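(* Let $\mathbb{K}$ be an algebraically closed field of characteristic zero. Then every trinomial hypersurface over $\mathbb{K}$ which, up to a permutation of the variables (and of the three monomials), is of one of the following types is flexible (here all exponents $l_{ij}$ and all $m_{ij}$ are arbitrary positive integers): $H_1$: $\mathbb{V}\left(T_0^{l_0}+T_1^{l_1}+T_{21}T_{22}\cdots T_{2n_2}\right)$, with $n_0\ge 0$, $n_1,n_2\ge 1$; $H_2$: $\mathbb{V}\left(T_{01}^2T_{02}^2\cdots T_{0n_0}^2+T_{11}^2T_{12}^2\cdots T_{1n_1}^2+T_2^{l_2}\right)$, with $n_0,n_1,n_2\ge 1$; $H_3$: $\mathbb{V}\left(T_0^{l_0}+T_{11}T_{12}^{l_{12}}\cdots T_{1n_1}^{l_{1n_1}}+T_{21}T_{22}^{l_{22}}\cdots T_{2n_2}^{l_{2n_2}}\right)$, with $n_0\ge 0$, $n_1,n_2\ge 1$; $H_4$: $\mathbb{V}\left(T_{01}T_{02}^{l_{02}}\cdots T_{0n_0}^{l_{0n_0}}+T_{11}^2T_{12}^{2m_{12}}\cdots T_{1n_1}^{2m_{1n_1}}+T_{21}^2T_{22}^{2m_{22}}\cdots T_{2n_2}^{2m_{2n_2}}\right)$, with $n_0,n_1,n_2\ge 1$; $H_5$: $\mathbb{V}\left(T_{01}^2T_{02}^{2m_{02}}\cdots T_{0n_0}^{2m_{0n_0}}+T_{11}^2T_{12}^{2m_{12}}\cdots T_{1n_1}^{2m_{1n_1}}+T_{21}^2T_{22}^{2m_{22}}\cdots T_{2n_2}^{2m_{2n_2}}\right)$,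 with $n_0,n_1,n_2\ge 1$.
   Context: Here $T_i^{l_i}=T_{i1}^{l_{i1}}\cdots T_{in_i}^{l_{in_i}}$ (equal to $1$ if $n_i=0$), the $T_{ij}$ ($i\in\{0,1,2\}$, $1\le j\le n_i$) are the coordinates on $\mathbb{K}^{n_0+n_1+n_2}$, and $\mathbb{V}(g)$ denotes the zero locus of $g$ in $\mathbb{K}^{n_0+n_1+n_2}$. A trinomial hypersurface is a hypersurface $\mathbb{V}(T_0^{l_0}+T_1^{l_1}+T_2^{l_2})$ with $n_0\ge 0$, $n_1,n_2\ge 1$ and all $l_{ij}$ positive integers; it is known to be irreducible and normal. Let $\mathbb{G}_a$ be the additive group of $\mathbb{K}$. An affine variety $X$ is flexible if for every regular (smooth) point $x\in X$ the tangent space $T_xX$ is spanned by tangent vectors at $x$ to $\mathbb{G}_a$-orbits for various regular $\mathbb{G}_a$-actions on $X$. (For irreducible $X$ of dimension $\ge 2$ this is known to be equivalent to transitivity on the smooth locus of the subgroup $\mathrm{SAut}(X)\subset\mathrm{Aut}(X)$ generated by all algebraic subgroups isomorphic to $\mathbb{G}_a$.) *)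

theory Defs
  imports
    "HOL-Computational_Algebra.Polynomial"
    "HOL-Library.Poly_Mapping"
    "HOL-Library.Extended_Nat"
    "HOL-Library.Function_Algebras"
    "HOL-Combinatorics.Permutations"
begin

section \<open>Polynomials in several variables\<close>

type_synonym ('v, 'a) mpol = "('v \<Rightarrow>\<^sub>0 nat) \<Rightarrow>\<^sub>0 'a"

definition mvar :: "'v \<Rightarrow> ('v, 'a::comm_semiring_1) mpol" where
  "mvar i = Poly_Mapping.single (Poly_Mapping.single i 1) 1"

definition mvars :: "('v, 'a::zero) mpol \<Rightarrow> 'v set" where
  "mvars p = (\<Union>m\<in>Poly_Mapping.keys p. Poly_Mapping.keys m)"

definition meval :: "('v, 'a::comm_semiring_1) mpol \<Rightarrow> ('v \<Rightarrow> 'a) \<Rightarrow> 'a" where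
  "meval p x = (\<Sum>m\<in>Poly_Mapping.keys p. Poly_Mapping.lookup p m *
     (\<Prod>i\<in>Poly_Mapping.keys m. x i ^ Poly_Mapping.lookup m i))"

definition mpderiv :: "'v \<Rightarrow> ('v, 'a::comm_semiring_1) mpol \<Rightarrow> ('v, 'a) mpol" where
  "mpderiv i p = (\<Sum>m\<in>Poly_Mapping.keys p.
     Poly_Mapping.single (m - Poly_Mapping.single i 1)
       (of_nat (Poly_Mapping.lookup m i) * Poly_Mapping.lookup p m))"

section \<open>Affine varieties\<close>

text \<open>The affine space with coordinates indexed by a finite set \<open>I\<close> consists of the families
  that vanish outside \<open>I\<close>; it is thus a linear subspace of the full function space.\<close>

definition affine_space :: "'v set \<Rightarrow> ('v \<Rightarrow> 'a::zero) set" where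
  "affine_space I = {x. \<forall>i. i \<notin> I \<longrightarrow> x i = 0}"

definition zero_locus :: "'v set \<Rightarrow> ('v, 'a::comm_semiring_1) mpol set \<Rightarrow> ('v \<Rightarrow> 'a) set" where
  "zero_locus I S = {x \<in> affine_space I. \<forall>f\<in>S. meval f x = 0}"

definition zariski_closed :: "'v set \<Rightarrow> ('v \<Rightarrow> 'a::comm_semiring_1) set \<Rightarrow> bool" where
  "zariski_closed I X \<longleftrightarrow> (\<exists>S. (\<forall>f\<in>S. mvars f \<subseteq> I) \<and> X = zero_locus I S)"

definition irreducible_closed :: "'v set \<Rightarrow> ('v \<Rightarrow> 'a::comm_semiring_1) set \<Rightarrow> bool" where
  "irreducible_closed I X \<longleftrightarrow> zariski_closed I X \<and> X \<noteq> {} \<and>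
     (\<forall>A B. zariski_closed I A \<and> zariski_closed I B \<and> X = A \<union> B \<longrightarrow> X = A \<or> X = B)"

definition vanishing_ideal :: "'v set \<Rightarrow> ('v \<Rightarrow> 'a::comm_semiring_1) set \<Rightarrow> ('v, 'a) mpol set" where
  "vanishing_ideal I X = {f. mvars f \<subseteq> I \<and> (\<forall>x\<in>X. meval f x = 0)}"

text \<open>The dimension of \<open>X\<close> at \<open>x\<close> is the Krull dimension of the local ring of \<open>X\<close> at \<open>x\<close>,
  expressed through chains of irreducible closed subsets of \<open>X\<close> containing \<open>x\<close>. For
  irreducible \<open>X\<close> it does not depend on \<open>x\<close> and equals the dimension of \<open>X\<close>.\<close>

definition local_dim :: "'v set \<Rightarrow> ('v \<Rightarrow> 'a::comm_semiring_1) set \<Rightarrow> ('v \<Rightarrow> 'a) \<Rightarrow> enat" where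
  "local_dim I X x = Sup {enat k | k. \<exists>Z :: nat \<Rightarrow> ('v \<Rightarrow> 'a) set.
     (\<forall>i\<le>k. irreducible_closed I (Z i) \<and> x \<in> Z i \<and> Z i \<subseteq> X) \<and>
     (\<forall>i<k. Z i \<subset> Z (Suc i))}"

definition fscale :: "'a::field \<Rightarrow> ('v \<Rightarrow> 'a) \<Rightarrow> 'v \<Rightarrow> 'a" where
  "fscale c v = (\<lambda>i. c * v i)"

global_interpretation fvec: vector_space "fscale :: 'a::field \<Rightarrow> ('v \<Rightarrow> 'a) \<Rightarrow> 'v \<Rightarrow> 'a"
  defines fspan = fvec.span and fdim = fvec.dim
  by unfold_locales (auto simp: fscale_def fun_eq_iff algebra_simps)

definition tangent_space ::
    "'v set \<Rightarrow> ('v \<Rightarrow> 'a::field) set \<Rightarrow> ('v \<Rightarrow> 'a) \<Rightarrow> ('v \<Rightarrow> 'a) set" where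
  "tangent_space I X x = {v \<in> affine_space I.
     \<forall>f\<in>vanishing_ideal I X. (\<Sum>i\<in>I. meval (mpderiv i f) x * v i) = 0}"

definition regular_point :: "'v set \<Rightarrow> ('v \<Rightarrow> 'a::field) set \<Rightarrow> ('v \<Rightarrow> 'a) \<Rightarrow> bool" where
  "regular_point I X x \<longleftrightarrow> x \<in> X \<and> enat (fdim (tangent_space I X x)) = local_dim I X x"

section \<open>Actions of the additive group and flexibility\<close>

text \<open>The map from the product of the affine line with \<open>X\<close> to \<open>X\<close> is regular if its
  coordinates are restrictions of polynomials in the coordinates of \<open>X\<close>
  (indexed by \<open>Some i\<close>) and the parameter \<open>t\<close> (indexed by \<open>None\<close>).\<close>

definition regular_Ga_action ::
    "'v set \<Rightarrow> ('v \<Rightarrow> 'a::field) set \<Rightarrow> ('a \<Rightarrow> ('v \<Rightarrow> 'a) \<Rightarrow> 'v \<Rightarrow> 'a) \<Rightarrow> bool" where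
  "regular_Ga_action I X \<phi> \<longleftrightarrow>
     (\<forall>t. \<forall>x\<in>X. \<phi> t x \<in> X) \<and>
     (\<forall>x\<in>X. \<phi> 0 x = x) \<and>
     (\<forall>s t. \<forall>x\<in>X. \<phi> (s + t) x = \<phi> s (\<phi> t x)) \<and>
     (\<forall>i\<in>I. \<exists>F :: ('v option, 'a) mpol. mvars F \<subseteq> insert None (Some ` I) \<and>
        (\<forall>t. \<forall>x\<in>X. \<phi> t x i = meval F (case_option t x)))"

text \<open>\<open>v\<close> is the derivative at parameter 0 of the polynomial curve \<open>c\<close>. Over an infinite field the
  polynomials \<open>p\<close>, hence \<open>v\<close>, are determined by \<open>c\<close>.\<close>

definition velocity_at_0 :: "('a::field \<Rightarrow> 'v \<Rightarrow> 'a) \<Rightarrow> ('v \<Rightarrow> 'a) \<Rightarrow> bool" where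
  "velocity_at_0 c v \<longleftrightarrow>
     (\<forall>i. \<exists>p. (\<forall>t. c t i = poly p t) \<and> v i = poly (pderiv p) 0)"

definition Ga_orbit_tangents ::
    "'v set \<Rightarrow> ('v \<Rightarrow> 'a::field) set \<Rightarrow> ('v \<Rightarrow> 'a) \<Rightarrow> ('v \<Rightarrow> 'a) set" where
  "Ga_orbit_tangents I X x =
     {v. \<exists>\<phi>. regular_Ga_action I X \<phi> \<and> velocity_at_0 (\<lambda>t. \<phi> t x) v}"

definition flexible :: "'v set \<Rightarrow> ('v \<Rightarrow> 'a::field) set \<Rightarrow> bool" where
  "flexible I X \<longleftrightarrow> finite I \<and> zariski_closed I X \<and>
     (\<forall>x. regular_point I X x \<longrightarrow> fspan (Ga_orbit_tangents I X x) = tangent_space I X x)"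

section \<open>Trinomial hypersurfaces\<close>

text \<open>Only the values \<open>n i\<close> for \<open>i \<le> 2\<close> and \<open>l i j\<close> for \<open>i \<le> 2\<close>, \<open>1 \<le> j \<le> n i\<close> are relevant.\<close>

definition trinomial_data :: "(nat \<Rightarrow> nat) \<Rightarrow> (nat \<Rightarrow> nat \<Rightarrow> nat) \<Rightarrow> bool" where
  "trinomial_data n l \<longleftrightarrow> n 1 \<ge> 1 \<and> n 2 \<ge> 1 \<and> (\<forall>i\<in>{0..2}. \<forall>j\<in>{1..n i}. l i j \<ge> 1)"

definition trinomial_vars :: "(nat \<Rightarrow> nat) \<Rightarrow> (nat \<times> nat) set" where
  "trinomial_vars n = (SIGMA i:{0..2}. {1..n i})"

definition trinomial ::
    "(nat \<Rightarrow> nat) \<Rightarrow> (nat \<Rightarrow> nat \<Rightarrow> nat) \<Rightarrow> (nat \<times> nat, 'a::comm_semiring_1) mpol" where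
  "trinomial n l = (\<Sum>i\<in>{0..2}. \<Prod>j\<in>{1..n i}. mvar (i, j) ^ l i j)"

definition trinomial_hypersurface ::
    "(nat \<Rightarrow> nat) \<Rightarrow> (nat \<Rightarrow> nat \<Rightarrow> nat) \<Rightarrow> (nat \<times> nat \<Rightarrow> 'a::comm_semiring_1) set" where
  "trinomial_hypersurface n l = zero_locus (trinomial_vars n) {trinomial n l}"

text \<open>Equality of the data up to a permutation \<open>\<pi>\<close> of the three monomials and renumberings \<open>\<sigma> i\<close>
  of the variables within each monomial.\<close>

definition permuted_data ::
    "(nat \<Rightarrow> nat) \<Rightarrow> (nat \<Rightarrow> nat \<Rightarrow> nat) \<Rightarrow> (nat \<Rightarrow> nat) \<Rightarrow> (nat \<Rightarrow> nat \<Rightarrow> nat) \<Rightarrow> bool" where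
  "permuted_data n l n' l' \<longleftrightarrow> (\<exists>\<pi> \<sigma>. \<pi> permutes {0..2} \<and>
     (\<forall>i\<in>{0..2}. bij_betw (\<sigma> i) {1..n i} {1..n' (\<pi> i)} \<and>
        (\<forall>j\<in>{1..n i}. l' (\<pi> i) (\<sigma> i j) = l i j)))"

definition type_H1 :: "(nat \<Rightarrow> nat) \<Rightarrow> (nat \<Rightarrow> nat \<Rightarrow> nat) \<Rightarrow> bool" where
  "type_H1 n l \<longleftrightarrow> trinomial_data n l \<and> (\<forall>j\<in>{1..n 2}. l 2 j = 1)"

definition type_H2 :: "(nat \<Rightarrow> nat) \<Rightarrow> (nat \<Rightarrow> nat \<Rightarrow> nat) \<Rightarrow> bool" where
  "type_H2 n l \<longleftrightarrow> trinomial_data n l \<and> n 0 \<ge> 1 \<and>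
     (\<forall>j\<in>{1..n 0}. l 0 j = 2) \<and> (\<forall>j\<in>{1..n 1}. l 1 j = 2)"

definition type_H3 :: "(nat \<Rightarrow> nat) \<Rightarrow> (nat \<Rightarrow> nat \<Rightarrow> nat) \<Rightarrow> bool" where
  "type_H3 n l \<longleftrightarrow> trinomial_data n l \<and> l 1 1 = 1 \<and> l 2 1 = 1"

definition type_H4 :: "(nat \<Rightarrow> nat) \<Rightarrow> (nat \<Rightarrow> nat \<Rightarrow> nat) \<Rightarrow> bool" where
  "type_H4 n l \<longleftrightarrow> trinomial_data n l \<and> n 0 \<ge> 1 \<and> l 0 1 = 1 \<and>
     (\<forall>i\<in>{1..2}. l i 1 = 2 \<and> (\<forall>j\<in>{2..n i}. even (l i j)))"

definition type_H5 :: "(nat \<Rightarrow> nat) \<Rightarrow> (nat \<Rightarrow> nat \<Rightarrow> nat) \<Rightarrow> bool" where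
  "type_H5 n l \<longleftrightarrow> trinomial_data n l \<and> n 0 \<ge> 1 \<and>
     (\<forall>i\<in>{0..2}. l i 1 = 2 \<and> (\<forall>j\<in>{2..n i}. even (l i j)))"

end

theory Submission
  imports Defs
begin

text \<open>Let \<open>f\<close> be the trinomial and \<open>G\<close> its gradient. The Nullstellensatz for \<open>f\<close>, which follows
  from pseudo-division in one variable, and the bound on chains of irreducible closed sets show that
  \<open>G x \<noteq> 0\<close> at every regular point \<open>x\<close>; then the tangent space is contained in the kernel of \<open>G x\<close>.
  This kernel is spanned by the vectors \<open>R i j = G i * unit j - G j * unit i\<close>. Such a vector is an
  orbit tangent if \<open>i\<close> is a variable of exponent one and \<open>j\<close> occurs in another monomial, and, up to
  a factor, a sum of two orbit tangents if \<open>i\<close> and some variable of a second monomial are squared,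
  the other exponents in these two monomials are even, and \<open>j\<close> occurs in the third monomial.

  Actions conjugate by elements of the group generated by all actions, so it suffices to treat
  one point of each orbit. On an orbit the product of polynomials that do not vanish identically
  does not vanish identically. Hence one can look at the coordinates one by one, and the vectors
  \<open>R i j\<close> suffice to show that no coordinate vanishes identically on the orbit of a point with
  \<open>G x \<noteq> 0\<close>. At a point with all coordinates nonzero all entries of \<open>G\<close> are nonzero and the
  \<open>R i j\<close> available for each of the five types link all variables.\<close>

section \<open>Polynomial functions\<close>

text \<open>Orbit tangents are scarce at special points: where several coordinates vanish, many
  entries of \<open>grad\<close> can vanish, and the vectors \<open>rot i j\<close> at hand no
  longer span. This is why every smooth point is moved before anything is spanned. Moving is
  possible because smoothness already carries information about coordinates. A nonzero partial
  derivative with respect to \<open>w\<close> forces all coordinates in its monomial to be nonzero,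
  unless \<open>w\<close> has exponent one; a nonzero monomial forces a second nonzero one, since
  the three add up to zero; and nonzero monomials supply the nonzero entries of \<open>grad\<close>
  that push the remaining coordinates away from zero. Squared variables cost most. Their actions
  come from factoring a sum of two squares with a square root of -1, and adding the tangents for
  both square roots leaves a multiple of \<open>rot i w\<close> whose factor is the square root of a
  cofactor. The vector is thus obtained only where that cofactor is nonzero, and the order in which
  coordinates are made nonzero has to respect this.\<close>

definition monom_eval :: "('v \<Rightarrow>\<^sub>0 nat) \<Rightarrow> ('v \<Rightarrow> 'a::comm_semiring_1) \<Rightarrow> 'a" where
  "monom_eval m x = (\<Prod>i\<in>Poly_Mapping.keys m. x i ^ Poly_Mapping.lookup m i)"

lemma monom_eval_superset:
  assumes "finite I" "Poly_Mapping.keys m \<subseteq> I"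
  shows "monom_eval m x = (\<Prod>i\<in>I. x i ^ Poly_Mapping.lookup m i)"
  unfolding monom_eval_def
  by (rule prod.mono_neutral_left[OF assms]) (auto simp: in_keys_iff)

lemma monom_eval_add: "monom_eval (m + m') x = monom_eval m x * monom_eval m' x"
proof -
  let ?K = "Poly_Mapping.keys m \<union> Poly_Mapping.keys m'"
  have "monom_eval k x = (\<Prod>i\<in>?K. x i ^ Poly_Mapping.lookup k i)" if "k \<in> {m, m', m + m'}" for k
    by (rule monom_eval_superset) (use that keys_add[of m m'] in auto)
  then show ?thesis
    by (simp add: lookup_add power_add prod.distrib)
qed

lemma meval_superset:
  assumes "finite S" "Poly_Mapping.keys p \<subseteq> S"
  shows "meval p x = (\<Sum>m\<in>S. Poly_Mapping.lookup p m * monom_eval m x)"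
  unfolding meval_def monom_eval_def
  by (rule sum.mono_neutral_left[OF assms]) (auto simp: in_keys_iff)

lemma meval_monom_eval:
  "meval p x = (\<Sum>m\<in>Poly_Mapping.keys p. Poly_Mapping.lookup p m * monom_eval m x)"
  by (rule meval_superset) auto

lemma meval_add: "meval (p + q) x = meval p x + meval q x"
proof -
  let ?K = "Poly_Mapping.keys p \<union> Poly_Mapping.keys q"
  have "meval r x = (\<Sum>m\<in>?K. Poly_Mapping.lookup r m * monom_eval m x)" if "r \<in> {p, q, p + q}" for r
    by (rule meval_superset) (use that keys_add[of p q] in auto)
  then show ?thesis
    by (simp add: lookup_add algebra_simps sum.distrib)
qed

lemma meval_zero [simp]: "meval 0 x = 0"
  by (simp add: meval_def)

lemma meval_sum: "meval (sum f S) x = (\<Sum>s\<in>S. meval (f s) x)"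
  by (induction S rule: infinite_finite_induct) (auto simp: meval_add)

lemma meval_single: "meval (Poly_Mapping.single m c) x = c * monom_eval m x"
  by (simp add: meval_def monom_eval_def)

lemma mpol_sum_singles:
  "p = (\<Sum>m\<in>Poly_Mapping.keys p. Poly_Mapping.single m (Poly_Mapping.lookup p m))"
  by (rule poly_mapping_eqI)
     (simp add: lookup_sum lookup_single when_def in_keys_iff)

lemma mpol_times_expand:
  "p * q = (\<Sum>m\<in>Poly_Mapping.keys p. \<Sum>m'\<in>Poly_Mapping.keys q.
      Poly_Mapping.single (m + m') (Poly_Mapping.lookup p m * Poly_Mapping.lookup q m'))"
  for p q :: "('v, 'a::comm_semiring_1) mpol"
  by (subst mpol_sum_singles[of p], subst mpol_sum_singles[of q])
     (simp add: sum_product mult_single)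

lemma meval_mult: "meval (p * q) x = meval p x * meval q x"
  unfolding mpol_times_expand[of p q]
  by (simp add: meval_sum meval_single monom_eval_add meval_monom_eval[of p]
      meval_monom_eval[of q] sum_product algebra_simps)

lemma mvars_add: "mvars (p + q) \<subseteq> mvars p \<union> mvars q"
  using keys_add[of p q] by (auto simp: mvars_def)

lemma mvars_mult: "mvars (p * q) \<subseteq> mvars p \<union> mvars q"
  using keys_mult[of p q] keys_add by (fastforce simp: mvars_def)

text \<open>Tangent spaces speak of formal polynomials, but identities such as divisibility by the
  trinomial are easier to prove pointwise. The set \<open>I\<close> records which variables may
  occur, which matters when a remainder must not involve a given variable.\<close>

definition polyfun :: "'v set \<Rightarrow> (('v \<Rightarrow> 'a::comm_semiring_1) \<Rightarrow> 'a) \<Rightarrow> bool" where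
  "polyfun I F \<longleftrightarrow> (\<exists>p. mvars p \<subseteq> I \<and> F = meval p)"

lemma polyfun_meval: "mvars p \<subseteq> I \<Longrightarrow> polyfun I (meval p)"
  by (auto simp: polyfun_def)

lemma polyfunE:
  assumes "polyfun I F"
  obtains p where "mvars p \<subseteq> I" "F = meval p"
  using assms by (auto simp: polyfun_def)

lemma polyfun_const [intro]: "polyfun I (\<lambda>x. c)"
proof -
  have "mvars (Poly_Mapping.single 0 c) \<subseteq> I" "(\<lambda>x. c) = meval (Poly_Mapping.single 0 c)"
    by (auto simp: mvars_def fun_eq_iff meval_single monom_eval_def split: if_splits)
  then show ?thesis unfolding polyfun_def by blast
qed

lemma meval_mvar: "meval (mvar i) x = x i"
  by (simp add: mvar_def meval_single monom_eval_def)

lemma mvars_mvar: "mvars (mvar i :: ('v, 'a::comm_semiring_1) mpol) = {i}"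
  by (simp add: mvar_def mvars_def)

lemma polyfun_var [intro]: "i \<in> I \<Longrightarrow> polyfun I (\<lambda>x. x i)"
  unfolding polyfun_def by (intro exI[of _ "mvar i"]) (auto simp: mvars_mvar meval_mvar fun_eq_iff)

lemma polyfun_add [intro]:
  assumes "polyfun I F" "polyfun I G" shows "polyfun I (\<lambda>x. F x + G x)"
proof -
  obtain p q where "mvars p \<subseteq> I" "F = meval p" "mvars q \<subseteq> I" "G = meval q"
    using assms by (auto simp: polyfun_def)
  then show ?thesis
    unfolding polyfun_def using mvars_add[of p q]
    by (intro exI[of _ "p + q"]) (auto simp: meval_add fun_eq_iff)
qed

lemma polyfun_mult [intro]:
  assumes "polyfun I F" "polyfun I G" shows "polyfun I (\<lambda>x. F x * G x)"
proof -
  obtain p q where "mvars p \<subseteq> I" "F = meval p" "mvars q \<subseteq> I" "G = meval q"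
    using assms by (auto simp: polyfun_def)
  then show ?thesis
    unfolding polyfun_def using mvars_mult[of p q]
    by (intro exI[of _ "p * q"]) (auto simp: meval_mult fun_eq_iff)
qed

lemma polyfun_uminus [intro]: "polyfun I F \<Longrightarrow> polyfun I (\<lambda>x. - F x :: 'a::comm_ring_1)"
  using polyfun_mult[OF polyfun_const[of I "-1"], of F] by simp

lemma polyfun_diff [intro]:
  "polyfun I F \<Longrightarrow> polyfun I G \<Longrightarrow> polyfun I (\<lambda>x. F x - G x :: 'a::comm_ring_1)"
  using polyfun_add[OF _ polyfun_uminus, of I F G] by simp

lemma polyfun_power [intro]: "polyfun I F \<Longrightarrow> polyfun I (\<lambda>x. F x ^ n)"
  by (induction n) auto

lemma polyfun_sum [intro]: "(\<And>s. s \<in> S \<Longrightarrow> polyfun I (F s)) \<Longrightarrow> polyfun I (\<lambda>x. \<Sum>s\<in>S. F s x)"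
  by (induction S rule: infinite_finite_induct) auto

lemma polyfun_prod [intro]: "(\<And>s. s \<in> S \<Longrightarrow> polyfun I (F s)) \<Longrightarrow> polyfun I (\<lambda>x. \<Prod>s\<in>S. F s x)"
  by (induction S rule: infinite_finite_induct) auto

text \<open>Monomials arise from constants by multiplication with single variables, so no case for
  general products is needed. The facts \<open>pw\<close>, \<open>mon\<close> and \<open>sm\<close>
  build powers, monomials and sums; they carry \<open>polyfun\<close> along because the cases
  \<open>add\<close> and \<open>var\<close> assume it.\<close>

lemma polyfun_induct [consumes 1, case_names const add var]:
  assumes "polyfun I F"
    and const: "\<And>c. P (\<lambda>x. c)"
    and add: "\<And>F G. polyfun I F \<Longrightarrow> polyfun I G \<Longrightarrow> P F \<Longrightarrow> P G \<Longrightarrow> P (\<lambda>x. F x + G x)"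
    and var: "\<And>F i. polyfun I F \<Longrightarrow> P F \<Longrightarrow> i \<in> I \<Longrightarrow> P (\<lambda>x. x i * F x)"
  shows "P F"
proof -
  obtain p where p: "mvars p \<subseteq> I" "F = meval p"
    using assms(1) by (rule polyfunE)
  have pw: "P (\<lambda>x. x i ^ k * F x) \<and> polyfun I (\<lambda>x. x i ^ k * F x)"
    if "P F" "polyfun I F" "i \<in> I" for i k F
    using that
  proof (induction k)
    case (Suc k)
    then show ?case using var[of "\<lambda>x. x i ^ k * F x" i] by (auto simp: mult.assoc)
  qed auto
  have mon: "P (\<lambda>x. c * (\<Prod>i\<in>K. x i ^ n i)) \<and> polyfun I (\<lambda>x. c * (\<Prod>i\<in>K. x i ^ n i))"
    if "finite K" "K \<subseteq> I" for K c and n :: "'a \<Rightarrow> nat"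
    using that
  proof (induction K)
    case (insert i K)
    then show ?case using pw[of "\<lambda>x. c * (\<Prod>i\<in>K. x i ^ n i)" i "n i"]
      by (auto simp: algebra_simps)
  qed (auto simp: const)
  have sm: "P (\<lambda>x. \<Sum>m\<in>M. Poly_Mapping.lookup p m * monom_eval m x) \<and>
      polyfun I (\<lambda>x. \<Sum>m\<in>M. Poly_Mapping.lookup p m * monom_eval m x)"
    if "finite M" "M \<subseteq> Poly_Mapping.keys p" for M
    using that
  proof (induction M)
    case (insert m M)
    have "Poly_Mapping.keys m \<subseteq> I" using insert.prems p(1) by (auto simp: mvars_def)
    from mon[OF finite_keys this, of "Poly_Mapping.lookup p m" "Poly_Mapping.lookup m"]
    show ?case using insert
        add[of "\<lambda>x. Poly_Mapping.lookup p m * monom_eval m x" "\<lambda>x. \<Sum>m\<in>M. Poly_Mapping.lookup p m * monom_eval m x"]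
      by (auto simp: monom_eval_def)
  qed (auto simp: const)
  from sm[of "Poly_Mapping.keys p"] show ?thesis
    by (simp add: p(2) meval_monom_eval[abs_def])
qed

lemma polyfun_mono: "polyfun I F \<Longrightarrow> I \<subseteq> J \<Longrightarrow> polyfun J F"
  by (auto simp: polyfun_def)

lemma polyfun_cong:
  assumes "polyfun I F" "\<And>i. i \<in> I \<Longrightarrow> x i = y i"
  shows "F x = F y"
  using assms by (induction rule: polyfun_induct) auto

lemma polyfun_subst:
  assumes "polyfun I F" "\<And>i. i \<in> I \<Longrightarrow> polyfun J (G i)"
  shows "polyfun J (\<lambda>x. F (\<lambda>i. G i x))"
  using assms by (induction rule: polyfun_induct) auto

lemma polyfun_along_curve:
  fixes F :: "('v \<Rightarrow> 'a::comm_ring_1) \<Rightarrow> 'a"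
  assumes "polyfun I F" "\<And>i. i \<in> I \<Longrightarrow> \<exists>p. \<forall>t. c t i = poly p t"
  shows "\<exists>p. \<forall>t. F (c t) = poly p t"
  using assms
proof (induction rule: polyfun_induct)
  case (const k)
  show ?case by (intro exI[of _ "[:k:]"]) auto
next
  case (add F G)
  then obtain p q where "\<forall>t. F (c t) = poly p t" "\<forall>t. G (c t) = poly q t" by blast
  then show ?case by (intro exI[of _ "p + q"]) simp
next
  case (var F i)
  then obtain p q where "\<forall>t. c t i = poly p t" "\<forall>t. F (c t) = poly q t" by blast
  then show ?case by (intro exI[of _ "p * q"]) simp
qed

text \<open>On the line through \<open>x0\<close> and \<open>x\<close> both factors become nonzero
  polynomials in one variable; their product is nonzero as well and has a non-root, the field being
  infinite.\<close>

lemma polyfun_mult_eq_0: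
  fixes p q :: "('v \<Rightarrow> 'a::field_char_0) \<Rightarrow> 'a"
  assumes "polyfun I p" "polyfun I q" "\<And>x. p x * q x = 0" "p x0 \<noteq> 0"
  shows "q x = 0"
proof (rule ccontr)
  assume "q x \<noteq> 0"
  define c where "c = (\<lambda>t i. x0 i + t * (x i - x0 i))"
  have c: "\<exists>p. \<forall>t. c t i = poly p t" for i
    by (rule exI[of _ "[:x0 i, x i - x0 i:]"]) (simp add: c_def algebra_simps)
  obtain P where P: "\<forall>t. p (c t) = poly P t" using polyfun_along_curve[where c = c, OF assms(1) c] by blast
  obtain Q where Q: "\<forall>t. q (c t) = poly Q t" using polyfun_along_curve[where c = c, OF assms(2) c] by blast
  note PQ = P[rule_format] Q[rule_format]
  have "c 0 = x0" "c 1 = x" by (auto simp: c_def)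
  then have "P \<noteq> 0" "Q \<noteq> 0" using PQ(1)[of 0] PQ(2)[of 1] assms(4) \<open>q x \<noteq> 0\<close> by auto
  then have "P * Q \<noteq> 0" by simp
  then obtain t where "poly (P * Q) t \<noteq> 0" using poly_all_0_iff_0 by blast
  then show False using assms(3)[of "c t"] PQ by simp
qed

lemma polyfun_split_var:
  fixes q :: "('v \<Rightarrow> 'a::comm_ring_1) \<Rightarrow> 'a"
  assumes "polyfun I q" "t \<in> I"
  shows "\<exists>r. polyfun I r \<and> (\<forall>x. q x = q (x(t := 0)) + x t * r x)"
  using assms
proof (induction rule: polyfun_induct)
  case (const c)
  show ?case by (intro exI[of _ "\<lambda>x. 0"]) auto
next
  case (add F G)
  then obtain r s where rs: "polyfun I r" "\<And>x. F x = F (x(t := 0)) + x t * r x"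
    "polyfun I s" "\<And>x. G x = G (x(t := 0)) + x t * s x" by blast
  show ?case
  proof (intro exI[of _ "\<lambda>x. r x + s x"] conjI allI)
    fix x show "F x + G x = F (x(t := 0)) + G (x(t := 0)) + x t * (r x + s x)"
      by (subst rs(2), subst rs(4)) (simp add: algebra_simps)
  qed (use rs in auto)
next
  case (var F i)
  then obtain r where r: "polyfun I r" "\<And>x. F x = F (x(t := 0)) + x t * r x" by blast
  show ?case
  proof (cases "i = t")
    case True
    then show ?thesis using var.hyps by (intro exI[of _ F]) auto
  next
    case False
    show ?thesis
    proof (intro exI[of _ "\<lambda>x. x i * r x"] conjI allI)
      fix x
      show "x i * F x = (x(t := 0)) i * F (x(t := 0)) + x t * (x i * r x)"
        by (subst r(2)) (use False in \<open>simp add: algebra_simps\<close>)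
    qed (use r var.hyps in auto)
  qed
qed

section \<open>Derivatives along polynomial curves\<close>

text \<open>Product rule. If \<open>i\<close> does not occur in \<open>m\<close>, the subtraction
  \<open>m - Poly_Mapping.single i 1\<close> is truncated, but then the factor
  \<open>of_nat (Poly_Mapping.lookup m i)\<close> is zero.\<close>

lemma monom_eval_along_curve_deriv:
  fixes q :: "'v \<Rightarrow> 'a::field poly"
  assumes "finite I" "Poly_Mapping.keys m \<subseteq> I" "\<And>i. i \<in> I \<Longrightarrow> x i = poly (q i) 0"
  shows "poly (pderiv (\<Prod>i\<in>I. q i ^ Poly_Mapping.lookup m i)) 0 =
    (\<Sum>i\<in>I. of_nat (Poly_Mapping.lookup m i) * monom_eval (m - Poly_Mapping.single i 1) x * poly (pderiv (q i)) 0)"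
  unfolding pderiv_prod poly_sum
proof (rule sum.cong)
  fix i assume i: "i \<in> I"
  let ?m = "Poly_Mapping.lookup m"
  have lk: "Poly_Mapping.lookup (m - Poly_Mapping.single i 1) j = (if j = i then ?m i - 1 else ?m j)" for j
    by (auto simp: lookup_minus lookup_single when_def)
  have "Poly_Mapping.keys (m - Poly_Mapping.single i 1) \<subseteq> I"
    using assms(2) by (auto simp: in_keys_iff lk simp del: One_nat_def split: if_splits)
  then have "monom_eval (m - Poly_Mapping.single i 1) x =
      (\<Prod>j\<in>I. x j ^ (if j = i then ?m i - 1 else ?m j))"
    by (subst monom_eval_superset[OF assms(1)]) (simp_all only: lk)
  also have "\<dots> = x i ^ (?m i - 1) * (\<Prod>j\<in>I - {i}. x j ^ ?m j)"
    by (subst prod.remove[OF assms(1) i]) simp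
  finally have e: "monom_eval (m - Poly_Mapping.single i 1) x = x i ^ (?m i - 1) * (\<Prod>j\<in>I - {i}. x j ^ ?m j)" .
  have "(\<Prod>j\<in>I - {i}. poly (q j) 0 ^ ?m j) = (\<Prod>j\<in>I - {i}. x j ^ ?m j)"
    by (rule prod.cong) (use assms(3) in auto)
  then show "poly ((\<Prod>j\<in>I - {i}. q j ^ ?m j) * pderiv (q i ^ ?m i)) 0 =
      of_nat (?m i) * monom_eval (m - Poly_Mapping.single i 1) x * poly (pderiv (q i)) 0"
    by (simp add: e[unfolded One_nat_def] pderiv_power poly_prod assms(3)[OF i] algebra_simps)
qed simp

definition mdiff :: "'v set \<Rightarrow> ('v, 'a::comm_semiring_1) mpol \<Rightarrow> ('v \<Rightarrow> 'a) \<Rightarrow> ('v \<Rightarrow> 'a) \<Rightarrow> 'a" where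
  "mdiff I p x v = (\<Sum>i\<in>I. meval (mpderiv i p) x * v i)"

lemma meval_along_curve_deriv:
  fixes c :: "'a::field \<Rightarrow> 'v \<Rightarrow> 'a"
  assumes "finite I" "mvars p \<subseteq> I" "velocity_at_0 c v"
  shows "\<exists>P. (\<forall>t. meval p (c t) = poly P t) \<and> poly (pderiv P) 0 = mdiff I p (c 0) v"
proof -
  obtain q where q: "\<And>i t. c t i = poly (q i) t" "\<And>i. v i = poly (pderiv (q i)) 0"
    using assms(3) unfolding velocity_at_0_def by metis
  let ?l = "Poly_Mapping.lookup p"
  have km: "Poly_Mapping.keys m \<subseteq> I" if "m \<in> Poly_Mapping.keys p" for m
    using that assms(2) by (auto simp: mvars_def)
  define P where "P = (\<Sum>m\<in>Poly_Mapping.keys p. smult (?l m) (\<Prod>i\<in>I. q i ^ Poly_Mapping.lookup m i))"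
  have "meval p (c t) = poly P t" for t
    by (simp add: meval_monom_eval P_def poly_sum poly_prod q
        monom_eval_superset[OF assms(1) km] cong: sum.cong)
  moreover have "poly (pderiv P) 0 = mdiff I p (c 0) v"
  proof -
    have "poly (pderiv P) 0 = (\<Sum>m\<in>Poly_Mapping.keys p. ?l m *
       (\<Sum>i\<in>I. of_nat (Poly_Mapping.lookup m i) * monom_eval (m - Poly_Mapping.single i 1) (c 0) * v i))"
      unfolding P_def higher_pderiv_sum[of 1, simplified] poly_sum pderiv_smult poly_smult
      by (rule sum.cong)
        (simp_all add: monom_eval_along_curve_deriv[where x="c 0", OF assms(1) km] q(1,2))
    also have "\<dots> = (\<Sum>i\<in>I. \<Sum>m\<in>Poly_Mapping.keys p.
        of_nat (Poly_Mapping.lookup m i) * ?l m * monom_eval (m - Poly_Mapping.single i 1) (c 0) * v i)"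
      by (subst sum.swap) (simp add: sum_distrib_left algebra_simps)
    also have "\<dots> = mdiff I p (c 0) v"
      by (simp add: mdiff_def mpderiv_def meval_sum meval_single sum_distrib_right)
    finally show ?thesis .
  qed
  ultimately show ?thesis by blast
qed

text \<open>This is how formal partial derivatives get evaluated: any polynomial \<open>P\<close>
  describing the values along the curve may be differentiated instead, since values determine a
  polynomial over an infinite field.\<close>

lemma mdiff_unique:
  fixes c :: "'a::field_char_0 \<Rightarrow> 'v \<Rightarrow> 'a"
  assumes "finite I" "mvars p \<subseteq> I" "velocity_at_0 c v" "\<And>t. meval p (c t) = poly P t"
  shows "mdiff I p (c 0) v = poly (pderiv P) 0"
proof -
  obtain Q where Q: "\<And>t. meval p (c t) = poly Q t" "poly (pderiv Q) 0 = mdiff I p (c 0) v"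
    using meval_along_curve_deriv[OF assms(1-3)] by blast
  have "poly P = poly Q" using Q(1) assms(4) by auto
  then have "P = Q" using poly_eq_poly_eq_iff by blast
  then show ?thesis using Q(2) by simp
qed

lemma velocity_line: "velocity_at_0 (\<lambda>t i. x i + t * v i) v"
  unfolding velocity_at_0_def
proof
  fix i
  show "\<exists>p. (\<forall>t. x i + t * v i = poly p t) \<and> v i = poly (pderiv p) 0"
    by (rule exI[of _ "[:x i, v i:]"]) (simp add: pderiv_pCons)
qed

lemma mdiff_line:
  fixes x v :: "'v \<Rightarrow> 'a::field_char_0"
  assumes "finite I" "mvars p \<subseteq> I" "\<And>t. meval p (\<lambda>i. x i + t * v i) = poly P t"
  shows "mdiff I p x v = poly (pderiv P) 0"
  using mdiff_unique[OF assms(1,2) velocity_line assms(3)] by simp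

lemma tangent_space_mdiff:
  "tangent_space I X x = {v \<in> affine_space I. \<forall>f\<in>vanishing_ideal I X. mdiff I f x v = 0}"
  by (simp add: tangent_space_def mdiff_def)

section \<open>Orbits of additive group actions\<close>

lemma subspace_tangent_space: "fvec.subspace (tangent_space I X x)"
proof (rule fvec.subspaceI)
  show "0 \<in> tangent_space I X x"
    by (simp add: tangent_space_def affine_space_def)
  show "v + w \<in> tangent_space I X x" if "v \<in> tangent_space I X x" "w \<in> tangent_space I X x" for v w
    using that by (simp add: tangent_space_def affine_space_def distrib_left sum.distrib)
  show "fscale c v \<in> tangent_space I X x" if "v \<in> tangent_space I X x" for c v
  proof -
    have "(\<Sum>i\<in>I. meval (mpderiv i f) x * fscale c v i) = c * (\<Sum>i\<in>I. meval (mpderiv i f) x * v i)" for f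
      by (simp add: fscale_def sum_distrib_left algebra_simps)
    then show ?thesis
      using that by (simp add: tangent_space_def affine_space_def) (simp add: fscale_def)
  qed
qed

text \<open>Polynomials vanishing on \<open>X\<close> are zero along an orbit, so their derivative
  in the direction of the velocity is zero. Coordinates outside \<open>I\<close> are treated
  separately because \<open>velocity_at_0\<close> speaks of all of them.\<close>

lemma Ga_orbit_tangents_subset:
  fixes X :: "('v \<Rightarrow> 'a::field_char_0) set"
  assumes "finite I" "X \<subseteq> affine_space I" "x \<in> X"
  shows "Ga_orbit_tangents I X x \<subseteq> tangent_space I X x"
proof
  fix v assume "v \<in> Ga_orbit_tangents I X x"
  then obtain \<phi> where \<phi>: "regular_Ga_action I X \<phi>" "velocity_at_0 (\<lambda>t. \<phi> t x) v"
    by (auto simp: Ga_orbit_tangents_def)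
  have X: "\<phi> t x \<in> X" "\<phi> 0 x = x" for t
    using \<phi>(1) assms(3) by (auto simp: regular_Ga_action_def)
  have "v i = 0" if "i \<notin> I" for i
  proof -
    obtain p where p: "\<And>t. \<phi> t x i = poly p t" "v i = poly (pderiv p) 0"
      using \<phi>(2) unfolding velocity_at_0_def by metis
    have "poly p t = 0" for t using X(1)[of t] assms(2) that p(1)[of t] by (auto simp: affine_space_def)
    then have "p = 0" using poly_all_0_iff_0 by blast
    then show ?thesis using p by simp
  qed
  moreover have "mdiff I f x v = 0" if "f \<in> vanishing_ideal I X" for f
  proof -
    have "mdiff I f (\<phi> 0 x) v = poly (pderiv 0) 0"
      by (rule mdiff_unique[OF assms(1) _ \<phi>(2)]) (use that X(1) in \<open>auto simp: vanishing_ideal_def\<close>)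
    then show ?thesis using X by simp
  qed
  ultimately show "v \<in> tangent_space I X x"
    by (auto simp: tangent_space_mdiff affine_space_def)
qed

lemma fspan_Ga_orbit_tangents_subset:
  fixes X :: "('v \<Rightarrow> 'a::field_char_0) set"
  assumes "finite I" "X \<subseteq> affine_space I" "x \<in> X"
  shows "fspan (Ga_orbit_tangents I X x) \<subseteq> tangent_space I X x"
  by (rule fvec.span_minimal[OF Ga_orbit_tangents_subset[OF assms] subspace_tangent_space])

lemma polyfun_subst_option:
  assumes "polyfun (insert None (Some ` I)) P" "polyfun J T" "\<And>i. i \<in> I \<Longrightarrow> polyfun J (G i)"
  shows "polyfun J (\<lambda>w. P (case_option (T w) (\<lambda>i. G i w)))"
proof -
  have "polyfun J (\<lambda>w. P (\<lambda>o'. (case o' of None \<Rightarrow> T | Some i \<Rightarrow> G i) w))"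
    by (rule polyfun_subst[OF assms(1)]) (use assms(2,3) in auto)
  also have "(\<lambda>w. P (\<lambda>o'. (case o' of None \<Rightarrow> T | Some i \<Rightarrow> G i) w)) = (\<lambda>w. P (case_option (T w) (\<lambda>i. G i w)))"
    by (intro ext arg_cong[where f = P]) (auto split: option.splits)
  finally show ?thesis .
qed

lemma regular_Ga_action_coords:
  assumes "regular_Ga_action I X \<phi>"
  obtains P where "\<And>i. i \<in> I \<Longrightarrow> polyfun (insert None (Some ` I)) (P i)"
    "\<And>i t x. i \<in> I \<Longrightarrow> x \<in> X \<Longrightarrow> \<phi> t x i = P i (case_option t x)"
proof -
  have "\<forall>i\<in>I. \<exists>F. polyfun (insert None (Some ` I)) F \<and> (\<forall>t. \<forall>x\<in>X. \<phi> t x i = F (case_option t x))"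
  proof
    fix i assume "i \<in> I"
    then obtain F where "mvars F \<subseteq> insert None (Some ` I)" "\<forall>t. \<forall>x\<in>X. \<phi> t x i = meval F (case_option t x)"
      using assms unfolding regular_Ga_action_def by blast
    then show "\<exists>F. polyfun (insert None (Some ` I)) F \<and> (\<forall>t. \<forall>x\<in>X. \<phi> t x i = F (case_option t x))"
      by (intro exI[of _ "meval F"]) (simp add: polyfun_meval)
  qed
  from bchoice[OF this] show ?thesis using that by blast
qed

lemma regular_Ga_action_in: "regular_Ga_action I X \<phi> \<Longrightarrow> x \<in> X \<Longrightarrow> \<phi> t x \<in> X"
  by (auto simp: regular_Ga_action_def)

lemma regular_Ga_action_0: "regular_Ga_action I X \<phi> \<Longrightarrow> x \<in> X \<Longrightarrow> \<phi> 0 x = x"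
  by (auto simp: regular_Ga_action_def)

lemma regular_Ga_action_inverse:
  assumes "regular_Ga_action I X \<phi>" "x \<in> X"
  shows "\<phi> (- s) (\<phi> s x) = x" "\<phi> s (\<phi> (- s) x) = x"
proof -
  have add: "\<phi> (a + b) x = \<phi> a (\<phi> b x)" for a b
    using assms by (simp add: regular_Ga_action_def)
  show "\<phi> (- s) (\<phi> s x) = x" "\<phi> s (\<phi> (- s) x) = x"
    using add[of "-s" s] add[of s "-s"] regular_Ga_action_0[OF assms] by simp_all
qed

text \<open>The group law survives because the inner pair \<open>\<phi> s\<close>,
  \<open>\<phi> (- s)\<close> cancels on \<open>X\<close>. Polynomiality is a threefold substitution
  in which only the middle parameter is variable.\<close>

lemma regular_Ga_action_conj:
  assumes \<phi>: "regular_Ga_action I X \<phi>" and \<psi>: "regular_Ga_action I X \<psi>"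
  shows "regular_Ga_action I X (\<lambda>t x. \<phi> (- s) (\<psi> t (\<phi> s x)))"
proof -
  obtain P where P: "\<And>i. i \<in> I \<Longrightarrow> polyfun (insert None (Some ` I)) (P i)"
    "\<And>i t x. i \<in> I \<Longrightarrow> x \<in> X \<Longrightarrow> \<phi> t x i = P i (case_option t x)"
    using regular_Ga_action_coords[OF \<phi>] by blast
  obtain R where R: "\<And>i. i \<in> I \<Longrightarrow> polyfun (insert None (Some ` I)) (R i)"
    "\<And>i t x. i \<in> I \<Longrightarrow> x \<in> X \<Longrightarrow> \<psi> t x i = R i (case_option t x)"
    using regular_Ga_action_coords[OF \<psi>] by blast
  \<comment> \<open>The polynomials \<open>P\<close> and \<open>R\<close> describe the actions only
    at indices in \<open>I\<close>, so the substituted points are compared by their agreement on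
    \<open>I\<close>.\<close>
  have cong: "F (case_option t x) = F (case_option t y)"
    if "polyfun (insert None (Some ` I)) F" "\<And>i. i \<in> I \<Longrightarrow> x i = y i"
    for F and x y :: "'a \<Rightarrow> 'b" and t
    by (rule polyfun_cong[OF that(1)]) (use that(2) in auto)
  note inn = regular_Ga_action_in[OF \<phi>] regular_Ga_action_in[OF \<psi>]
  have coord: "\<exists>F. mvars F \<subseteq> insert None (Some ` I) \<and>
      (\<forall>t. \<forall>x\<in>X. \<phi> (- s) (\<psi> t (\<phi> s x)) i = meval F (case_option t x))" if i: "i \<in> I" for i
  proof -
    let ?J = "insert None (Some ` I)"
    let ?F = "\<lambda>w. P i (case_option (- s) (\<lambda>j. R j (case_option (w None)
        (\<lambda>k. P k (case_option s (\<lambda>m. w (Some m)))))))"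
    have 1: "polyfun ?J (\<lambda>w. P k (case_option s (\<lambda>m. w (Some m))))" if "k \<in> I" for k
      by (rule polyfun_subst_option[OF P(1)[OF that]]) auto
    have 2: "polyfun ?J (\<lambda>w. R j (case_option (w None) (\<lambda>k. P k (case_option s (\<lambda>m. w (Some m))))))"
      if "j \<in> I" for j
      by (rule polyfun_subst_option[OF R(1)[OF that]]) (auto intro: 1)
    have "polyfun ?J ?F"
      by (rule polyfun_subst_option[OF P(1)[OF i]]) (auto intro: 2)
    then obtain F where F: "mvars F \<subseteq> ?J" "?F = meval F" by (rule polyfunE)
    have "\<phi> (- s) (\<psi> t (\<phi> s x)) i = meval F (case_option t x)" if x: "x \<in> X" for t x
    proof -
      have "\<phi> (- s) (\<psi> t (\<phi> s x)) i = P i (case_option (- s) (\<psi> t (\<phi> s x)))"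
        by (rule P(2)[OF i]) (intro inn x)
      also have "\<dots> = P i (case_option (- s) (\<lambda>j. R j (case_option t (\<phi> s x))))"
        by (rule cong[OF P(1)[OF i]]) (intro R(2) inn x)
      also have "\<dots> = P i (case_option (- s) (\<lambda>j. R j (case_option t (\<lambda>k. P k (case_option s x)))))"
        by (rule cong[OF P(1)[OF i]], rule cong[OF R(1)]) (auto intro: P(2) x)
      also have "\<dots> = ?F (case_option t x)" by simp
      also have "\<dots> = meval F (case_option t x)" by (simp only: F(2)[symmetric])
      finally show ?thesis .
    qed
    then show ?thesis using F(1) by blast
  qed
  have add: "\<psi> (a + b) y = \<psi> a (\<psi> b y)" if "y \<in> X" for a b y
    using \<psi> that by (simp add: regular_Ga_action_def)
  show ?thesis
    unfolding regular_Ga_action_def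
  proof (intro conjI allI ballI)
    fix x t s' assume x: "x \<in> X"
    show "\<phi> (- s) (\<psi> t (\<phi> s x)) \<in> X" by (intro inn x)
    show "\<phi> (- s) (\<psi> 0 (\<phi> s x)) = x"
      using regular_Ga_action_0[OF \<psi>] inn x regular_Ga_action_inverse[OF \<phi>] by simp
    show "\<phi> (- s) (\<psi> (s' + t) (\<phi> s x)) = \<phi> (- s) (\<psi> s' (\<phi> s (\<phi> (- s) (\<psi> t (\<phi> s x)))))"
      using inn x regular_Ga_action_inverse[OF \<phi>] add by simp
  qed (rule coord)
qed

definition mmap_diff :: "'v set \<Rightarrow> ('v \<Rightarrow> ('v, 'a::comm_semiring_1) mpol) \<Rightarrow> ('v \<Rightarrow> 'a) \<Rightarrow> ('v \<Rightarrow> 'a) \<Rightarrow> 'v \<Rightarrow> 'a" where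
  "mmap_diff I a x v = (\<lambda>i. if i \<in> I then mdiff I (a i) x v else 0)"

lemma velocity_mmap:
  fixes c :: "'a::field \<Rightarrow> 'v \<Rightarrow> 'a"
  assumes "finite I" "\<And>i. i \<in> I \<Longrightarrow> mvars (a i) \<subseteq> I" "velocity_at_0 c v"
  shows "velocity_at_0 (\<lambda>t i. if i \<in> I then meval (a i) (c t) else 0) (mmap_diff I a (c 0) v)"
  unfolding velocity_at_0_def
proof
  fix i
  show "\<exists>p. (\<forall>t. (if i \<in> I then meval (a i) (c t) else 0) = poly p t) \<and>
      mmap_diff I a (c 0) v i = poly (pderiv p) 0"
  proof (cases "i \<in> I")
    case True
    then show ?thesis
      using meval_along_curve_deriv[OF assms(1) assms(2)[OF True] assms(3)]
      by (auto simp: mmap_diff_def)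
  next
    case False
    then show ?thesis by (intro exI[of _ 0]) (simp add: mmap_diff_def)
  qed
qed

text \<open>Only the inclusion that can fail; the other one is
  \<open>fspan_Ga_orbit_tangents_subset\<close>.\<close>

definition spanned_at :: "'v set \<Rightarrow> ('v \<Rightarrow> 'a::field) set \<Rightarrow> ('v \<Rightarrow> 'a) \<Rightarrow> bool" where
  "spanned_at I X x \<longleftrightarrow> tangent_space I X x \<subseteq> fspan (Ga_orbit_tangents I X x)"

text \<open>The differential of \<open>\<phi> (- s)\<close> maps orbit tangents at \<open>\<phi> s x\<close> to tangents at \<open>x\<close>
  of orbits of the conjugate actions.\<close>

lemma spanned_at_transport:
  fixes X :: "('v \<Rightarrow> 'a::field_char_0) set"
  assumes I: "finite I" and XI: "X \<subseteq> affine_space I" and x: "x \<in> X"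
    and \<phi>: "regular_Ga_action I X \<phi>" and y: "spanned_at I X (\<phi> s x)"
  shows "spanned_at I X x"
proof -
  have "\<exists>a. \<forall>i\<in>I. mvars (a i) \<subseteq> I \<and> (\<forall>x\<in>X. \<phi> r x i = meval (a i) x)" for r
  proof -
    obtain P where P: "\<And>i. i \<in> I \<Longrightarrow> polyfun (insert None (Some ` I)) (P i)"
      "\<And>i t x. i \<in> I \<Longrightarrow> x \<in> X \<Longrightarrow> \<phi> t x i = P i (case_option t x)"
      using regular_Ga_action_coords[OF \<phi>] by blast
    have "\<exists>a. mvars a \<subseteq> I \<and> (\<forall>x\<in>X. \<phi> r x i = meval a x)" if i: "i \<in> I" for i
    proof -
      have "polyfun I (\<lambda>x. P i (case_option r (\<lambda>j. x j)))"
        by (rule polyfun_subst_option[OF P(1)[OF i]]) auto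
      then obtain a where "mvars a \<subseteq> I" "(\<lambda>x. P i (case_option r (\<lambda>j. x j))) = meval a"
        by (rule polyfunE)
      then show ?thesis using P(2)[OF i] by (intro exI[of _ a]) (simp add: fun_eq_iff)
    qed
    then show ?thesis by (intro bchoice) blast
  qed
  then have "\<forall>r. \<exists>a. \<forall>i\<in>I. mvars (a i) \<subseteq> I \<and> (\<forall>x\<in>X. \<phi> r x i = meval (a i) x)" ..
  from choice[OF this] obtain A where A: "\<And>r i. i \<in> I \<Longrightarrow> mvars (A r i) \<subseteq> I"
    "\<And>r i x. i \<in> I \<Longrightarrow> x \<in> X \<Longrightarrow> \<phi> r x i = meval (A r i) x" by blast
  define a b where "a = A s" and "b = A (- s)"
  note a = A[where r = s, folded a_def] and b = A[where r = "- s", folded b_def]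
  define m where "m = (\<lambda>(a :: 'v \<Rightarrow> ('v, 'a) mpol) x i. if i \<in> I then meval (a i) x else 0)"
  have m: "m (A r) x = \<phi> r x" if "x \<in> X" for r x
    using A(2)[OF _ that] regular_Ga_action_in[OF \<phi> that, of r] XI
    by (auto simp: m_def fun_eq_iff affine_space_def)
  note ma = m[where r = s, folded a_def] and mb = m[where r = "- s", folded b_def]
  note inn = regular_Ga_action_in[OF \<phi>]
  show ?thesis
    unfolding spanned_at_def
  proof
    fix v assume v: "v \<in> tangent_space I X x"
    let ?w = "mmap_diff I a x v"
    let ?c = "\<lambda>t i. x i + t * v i"
    have vel: "velocity_at_0 (\<lambda>t. m a (?c t)) ?w"
      using velocity_mmap[OF I a(1) velocity_line[of x v]] by (simp add: m_def)
    have comp: "mdiff I f (\<phi> s x) ?w = poly (pderiv P) 0"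
      if "mvars f \<subseteq> I" "\<And>t. meval f (m a (?c t)) = poly P t" for f P
      using mdiff_unique[OF I that(1) vel that(2)] by (simp add: ma[OF x])
    have pf: "\<exists>r. mvars r \<subseteq> I \<and> (\<forall>x. meval f (m a x) = meval r x)" if "mvars f \<subseteq> I" for f
    proof -
      have "polyfun I (\<lambda>x. meval f (\<lambda>i. meval (a i) x))"
        by (rule polyfun_subst[OF polyfun_meval[OF that]]) (rule polyfun_meval[OF a(1)])
      then obtain r where "mvars r \<subseteq> I" "(\<lambda>x. meval f (\<lambda>i. meval (a i) x)) = meval r"
        by (rule polyfunE)
      moreover have "meval f (m a x) = meval f (\<lambda>i. meval (a i) x)" for x
        by (rule polyfun_cong[OF polyfun_meval[OF that]]) (simp add: m_def)
      ultimately show ?thesis by (intro exI[of _ r]) (simp add: fun_eq_iff)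
    qed
    \<comment> \<open>Tangent vectors kill every polynomial vanishing on \<open>X\<close>.
      Identities that hold on \<open>X\<close> alone may therefore be differentiated along the
      straight line \<open>?c\<close>, although that line leaves \<open>X\<close> in
      general.\<close>
    have kill: "poly (pderiv P) 0 = 0"
      if "mvars r \<subseteq> I" "\<And>x. x \<in> X \<Longrightarrow> meval r x = 0" "\<And>t. meval r (?c t) = poly P t" for r P
      using mdiff_line[OF I that(1,3)] v that(1,2)
      by (auto simp: tangent_space_mdiff vanishing_ideal_def)
    have along: "\<exists>P. \<forall>t. meval r (?c t) = poly P t" if "mvars r \<subseteq> I" for r
      using meval_along_curve_deriv[OF I that velocity_line[of x v]] by blast
    have w: "?w \<in> tangent_space I X (\<phi> s x)"
      unfolding tangent_space_mdiff
    proof (intro CollectI conjI ballI)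
      show "?w \<in> affine_space I" by (simp add: affine_space_def mmap_diff_def)
      fix f assume f: "f \<in> vanishing_ideal I X"
      then have fI: "mvars f \<subseteq> I" by (simp add: vanishing_ideal_def)
      obtain r where r: "mvars r \<subseteq> I" "\<And>x. meval f (m a x) = meval r x" using pf[OF fI] by blast
      obtain P where P: "\<And>t. meval r (?c t) = poly P t" using along[OF r(1)] by blast
      have "meval r z = 0" if "z \<in> X" for z
        using f ma[OF that] inn[OF that] r(2)[of z] by (auto simp: vanishing_ideal_def)
      from kill[OF r(1) this P] comp[OF fI] show "mdiff I f (\<phi> s x) ?w = 0"
        by (simp add: r(2) P)
    qed
    \<comment> \<open>The composition of \<open>\<phi> (- s)\<close> with \<open>\<phi> s\<close> is
      the identity on \<open>X\<close> only. Its deviation \<open>r'\<close> from the coordinate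
      \<open>i\<close> vanishes on \<open>X\<close>, so by \<open>kill\<close> the two differentials
      are inverse to each other on tangent vectors.\<close>
    have w_back: "mmap_diff I b (\<phi> s x) ?w = v"
    proof
      fix i
      show "mmap_diff I b (\<phi> s x) ?w i = v i"
      proof (cases "i \<in> I")
        case True
        obtain r where r: "mvars r \<subseteq> I" "\<And>x. meval (b i) (m a x) = meval r x"
          using pf[OF b(1)[OF True]] by blast
        have "polyfun I (\<lambda>x. meval r x - x i)"
          using True by (intro polyfun_diff polyfun_meval r(1) polyfun_var)
        then obtain r' where "mvars r' \<subseteq> I" "(\<lambda>x. meval r x - x i) = meval r'"
          by (rule polyfunE)
        then have r': "mvars r' \<subseteq> I" "\<And>x. meval r x - x i = meval r' x" by (simp_all add: fun_eq_iff)
        obtain P where P: "\<And>t. meval r' (?c t) = poly P t" using along[OF r'(1)] by blast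
        have "meval r' z = 0" if "z \<in> X" for z
        proof -
          have "meval r z = \<phi> (- s) (\<phi> s z) i"
            using r(2)[of z] ma[OF that] b(2)[OF True inn[OF that], of s] by simp
          then show ?thesis using r'(2)[of z] regular_Ga_action_inverse[OF \<phi> that] by simp
        qed
        from kill[OF r'(1) this P] have P0: "poly (pderiv P) 0 = 0" .
        have "meval (b i) (m a (?c t)) = poly (P + [:x i, v i:]) t" for t
          using r(2)[of "?c t"] r'(2)[of "?c t"] P[of t] by (simp add: algebra_simps)
        from comp[OF b(1)[OF True] this] P0 True show ?thesis
          by (simp add: mmap_diff_def pderiv_add pderiv_pCons)
      next
        case False
        then show ?thesis using v by (simp add: mmap_diff_def tangent_space_def affine_space_def)
      qed
    qed
    have sub: "fvec.subspace {u. mmap_diff I b (\<phi> s x) u \<in> fspan (Ga_orbit_tangents I X x)}"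
    proof (rule fvec.subspaceI; clarify)
      have "mmap_diff I b (\<phi> s x) 0 = 0"
        by (simp add: mmap_diff_def mdiff_def fun_eq_iff)
      then show "mmap_diff I b (\<phi> s x) 0 \<in> fspan (Ga_orbit_tangents I X x)"
        by (simp add: fvec.span_zero)
    next
      fix u u' assume *: "mmap_diff I b (\<phi> s x) u \<in> fspan (Ga_orbit_tangents I X x)"
        "mmap_diff I b (\<phi> s x) u' \<in> fspan (Ga_orbit_tangents I X x)"
      have "mmap_diff I b (\<phi> s x) (u + u') = mmap_diff I b (\<phi> s x) u + mmap_diff I b (\<phi> s x) u'"
        by (simp add: mmap_diff_def mdiff_def fun_eq_iff algebra_simps sum.distrib)
      then show "mmap_diff I b (\<phi> s x) (u + u') \<in> fspan (Ga_orbit_tangents I X x)"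
        using fvec.span_add[OF *] by simp
    next
      fix k u assume *: "mmap_diff I b (\<phi> s x) u \<in> fspan (Ga_orbit_tangents I X x)"
      have "mmap_diff I b (\<phi> s x) (fscale k u) = fscale k (mmap_diff I b (\<phi> s x) u)"
        by (simp add: mmap_diff_def mdiff_def fscale_def fun_eq_iff sum_distrib_left algebra_simps)
      then show "mmap_diff I b (\<phi> s x) (fscale k u) \<in> fspan (Ga_orbit_tangents I X x)"
        using fvec.span_scale[OF *] by simp
    qed
    have "mmap_diff I b (\<phi> s x) u \<in> Ga_orbit_tangents I X x"
      if "u \<in> Ga_orbit_tangents I X (\<phi> s x)" for u
    proof -
      obtain \<psi> where \<psi>: "regular_Ga_action I X \<psi>" "velocity_at_0 (\<lambda>t. \<psi> t (\<phi> s x)) u"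
        using \<open>u \<in> _\<close> by (auto simp: Ga_orbit_tangents_def)
      have "velocity_at_0 (\<lambda>t. m b (\<psi> t (\<phi> s x))) (mmap_diff I b (\<psi> 0 (\<phi> s x)) u)"
        using velocity_mmap[OF I b(1) \<psi>(2)] by (simp add: m_def)
      moreover have "m b (\<psi> t (\<phi> s x)) = \<phi> (- s) (\<psi> t (\<phi> s x))" for t
        by (intro mb regular_Ga_action_in[OF \<psi>(1)] inn x)
      ultimately have "velocity_at_0 (\<lambda>t. \<phi> (- s) (\<psi> t (\<phi> s x))) (mmap_diff I b (\<phi> s x) u)"
        using regular_Ga_action_0[OF \<psi>(1) inn[OF x]] by simp
      then show ?thesis
        using regular_Ga_action_conj[OF \<phi> \<psi>(1), of s] by (auto simp: Ga_orbit_tangents_def)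
    qed
    then have "fspan (Ga_orbit_tangents I X (\<phi> s x)) \<subseteq>
        {u. mmap_diff I b (\<phi> s x) u \<in> fspan (Ga_orbit_tangents I X x)}"
      by (intro fvec.span_minimal sub) (auto intro: fvec.span_base)
    with w y have "mmap_diff I b (\<phi> s x) ?w \<in> fspan (Ga_orbit_tangents I X x)"
      unfolding spanned_at_def by blast
    then show "v \<in> fspan (Ga_orbit_tangents I X x)" by (simp only: w_back)
  qed
qed

section \<open>Orbits of the group generated by all additive group actions\<close>

inductive Ga_reach :: "'v set \<Rightarrow> ('v \<Rightarrow> 'a::field) set \<Rightarrow> ('v \<Rightarrow> 'a) \<Rightarrow> ('v \<Rightarrow> 'a) \<Rightarrow> bool"
  for I X x where
  refl: "Ga_reach I X x x"
| step: "Ga_reach I X x y \<Longrightarrow> regular_Ga_action I X \<phi> \<Longrightarrow> Ga_reach I X x (\<phi> t y)"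

lemma Ga_reach_in: "Ga_reach I X x y \<Longrightarrow> x \<in> X \<Longrightarrow> y \<in> X"
  by (induction rule: Ga_reach.induct) (auto intro: regular_Ga_action_in)

lemma Ga_reach_trans: "Ga_reach I X y z \<Longrightarrow> Ga_reach I X x y \<Longrightarrow> Ga_reach I X x z"
  by (induction rule: Ga_reach.induct) (auto intro: Ga_reach.intros)

lemma Ga_reach_sym: "Ga_reach I X x y \<Longrightarrow> x \<in> X \<Longrightarrow> Ga_reach I X y x"
proof (induction rule: Ga_reach.induct)
  case (step y \<phi> t)
  have "y \<in> X" using Ga_reach_in[OF step.hyps(1)] step.prems .
  then have "Ga_reach I X (\<phi> t y) y"
    using Ga_reach.step[OF Ga_reach.refl step.hyps(2), of "\<phi> t y" "- t"]
      regular_Ga_action_inverse(1)[OF step.hyps(2)] by simp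
  with step show ?case using Ga_reach_trans by blast
qed (rule Ga_reach.refl)

lemma Ga_reach_spanned_at:
  fixes X :: "('v \<Rightarrow> 'a::field_char_0) set"
  assumes "finite I" "X \<subseteq> affine_space I" "x \<in> X" "Ga_reach I X x y" "spanned_at I X y"
  shows "spanned_at I X x"
  using assms(4,5)
proof (induction rule: Ga_reach.induct)
  case (step y \<phi> t)
  then show ?case
    using spanned_at_transport[OF assms(1,2) Ga_reach_in[OF step.hyps(1) assms(3)] step.hyps(2)] by blast
qed

text \<open>The last flow is run for the time \<open>t * s\<close> while its starting point moves
  along the curve obtained so far. This gives \<open>x\<close> at \<open>t = 0\<close> and the new
  end point at \<open>t = 1\<close>.\<close>

lemma Ga_reach_curve:
  fixes X :: "('v \<Rightarrow> 'a::field_char_0) set"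
  assumes "X \<subseteq> affine_space I" "x \<in> X" "Ga_reach I X x y"
  shows "\<exists>c. c 0 = x \<and> c 1 = y \<and> (\<forall>t. Ga_reach I X x (c t)) \<and> (\<forall>i. \<exists>p. \<forall>t. c t i = poly p t)"
  using assms(3)
proof (induction rule: Ga_reach.induct)
  case refl
  have "\<exists>p. \<forall>t. x i = poly p t" for i by (rule exI[of _ "[:x i:]"]) simp
  then show ?case by (intro exI[of _ "\<lambda>_. x"]) (auto intro: Ga_reach.refl)
next
  case (step y \<phi> s)
  then obtain c where c: "c 0 = x" "c 1 = y" "\<And>t. Ga_reach I X x (c t)"
    "\<And>i. \<exists>p. \<forall>t. c t i = poly p t" by blast
  have cX: "c t \<in> X" for t using Ga_reach_in[OF c(3) assms(2)] .
  obtain P where P: "\<And>i. i \<in> I \<Longrightarrow> polyfun (insert None (Some ` I)) (P i)"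
    "\<And>i t x. i \<in> I \<Longrightarrow> x \<in> X \<Longrightarrow> \<phi> t x i = P i (case_option t x)"
    using regular_Ga_action_coords[OF step.hyps(2)] by blast
  have "\<exists>p. \<forall>t. \<phi> (t * s) (c t) i = poly p t" for i
  proof (cases "i \<in> I")
    case True
    have "\<exists>p. \<forall>t. case_option (t * s) (c t) j = poly p t" for j
    proof (cases j)
      case None
      then show ?thesis by (intro exI[of _ "[:0, s:]"]) simp
    qed (use c(4) in auto)
    from polyfun_along_curve[where c = "\<lambda>t. case_option (t * s) (c t)", OF P(1)[OF True] this]
    show ?thesis using P(2)[OF True cX] by simp
  next
    case False
    then have "\<phi> (t * s) (c t) i = 0" for t
      using regular_Ga_action_in[OF step.hyps(2) cX] assms(1) by (auto simp: affine_space_def)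
    then show ?thesis by (intro exI[of _ 0]) simp
  qed
  moreover have "\<phi> (0 * s) (c 0) = x" using regular_Ga_action_0[OF step.hyps(2) assms(2)] c(1) by simp
  moreover have "Ga_reach I X x (\<phi> (t * s) (c t))" for t
    by (rule Ga_reach.step[OF c(3) step.hyps(2)])
  ultimately show ?case
    using c(2) by (intro exI[of _ "\<lambda>t. \<phi> (t * s) (c t)"]) simp
qed

definition nonvanishing :: "'v set \<Rightarrow> ('v \<Rightarrow> 'a::field) set \<Rightarrow> ('v \<Rightarrow> 'a) \<Rightarrow> (('v \<Rightarrow> 'a) \<Rightarrow> 'a) \<Rightarrow> bool" where
  "nonvanishing I X x F \<longleftrightarrow> (\<exists>y. Ga_reach I X x y \<and> F y \<noteq> 0)"

lemma nonvanishing_refl: "F x \<noteq> 0 \<Longrightarrow> nonvanishing I X x F"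
  unfolding nonvanishing_def using Ga_reach.refl by blast

text \<open>Two points of an orbit lie on a polynomial curve inside the orbit; a polynomial not
  vanishing at one of them vanishes at finitely many points of that curve only.\<close>

lemma nonvanishing_mult:
  fixes X :: "('v \<Rightarrow> 'a::field_char_0) set"
  assumes "X \<subseteq> affine_space I" "x \<in> X" "polyfun I F" "polyfun I H"
    and "nonvanishing I X x F" "nonvanishing I X x H"
  shows "nonvanishing I X x (\<lambda>y. F y * H y)"
proof -
  obtain y z where yz: "Ga_reach I X x y" "F y \<noteq> 0" "Ga_reach I X x z" "H z \<noteq> 0"
    using assms(5,6) by (auto simp: nonvanishing_def)
  have y: "y \<in> X" by (rule Ga_reach_in[OF yz(1) assms(2)])
  have "Ga_reach I X y z"
    by (rule Ga_reach_trans[OF yz(3) Ga_reach_sym[OF yz(1) assms(2)]])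
  from Ga_reach_curve[OF assms(1) y this] obtain c where c: "c 0 = y" "c 1 = z"
    "\<And>t. Ga_reach I X y (c t)" "\<And>i. \<exists>p. \<forall>t. c t i = poly p t" by blast
  obtain P where P: "\<And>t. F (c t) = poly P t"
    using polyfun_along_curve[where c = c, OF assms(3) c(4)] by blast
  obtain Q where Q: "\<And>t. H (c t) = poly Q t"
    using polyfun_along_curve[where c = c, OF assms(4) c(4)] by blast
  have "P \<noteq> 0" "Q \<noteq> 0" using P[of 0] Q[of 1] yz c by auto
  then have "P * Q \<noteq> 0" by simp
  then obtain t where "poly (P * Q) t \<noteq> 0" using poly_all_0_iff_0 by blast
  then have "F (c t) * H (c t) \<noteq> 0" using P Q by simp
  then show ?thesis using Ga_reach_trans[OF c(3) yz(1)] by (auto simp: nonvanishing_def)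
qed

lemma nonvanishing_all:
  fixes X :: "('v \<Rightarrow> 'a::field_char_0) set"
  assumes "X \<subseteq> affine_space I" "x \<in> X" "finite S"
    and "\<And>s. s \<in> S \<Longrightarrow> polyfun I (F s)" "\<And>s. s \<in> S \<Longrightarrow> nonvanishing I X x (F s)"
  obtains y where "Ga_reach I X x y" "\<forall>s\<in>S. F s y \<noteq> 0"
proof -
  have "nonvanishing I X x (\<lambda>y. \<Prod>s\<in>S. F s y)"
    using assms(3-5)
  proof (induction S)
    case empty
    show ?case by (rule nonvanishing_refl) simp
  next
    case (insert s S)
    then show ?case using nonvanishing_mult[OF assms(1,2), of "F s" "\<lambda>y. \<Prod>s\<in>S. F s y"] by auto
  qed
  then show ?thesis using that assms(3) by (auto simp: nonvanishing_def)
qed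

text \<open>If the coordinate \<open>i\<close> were zero on the whole orbit, it would be zero along
  every flow curve through \<open>x\<close>; then all orbit tangents, and everything in their span,
  would have entry zero at \<open>i\<close>.\<close>

lemma nonvanishing_tangent:
  fixes X :: "('v \<Rightarrow> 'a::field_char_0) set"
  assumes "v \<in> fspan (Ga_orbit_tangents I X x)" "v i \<noteq> 0"
  shows "nonvanishing I X x (\<lambda>y. y i)"
proof (rule ccontr)
  assume neg: "\<not> nonvanishing I X x (\<lambda>y. y i)"
  have "u i = 0" if "u \<in> Ga_orbit_tangents I X x" for u
  proof -
    obtain \<phi> where \<phi>: "regular_Ga_action I X \<phi>" "velocity_at_0 (\<lambda>t. \<phi> t x) u"
      using \<open>u \<in> _\<close> by (auto simp: Ga_orbit_tangents_def)
    then obtain p where p: "\<And>t. \<phi> t x i = poly p t" "u i = poly (pderiv p) 0"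
      unfolding velocity_at_0_def by metis
    have "poly p t = 0" for t
      using neg Ga_reach.step[OF Ga_reach.refl \<phi>(1)] p(1)[of t] unfolding nonvanishing_def by metis
    then have "p = 0" using poly_all_0_iff_0 by blast
    then show "u i = 0" using p by simp
  qed
  moreover have "fvec.subspace {u :: 'v \<Rightarrow> 'a. u i = 0}"
    by (rule fvec.subspaceI) (auto simp: fscale_def)
  ultimately have "fspan (Ga_orbit_tangents I X x) \<subseteq> {u. u i = 0}"
    by (intro fvec.span_minimal) auto
  then show False using assms by auto
qed

section \<open>An upper bound for the local dimension\<close>

text \<open>Running out of either list ends the product, so the function is polynomial for every
  list of exponents; in the sums below both lists have the same length.\<close>

fun power_product :: "(('v \<Rightarrow> 'a::comm_semiring_1) \<Rightarrow> 'a) list \<Rightarrow> nat list \<Rightarrow> ('v \<Rightarrow> 'a) \<Rightarrow> 'a" where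
  "power_product (g # gs) (k # ks) x = g x ^ k * power_product gs ks x"
| "power_product _ _ x = 1"

definition exponent_lists :: "nat \<Rightarrow> nat \<Rightarrow> nat list set" where
  "exponent_lists d N = {ks. set ks \<subseteq> {..N} \<and> length ks = d}"

text \<open>Algebraic independence of the restrictions to \<open>Z\<close>. A relation is given by
  coefficients \<open>c\<close> on a box of exponents at most \<open>N\<close>; for
  \<open>gs = []\<close> independence says that \<open>Z\<close> is nonempty.\<close>

definition alg_indep :: "(('v \<Rightarrow> 'a::comm_semiring_1) \<Rightarrow> 'a) list \<Rightarrow> ('v \<Rightarrow> 'a) set \<Rightarrow> bool" where
  "alg_indep gs Z \<longleftrightarrow> (\<forall>N c.
     (\<forall>x\<in>Z. (\<Sum>ks\<in>exponent_lists (length gs) N. c ks * power_product gs ks x) = 0) \<longrightarrow>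
     (\<forall>ks\<in>exponent_lists (length gs) N. c ks = 0))"

text \<open>The vanishing ideal is prime: this is the form in which irreducibility enters, and for
  the affine space it can be checked by restriction to lines.\<close>

definition polyfun_prime :: "'v set \<Rightarrow> ('v \<Rightarrow> 'a::comm_semiring_1) set \<Rightarrow> bool" where
  "polyfun_prime I Z \<longleftrightarrow> (\<forall>p q. polyfun I p \<and> polyfun I q \<and> (\<forall>x\<in>Z. p x * q x = 0) \<longrightarrow>
     (\<forall>x\<in>Z. p x = 0) \<or> (\<forall>x\<in>Z. q x = 0))"

lemma finite_exponent_lists [simp]: "finite (exponent_lists d N)"
  unfolding exponent_lists_def by (rule finite_lists_length_eq) simp

lemma card_exponent_lists: "card (exponent_lists d N) = (N + 1) ^ d"
  unfolding exponent_lists_def by (subst card_lists_length_eq) auto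

lemma exponent_lists_0: "exponent_lists 0 N = {[]}"
  by (auto simp: exponent_lists_def)

lemma exponent_lists_Suc:
  "exponent_lists (Suc d) N = (\<lambda>(k, ks). k # ks) ` ({..N} \<times> exponent_lists d N)"
  by (auto simp: exponent_lists_def image_iff length_Suc_conv)

lemma polyfun_power_product:
  assumes "\<And>g. g \<in> set gs \<Longrightarrow> polyfun I g"
  shows "polyfun I (power_product gs ks)"
  using assms
proof (induction gs ks rule: list_induct2')
  case (4 g gs k ks)
  have "polyfun I (\<lambda>x. g x ^ k * power_product gs ks x)"
    using 4 by (intro polyfun_mult polyfun_power) auto
  moreover have "power_product (g # gs) (k # ks) = (\<lambda>x. g x ^ k * power_product gs ks x)" by auto
  ultimately show ?case by simp
next
  case 1
  have "power_product [] [] = (\<lambda>x :: 'a \<Rightarrow> 'b. 1)" by auto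
  then show ?case by (simp add: polyfun_const)
next
  case (2 g gs)
  have "power_product (g # gs) [] = (\<lambda>x. 1)" by auto
  then show ?case by (simp add: polyfun_const)
next
  case (3 k ks)
  have "power_product [] (k # ks) = (\<lambda>x :: 'a \<Rightarrow> 'b. 1)" by auto
  then show ?case by (simp add: polyfun_const)
qed

text \<open>In a relation that holds on \<open>Z'\<close> one can divide by the lowest power of \<open>g\<close>, as \<open>Z'\<close> is
  irreducible and \<open>g\<close> does not vanish on it; the lowest coefficient then vanishes on \<open>Z\<close>.\<close>

lemma alg_indep_Cons:
  fixes gs :: "(('v \<Rightarrow> 'a::field) \<Rightarrow> 'a) list"
  assumes gs: "\<And>g. g \<in> set gs \<Longrightarrow> polyfun I g" and indep: "alg_indep gs Z" and "Z \<subseteq> Z'"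
    and prime: "polyfun_prime I Z'" and g: "polyfun I g" "\<And>x. x \<in> Z \<Longrightarrow> g x = 0"
    and x0: "x0 \<in> Z'" "g x0 \<noteq> 0"
  shows "alg_indep (g # gs) Z'"
  unfolding alg_indep_def
proof (intro allI impI)
  fix N and c :: "nat list \<Rightarrow> 'a"
  assume 0: "\<forall>x\<in>Z'. (\<Sum>ks\<in>exponent_lists (length (g # gs)) N. c ks * power_product (g # gs) ks x) = 0"
  let ?L = "exponent_lists (length gs) N"
  define h where "h = (\<lambda>k x. \<Sum>ks\<in>?L. c (k # ks) * power_product gs ks x)"
  have ph: "polyfun I (h k)" for k
    unfolding h_def by (intro polyfun_sum polyfun_mult polyfun_const polyfun_power_product gs)
  have rel: "(\<Sum>k\<le>N. g x ^ k * h k x) = 0" if "x \<in> Z'" for x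
  proof -
    have "(\<Sum>ks\<in>exponent_lists (length (g # gs)) N. c ks * power_product (g # gs) ks x) =
        (\<Sum>(k, ks)\<in>{..N} \<times> ?L. c (k # ks) * (g x ^ k * power_product gs ks x))"
      unfolding exponent_lists_Suc list.size add_0_right add_Suc_right
      by (subst sum.reindex) (auto simp: inj_on_def case_prod_unfold)
    also have "\<dots> = (\<Sum>k\<le>N. g x ^ k * h k x)"
      by (simp add: h_def sum.cartesian_product[symmetric] sum_distrib_left algebra_simps)
    finally show ?thesis using 0 that by simp
  qed
  have coef: "\<forall>ks\<in>?L. c (k # ks) = 0" if "k \<le> N" for k
    using that
  proof (induction k rule: less_induct)
    case (less k)
    have h0: "h j x = 0" if "j < k" for j x
      using less.IH[OF that] less.prems that by (simp add: h_def)
    let ?q = "\<lambda>x. \<Sum>j\<in>{k..N}. g x ^ (j - k) * h j x"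
    have "g x ^ k * ?q x = 0" if "x \<in> Z'" for x
    proof -
      have "g x ^ k * ?q x = (\<Sum>j\<in>{k..N}. g x ^ j * h j x)"
        unfolding sum_distrib_left
        by (rule sum.cong) (auto simp: mult.assoc[symmetric] power_add[symmetric])
      also have "\<dots> = (\<Sum>j\<le>N. g x ^ j * h j x)"
        by (rule sum.mono_neutral_left) (auto simp: h0)
      finally show ?thesis using rel[OF that] by simp
    qed
    moreover have "polyfun I (\<lambda>x. g x ^ k)" "polyfun I ?q"
      by (intro polyfun_power g polyfun_sum polyfun_mult ph)+
    ultimately have "(\<forall>x\<in>Z'. g x ^ k = 0) \<or> (\<forall>x\<in>Z'. ?q x = 0)"
      using prime unfolding polyfun_prime_def by blast
    then have q: "?q x = 0" if "x \<in> Z'" for x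
      using x0 that by auto
    have "h k x = 0" if "x \<in> Z" for x
    proof -
      \<comment> \<open>On \<open>Z\<close> the function \<open>g\<close> is zero, so
        \<open>0 ^ 0 = 1\<close> singles out the term \<open>j = k\<close>.\<close>
      have "?q x = (\<Sum>j\<in>{k}. g x ^ (j - k) * h j x)"
        by (rule sum.mono_neutral_right) (use less.prems g(2)[OF that] in auto)
      then show ?thesis using q \<open>Z \<subseteq> Z'\<close> that by auto
    qed
    then show ?case
      using indep[unfolded alg_indep_def, rule_format, where c = "\<lambda>ks. c (k # ks)"]
      unfolding h_def by blast
  qed
  show "\<forall>ks\<in>exponent_lists (length (g # gs)) N. c ks = 0"
    using coef by (auto simp: exponent_lists_Suc)
qed

section \<open>Counting monomials with bounded exponents\<close>

definition box_monom :: "'v set \<Rightarrow> ('v \<Rightarrow> nat) \<Rightarrow> ('v \<Rightarrow> 'a::comm_semiring_1) \<Rightarrow> 'a" where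
  "box_monom I \<alpha> x = (\<Prod>i\<in>I. x i ^ \<alpha> i)"

text \<open>With each exponent bounded separately, bounds add under multiplication and the count
  \<open>(E + 1) ^ card I\<close> is immediate.\<close>

definition box_monoms :: "'v set \<Rightarrow> nat \<Rightarrow> (('v \<Rightarrow> 'a::comm_semiring_1) \<Rightarrow> 'a) set" where
  "box_monoms I E = {box_monom I \<alpha> | \<alpha>. \<forall>i\<in>I. \<alpha> i \<le> E}"

lemma box_monoms_PiE: "box_monoms I E = box_monom I ` (PiE I (\<lambda>_. {..E}))"
proof -
  have "box_monom I \<alpha> \<in> box_monom I ` (PiE I (\<lambda>_. {..E}))" if "\<forall>i\<in>I. \<alpha> i \<le> E" for \<alpha>
    by (rule image_eqI[of _ _ "restrict \<alpha> I"])
       (use that in \<open>auto simp: box_monom_def fun_eq_iff cong: prod.cong\<close>)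
  then show ?thesis by (auto simp: box_monoms_def)
qed

lemma finite_box_monoms: "finite I \<Longrightarrow> finite (box_monoms I E)"
  unfolding box_monoms_PiE by (intro finite_imageI finite_PiE) auto

lemma card_box_monoms: "finite I \<Longrightarrow> card (box_monoms I E) \<le> (E + 1) ^ card I"
  unfolding box_monoms_PiE
  by (rule order.trans[OF card_image_le]) (auto simp: card_PiE intro: finite_PiE)

text \<open>Bilinearity: for a fixed second factor the admissible first factors form a subspace.
  This is applied with a monomial as the fixed factor and then with \<open>G\<close>, so that only
  products of two monomials remain.\<close>

lemma box_span_mult:
  fixes F G :: "('v \<Rightarrow> 'a::field) \<Rightarrow> 'a"
  assumes "F \<in> fspan (box_monoms I E)" "G \<in> fspan (box_monoms I E')"
  shows "(\<lambda>x. F x * G x) \<in> fspan (box_monoms I (E + E'))"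
proof -
  let ?S = "fspan (box_monoms I (E + E')) :: (('v \<Rightarrow> 'a) \<Rightarrow> 'a) set"
  have lin: "fvec.subspace {F. (\<lambda>x. F x * H x) \<in> ?S}" for H :: "('v \<Rightarrow> 'a) \<Rightarrow> 'a"
  proof (rule fvec.subspaceI; clarify)
    show "(\<lambda>x. 0 x * H x) \<in> ?S" using fvec.span_zero by (simp add: zero_fun_def)
    show "(\<lambda>x. (F + G) x * H x) \<in> ?S" if "(\<lambda>x. F x * H x) \<in> ?S" "(\<lambda>x. G x * H x) \<in> ?S" for F G
      using fvec.span_add[OF that] by (simp add: plus_fun_def distrib_right)
    show "(\<lambda>x. fscale c F x * H x) \<in> ?S" if "(\<lambda>x. F x * H x) \<in> ?S" for c F
      using fvec.span_scale[OF that, of c] by (simp add: fscale_def mult.assoc)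
  qed
  have mm: "(\<lambda>x. box_monom I \<alpha> x * box_monom I \<beta> x) \<in> ?S"
    if "\<forall>i\<in>I. \<alpha> i \<le> E" "\<forall>i\<in>I. \<beta> i \<le> E'" for \<alpha> \<beta>
  proof -
    have "(\<lambda>x. box_monom I \<alpha> x * box_monom I \<beta> x) = (box_monom I (\<lambda>i. \<alpha> i + \<beta> i) :: ('v \<Rightarrow> 'a) \<Rightarrow> 'a)"
      by (simp add: box_monom_def fun_eq_iff power_add prod.distrib)
    moreover have "\<dots> \<in> box_monoms I (E + E')"
      using that by (force simp: box_monoms_def intro: add_mono)
    ultimately show ?thesis by (simp add: fvec.span_base)
  qed
  have "fspan (box_monoms I E') \<subseteq> {G. (\<lambda>x. G x * box_monom I \<alpha> x) \<in> ?S}" if "\<forall>i\<in>I. \<alpha> i \<le> E" for \<alpha>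
    by (intro fvec.span_minimal lin)
       (use mm[OF that] in \<open>auto simp: box_monoms_def mult.commute\<close>)
  then have "(\<lambda>x. G x * box_monom I \<alpha> x) \<in> ?S" if "\<forall>i\<in>I. \<alpha> i \<le> E" for \<alpha>
    using assms(2) that by blast
  then have "H \<in> {F. (\<lambda>x. F x * G x) \<in> ?S}" if "H \<in> box_monoms I E" for H
    using that by (auto simp: box_monoms_def mult.commute)
  then have "fspan (box_monoms I E) \<subseteq> {F. (\<lambda>x. F x * G x) \<in> ?S}"
    by (intro fvec.span_minimal lin) blast
  then show ?thesis using assms(1) by auto
qed

lemma box_monoms_mono: "E \<le> E' \<Longrightarrow> box_monoms I E \<subseteq> box_monoms I E'"
  unfolding box_monoms_def by (auto intro: order.trans)

lemma box_span_mono: "E \<le> E' \<Longrightarrow> F \<in> fspan (box_monoms I E) \<Longrightarrow> F \<in> fspan (box_monoms I E')"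
  using fvec.span_mono[OF box_monoms_mono] by blast

lemma box_span_1: "(\<lambda>x. 1) \<in> fspan (box_monoms I E)"
proof -
  have "(\<lambda>x :: 'a \<Rightarrow> 'b. 1) = box_monom I (\<lambda>_. 0)" by (simp add: box_monom_def fun_eq_iff)
  then show ?thesis by (intro fvec.span_base) (auto simp: box_monoms_def)
qed

lemma box_span_power:
  assumes "F \<in> fspan (box_monoms I E)"
  shows "(\<lambda>x. F x ^ k) \<in> fspan (box_monoms I (E * k))"
proof (induction k)
  case (Suc k)
  then show ?case using box_span_mult[OF assms Suc] by simp
qed (simp add: box_span_1)

lemma polyfun_box_span:
  fixes F :: "('v \<Rightarrow> 'a::field) \<Rightarrow> 'a"
  assumes "finite I" "polyfun I F"
  shows "\<exists>E. F \<in> fspan (box_monoms I E)"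
  using assms(2)
proof (induction rule: polyfun_induct)
  case (const c)
  show ?case using fvec.span_scale[OF box_span_1, of c] by (auto simp: fscale_def)
next
  case (add F G)
  then obtain E E' where "F \<in> fspan (box_monoms I E)" "G \<in> fspan (box_monoms I E')" by blast
  then have "F \<in> fspan (box_monoms I (max E E'))" "G \<in> fspan (box_monoms I (max E E'))"
    by (auto intro: box_span_mono[of E "max E E'"] box_span_mono[of E' "max E E'"])
  from fvec.span_add[OF this] show ?case by (auto simp: plus_fun_def)
next
  case (var F i)
  have "box_monom I (\<lambda>j. if j = i then 1 else 0) x = x i" for x :: "'v \<Rightarrow> 'a"
    using assms(1) var.hyps by (simp add: box_monom_def if_distrib[where f = "\<lambda>n. _ ^ n"] cong: if_cong)
  then have "(\<lambda>x. x i) = (box_monom I (\<lambda>j. if j = i then 1 else 0) :: ('v \<Rightarrow> 'a) \<Rightarrow> 'a)" by auto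
  then have "(\<lambda>x :: 'v \<Rightarrow> 'a. x i) \<in> box_monoms I 1" unfolding box_monoms_def
    by (intro CollectI exI[of _ "\<lambda>j. if j = i then 1 else 0"]) auto
  then have "(\<lambda>x :: 'v \<Rightarrow> 'a. x i) \<in> fspan (box_monoms I 1)" by (rule fvec.span_base)
  with var.IH show ?case using box_span_mult by blast
qed

lemma power_product_box_span:
  assumes "\<And>g. g \<in> set gs \<Longrightarrow> g \<in> fspan (box_monoms I E)" "set ks \<subseteq> {..N}" "length ks = length gs"
  shows "power_product gs ks \<in> fspan (box_monoms I (length gs * (E * N)))"
  using assms(3,1,2)
proof (induction ks gs rule: list_induct2)
  case Nil
  have "power_product [] [] = (\<lambda>x :: 'a \<Rightarrow> 'b. 1)" by auto
  then show ?case by (simp add: box_span_1)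
next
  case (Cons k ks g gs)
  have "(\<lambda>x. g x ^ k) \<in> fspan (box_monoms I (E * N))"
    by (rule box_span_mono[OF _ box_span_power]) (use Cons.prems in auto)
  moreover have "power_product gs ks \<in> fspan (box_monoms I (length gs * (E * N)))"
    using Cons by auto
  ultimately have "(\<lambda>x. g x ^ k * power_product gs ks x) \<in> fspan (box_monoms I (E * N + length gs * (E * N)))"
    by (rule box_span_mult)
  moreover have "power_product (g # gs) (k # ks) = (\<lambda>x. g x ^ k * power_product gs ks x)" by auto
  ultimately show ?case by simp
qed

lemma sum_function_apply: "sum F S x = (\<Sum>s\<in>S. F s x)" for F :: "'s \<Rightarrow> 'v \<Rightarrow> 'a::comm_monoid_add"
  by (induction S rule: infinite_finite_induct) auto

lemma alg_indepD:
  assumes "alg_indep gs Z" "ks \<in> exponent_lists (length gs) N"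
    and "\<And>x. (\<Sum>ks\<in>exponent_lists (length gs) N. c ks * power_product gs ks x) = 0"
  shows "c ks = 0"
proof -
  have "\<forall>x\<in>Z. (\<Sum>ks\<in>exponent_lists (length gs) N. c ks * power_product gs ks x) = 0"
    by (simp add: assms(3))
  moreover have "(\<forall>x\<in>Z. (\<Sum>ks\<in>exponent_lists (length gs) N. c ks * power_product gs ks x) = 0) \<longrightarrow>
      (\<forall>ks\<in>exponent_lists (length gs) N. c ks = 0)"
    using assms(1)[unfolded alg_indep_def, THEN spec[of _ N], THEN spec[of _ c]] .
  ultimately have "\<forall>ks\<in>exponent_lists (length gs) N. c ks = 0" by (rule rev_mp)
  with assms(2) show ?thesis by simp
qed

text \<open>Two different exponent lists with the same power product would give a relation with
  coefficients 1 and -1. Injectivity turns the number of lists into a number of independent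
  functions.\<close>

lemma alg_indep_inj_on:
  fixes gs :: "(('v \<Rightarrow> 'a::field) \<Rightarrow> 'a) list"
  assumes "alg_indep gs Z"
  shows "inj_on (power_product gs) (exponent_lists (length gs) N)"
proof (rule inj_onI, rule ccontr)
  let ?L = "exponent_lists (length gs) N"
  fix ks ks' assume *: "ks \<in> ?L" "ks' \<in> ?L" "power_product gs ks = power_product gs ks'" "ks \<noteq> ks'"
  define c where "c = (\<lambda>l. if l = ks then 1 else if l = ks' then - 1 else 0 :: 'a)"
  have "(\<Sum>l\<in>?L. c l * power_product gs l x) = 0" for x
  proof -
    have "(\<Sum>l\<in>?L. c l * power_product gs l x) = (\<Sum>l\<in>{ks, ks'}. c l * power_product gs l x)"
      by (rule sum.mono_neutral_right) (use *(1,2) in \<open>auto simp: c_def\<close>)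
    then show ?thesis using *(3,4) by (simp add: c_def)
  qed
  from alg_indepD[where c = c, OF assms *(1) this] show False by (simp add: c_def)
qed

lemma alg_indep_independent:
  fixes gs :: "(('v \<Rightarrow> 'a::field) \<Rightarrow> 'a) list"
  assumes "alg_indep gs Z"
  shows "fvec.independent (power_product gs ` exponent_lists (length gs) N)"
proof
  let ?L = "exponent_lists (length gs) N"
  assume "fvec.dependent (power_product gs ` ?L)"
  then obtain f u where f: "(\<Sum>u\<in>power_product gs ` ?L. fscale (f u) u) = 0"
    and u: "u \<in> power_product gs ` ?L" "f u \<noteq> 0"
    using fvec.dependent_finite[of "power_product gs ` ?L"] by auto
  define c where "c = (\<lambda>ks. f (power_product gs ks))"
  have s': "(\<Sum>ks\<in>?L. fscale (c ks) (power_product gs ks)) = 0"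
    using f by (simp add: sum.reindex[OF alg_indep_inj_on[OF assms]] c_def)
  have c0: "(\<Sum>ks\<in>?L. c ks * power_product gs ks x) = 0" for x
    using fun_cong[OF s', of x] by (simp add: sum_function_apply fscale_def)
  from u(1) obtain ks where ks: "u = power_product gs ks" "ks \<in> ?L" by (rule imageE)
  from alg_indepD[where c = c, OF assms ks(2) c0] u(2) show False unfolding c_def ks(1) by simp
qed

lemma finite_box_span:
  fixes A :: "(('v \<Rightarrow> 'a::field) \<Rightarrow> 'a) set"
  assumes "finite I" "finite A" "\<And>g. g \<in> A \<Longrightarrow> polyfun I g"
  shows "\<exists>E. A \<subseteq> fspan (box_monoms I E)"
  using assms(2,3)
proof (induction A)
  case (insert g A)
  then obtain E where E: "A \<subseteq> fspan (box_monoms I E)" by auto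
  obtain E' where E': "g \<in> fspan (box_monoms I E')"
    using polyfun_box_span[OF assms(1)] insert.prems by blast
  have "fspan (box_monoms I E) \<subseteq> (fspan (box_monoms I (max E E')) :: (('v \<Rightarrow> 'a) \<Rightarrow> 'a) set)"
    "fspan (box_monoms I E') \<subseteq> (fspan (box_monoms I (max E E')) :: (('v \<Rightarrow> 'a) \<Rightarrow> 'a) set)"
    by (intro fvec.span_mono box_monoms_mono; simp)+
  then show ?case using E E' by blast
qed auto

text \<open>With more functions than variables, their \<open>(N + 1) ^ d\<close> power products
  would outgrow the space that contains them: each exponent there is at most
  \<open>d * (E * N)\<close>, leaving at most \<open>(d * (E * N) + 1) ^ card I\<close>
  monomials.\<close>

lemma alg_indep_length_le:
  fixes gs :: "(('v \<Rightarrow> 'a::field) \<Rightarrow> 'a) list"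
  assumes I: "finite I" and gs: "\<And>g. g \<in> set gs \<Longrightarrow> polyfun I g" and indep: "alg_indep gs Z"
  shows "length gs \<le> card I"
proof (rule ccontr)
  assume neg: "\<not> length gs \<le> card I"
  define d where "d = length gs"
  obtain E where E: "set gs \<subseteq> fspan (box_monoms I E)"
    using finite_box_span[OF I finite_set gs] by blast
  have bound: "(N + 1) ^ d \<le> (d * (E * N) + 1) ^ card I" for N
  proof -
    let ?L = "exponent_lists d N" and ?B = "box_monoms I (d * (E * N)) :: (('v \<Rightarrow> 'a) \<Rightarrow> 'a) set"
    have "power_product gs ks \<in> fspan ?B" if "ks \<in> ?L" for ks
      unfolding d_def
      by (rule power_product_box_span) (use E that in \<open>auto simp: exponent_lists_def d_def\<close>)
    then have "power_product gs ` ?L \<subseteq> fspan ?B" by (rule image_subsetI)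
    with fvec.independent_span_bound[OF finite_box_monoms[OF I] alg_indep_independent[OF indep, of N]]
    have "card (power_product gs ` ?L) \<le> card ?B" by (simp add: d_def)
    also have "\<dots> \<le> (d * (E * N) + 1) ^ card I" by (rule card_box_monoms[OF I])
    also have "card (power_product gs ` ?L) = (N + 1) ^ d"
      unfolding d_def by (simp add: card_image[OF alg_indep_inj_on[OF indep]] card_exponent_lists)
    finally show ?thesis .
  qed
  \<comment> \<open>Chosen so that the estimate
    \<open>d * (E * N) + 1 \<le> (d * E + 1) * (N + 1)\<close> turns the upper bound into
    \<open>N * (N + 1) ^ card I\<close>, which is less than
    \<open>(N + 1) ^ (card I + 1)\<close>.\<close>
  define N where "N = (d * E + 1) ^ card I"
  have "(N + 1) ^ (card I + 1) \<le> (N + 1) ^ d" by (rule power_increasing) (use neg d_def in auto)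
  also have "\<dots> \<le> (d * (E * N) + 1) ^ card I" by (rule bound)
  also have "\<dots> \<le> ((d * E + 1) * (N + 1)) ^ card I"
    by (rule power_mono) (auto simp: algebra_simps)
  also have "\<dots> = N * (N + 1) ^ card I" by (simp only: N_def power_mult_distrib)
  finally have "(N + 1) * (N + 1) ^ card I \<le> N * (N + 1) ^ card I" by (simp only: power_add power_one_right mult.commute)
  then have "N + 1 \<le> N" by (subst (asm) mult_le_cancel2) simp
  then show False by simp
qed

section \<open>Chains of irreducible closed sets\<close>

lemma zariski_closed_Int_zeros:
  assumes "zariski_closed I Z" "polyfun I p"
  shows "zariski_closed I {x \<in> Z. p x = 0}"
proof -
  obtain S where S: "\<forall>f\<in>S. mvars f \<subseteq> I" "Z = zero_locus I S"
    using assms(1) by (auto simp: zariski_closed_def)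
  obtain q where q: "mvars q \<subseteq> I" "p = meval q" using assms(2) by (rule polyfunE)
  have "{x \<in> Z. p x = 0} = zero_locus I (insert q S)" by (auto simp: S q zero_locus_def)
  then show ?thesis unfolding zariski_closed_def using S q by blast
qed

lemma irreducible_closed_polyfun_prime:
  fixes Z :: "('v \<Rightarrow> 'a::idom) set"
  assumes "irreducible_closed I Z"
  shows "polyfun_prime I Z"
  unfolding polyfun_prime_def
proof (intro allI impI)
  fix p q assume pq: "polyfun I p \<and> polyfun I q \<and> (\<forall>x\<in>Z. p x * q x = 0)"
  let ?A = "{x \<in> Z. p x = 0}" and ?B = "{x \<in> Z. q x = 0}"
  have "zariski_closed I ?A" "zariski_closed I ?B"
    using assms pq by (auto simp: irreducible_closed_def intro: zariski_closed_Int_zeros)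
  moreover have "Z = ?A \<union> ?B" using pq by auto
  ultimately have "Z = ?A \<or> Z = ?B" using assms unfolding irreducible_closed_def by blast
  then show "(\<forall>x\<in>Z. p x = 0) \<or> (\<forall>x\<in>Z. q x = 0)" by blast
qed

lemma polyfun_affine_space_restrict:
  assumes "polyfun I p"
  obtains y where "y \<in> affine_space I" "p x = p y"
proof
  show "(\<lambda>i. if i \<in> I then x i else 0) \<in> affine_space I" by (simp add: affine_space_def)
  show "p x = p (\<lambda>i. if i \<in> I then x i else 0)" by (rule polyfun_cong[OF assms]) simp
qed

lemma affine_space_polyfun_prime:
  "polyfun_prime I (affine_space I :: ('v \<Rightarrow> 'a::field_char_0) set)"
  unfolding polyfun_prime_def
proof (intro allI impI)
  fix p q :: "('v \<Rightarrow> 'a) \<Rightarrow> 'a"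
  assume pq: "polyfun I p \<and> polyfun I q \<and> (\<forall>x\<in>affine_space I. p x * q x = 0)"
  have "p x * q x = 0" for x
    using polyfun_affine_space_restrict[of I "\<lambda>x. p x * q x" x] pq by (metis polyfun_mult)
  then show "(\<forall>x\<in>affine_space I. p x = 0) \<or> (\<forall>x\<in>affine_space I. q x = 0)"
    using polyfun_mult_eq_0[of I p q] pq by blast
qed

lemma closed_psubset_separate:
  assumes "zariski_closed I Z" "Z \<subset> Z'" "Z' \<subseteq> affine_space I"
  obtains g x where "polyfun I g" "\<And>x. x \<in> Z \<Longrightarrow> g x = 0" "x \<in> Z'" "g x \<noteq> 0"
proof -
  obtain S where S: "\<forall>f\<in>S. mvars f \<subseteq> I" "Z = zero_locus I S"
    using assms(1) by (auto simp: zariski_closed_def)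
  obtain x where x: "x \<in> Z'" "x \<notin> Z" using assms(2) by blast
  then obtain f where "f \<in> S" "meval f x \<noteq> 0" using S assms(3) by (auto simp: zero_locus_def)
  then show ?thesis
    using that[of "meval f" x] S x by (auto simp: zero_locus_def intro: polyfun_meval)
qed

text \<open>Each strict inclusion adds a function that vanishes on the smaller set but not on the
  larger one, so a chain with \<open>k\<close> steps gives \<open>k\<close> independent functions on
  \<open>Z k\<close>. The step from \<open>Z k\<close> to the affine space adds one more, hence
  \<open>k + 1 \<le> card I\<close>.\<close>

lemma local_dim_less:
  fixes X :: "('v \<Rightarrow> 'a::field_char_0) set"
  assumes I: "finite I" "I \<noteq> {}" and X: "X \<subset> affine_space I"
  shows "local_dim I X x < enat (card I)"
proof -
  have "k < card I" if Z: "\<forall>i\<le>k. irreducible_closed I (Z i) \<and> x \<in> Z i \<and> Z i \<subseteq> X" "\<forall>i<k. Z i \<subset> Z (Suc i)"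
    for k and Z :: "nat \<Rightarrow> ('v \<Rightarrow> 'a) set"
  proof -
    have closed: "zariski_closed I (Z i)" if "i \<le> k" for i
      using Z(1) that by (auto simp: irreducible_closed_def)
    have "\<exists>gs. length gs = i \<and> (\<forall>g\<in>set gs. polyfun I g) \<and> alg_indep gs (Z i)" if "i \<le> k" for i
      using that
    proof (induction i)
      case 0
      \<comment> \<open>\<open>Z 0\<close> contains \<open>x\<close>, so the constant 1 does not
        vanish on it.\<close>
      have "alg_indep [] (Z 0)" using Z(1) by (auto simp: alg_indep_def exponent_lists_0)
      then show ?case by auto
    next
      case (Suc i)
      then obtain gs where gs: "length gs = i" "\<forall>g\<in>set gs. polyfun I g" "alg_indep gs (Z i)" by auto
      have ZZ: "Z i \<subset> Z (Suc i)" "Z (Suc i) \<subseteq> affine_space I"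
        using Z Suc.prems order.trans[OF _ psubset_imp_subset[OF X], of "Z (Suc i)"] by auto
      obtain g x where g: "polyfun I g" "\<And>x. x \<in> Z i \<Longrightarrow> g x = 0" "x \<in> Z (Suc i)" "g x \<noteq> 0"
        using closed_psubset_separate[OF closed ZZ] Suc.prems by (metis Suc_leD)
      have "alg_indep (g # gs) (Z (Suc i))"
        by (rule alg_indep_Cons[where Z = "Z i" and I = I, OF _ gs(3) psubset_imp_subset[OF ZZ(1)] _ g])
           (use gs Z Suc.prems in \<open>auto intro: irreducible_closed_polyfun_prime\<close>)
      then show ?case using gs g by (intro exI[of _ "g # gs"]) auto
    qed
    then obtain gs where gs: "length gs = k" "\<forall>g\<in>set gs. polyfun I g" "alg_indep gs (Z k)" by blast
    have "Z k \<subseteq> X" using Z(1) by simp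
    then have ZX: "Z k \<subset> affine_space I" using X by (rule subset_psubset_trans)
    obtain g x where g: "polyfun I g" "\<And>x. x \<in> Z k \<Longrightarrow> g x = 0" "x \<in> affine_space I" "g x \<noteq> 0"
      using closed_psubset_separate[OF closed ZX] by auto
    have "alg_indep (g # gs) (affine_space I)"
      by (rule alg_indep_Cons[where Z = "Z k" and I = I, OF _ gs(3) psubset_imp_subset[OF ZX] affine_space_polyfun_prime g])
         (use gs(2) in blast)
    then have "length (g # gs) \<le> card I"
      by (intro alg_indep_length_le[OF I(1)]) (use gs g in auto)
    then show ?thesis using gs(1) by simp
  qed
  note chain = this
  \<comment> \<open>A supremum of numbers below a bound is compared with \<open>card I - 1\<close>,
    a true predecessor because \<open>I\<close> is nonempty.\<close>
  have "local_dim I X x \<le> enat (card I - 1)"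
    unfolding local_dim_def
  proof (rule Sup_least)
    fix e
    assume "e \<in> {enat k |k. \<exists>Z. (\<forall>i\<le>k. irreducible_closed I (Z i) \<and> x \<in> Z i \<and> Z i \<subseteq> X) \<and>
      (\<forall>i<k. Z i \<subset> Z (Suc i))}"
    then obtain k Z where "e = enat k"
      "\<forall>i\<le>k. irreducible_closed I (Z i) \<and> x \<in> Z i \<and> Z i \<subseteq> X" "\<forall>i<k. Z i \<subset> Z (Suc i)"
      by (elim CollectE exE conjE)
    with chain[of k Z] show "e \<le> enat (card I - 1)" by simp
  qed
  also have "\<dots> < enat (card I)" using I by (simp add: card_gt_0_iff)
  finally show ?thesis .
qed

section \<open>Trinomials\<close>

definition unit_vec :: "'v \<Rightarrow> 'v \<Rightarrow> 'a::zero_neq_one" where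
  "unit_vec i = (\<lambda>j. if j = i then 1 else 0)"

lemma inj_unit_vec: "inj (unit_vec :: 'v \<Rightarrow> 'v \<Rightarrow> 'a::zero_neq_one)"
proof (rule injI)
  fix i j :: 'v assume "(unit_vec i :: 'v \<Rightarrow> 'a) = unit_vec j"
  from fun_cong[OF this, of i] show "i = j" by (simp add: unit_vec_def split: if_splits)
qed

lemma affine_space_sum_units:
  assumes "finite I" "v \<in> affine_space I"
  shows "v = (\<Sum>i\<in>I. fscale (v i) (unit_vec i))"
proof
  fix j
  have "(\<Sum>i\<in>I. fscale (v i) (unit_vec i)) j = (\<Sum>i\<in>I. if j = i then v i else 0)"
    unfolding sum_function_apply by (rule sum.cong) (auto simp: fscale_def unit_vec_def)
  then show "v j = (\<Sum>i\<in>I. fscale (v i) (unit_vec i)) j"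
    using assms by (auto simp: affine_space_def)
qed

lemma card_le_fdim_affine_space:
  assumes "finite I"
  shows "card I \<le> fdim (affine_space I :: ('v \<Rightarrow> 'a::field) set)"
proof -
  let ?B = "unit_vec ` I :: ('v \<Rightarrow> 'a) set"
  have inj: "inj_on (unit_vec :: 'v \<Rightarrow> 'v \<Rightarrow> 'a) I" using inj_unit_vec by (rule inj_on_subset) simp
  have indep: "fvec.independent ?B"
  proof
    assume "fvec.dependent ?B"
    then obtain f u where f: "(\<Sum>u\<in>?B. fscale (f u) u) = 0" and u: "u \<in> ?B" "f u \<noteq> 0"
      using fvec.dependent_finite[of ?B] assms by auto
    from u(1) obtain j where j: "u = unit_vec j" "j \<in> I" by (rule imageE)
    have "0 = (\<Sum>i\<in>I. fscale (f (unit_vec i)) (unit_vec i)) j"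
      using f by (simp add: sum.reindex[OF inj])
    also have "\<dots> = (\<Sum>i\<in>I. if j = i then f (unit_vec i) else 0)"
      unfolding sum_function_apply by (rule sum.cong) (auto simp: fscale_def unit_vec_def)
    finally show False using u(2) j assms by simp
  qed
  have sub: "?B \<subseteq> affine_space I" by (auto simp: affine_space_def unit_vec_def)
  have span: "affine_space I \<subseteq> fspan ?B"
  proof
    fix v :: "'v \<Rightarrow> 'a" assume v: "v \<in> affine_space I"
    have "(\<Sum>i\<in>I. fscale (v i) (unit_vec i)) \<in> fspan ?B"
      by (intro fvec.span_sum fvec.span_scale fvec.span_base) auto
    then show "v \<in> fspan ?B" using affine_space_sum_units[OF assms v] by simp
  qed
  have "fdim (affine_space I :: ('v \<Rightarrow> 'a) set) = card ?B"
    using fvec.basis_card_eq_dim[OF sub span indep] by simp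
  then show ?thesis by (simp add: card_image[OF inj])
qed

lemma polyfun_upd_0:
  fixes q :: "('v \<Rightarrow> 'a::comm_semiring_1) \<Rightarrow> 'a"
  assumes "polyfun J q" shows "polyfun J (\<lambda>x. q (x(t := 0)))"
proof -
  have "polyfun J (\<lambda>x. q (\<lambda>i. if i = t then 0 else x i))"
  proof (rule polyfun_subst[OF assms])
    show "polyfun J (\<lambda>x. if i = t then 0 else x i)" if "i \<in> J" for i
      using that by (cases "i = t") auto
  qed
  moreover have "(\<lambda>i. if i = t then 0 else x i) = x(t := 0)" for x :: "'v \<Rightarrow> 'a"
    by auto
  ultimately show ?thesis by simp
qed

text \<open>The roots of \<open>c ^ l - a\<close> are nonzero, so the derivative
  \<open>l * c ^ (l - 1)\<close> does not vanish at them. All roots are simple, and the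
  \<open>l\<close> linear factors over the algebraically closed field are distinct.\<close>

lemma card_roots_of:
  fixes a :: "'a::{alg_closed_field, field_char_0}"
  assumes "a \<noteq> 0" "l > 0"
  shows "card {c. c ^ l = a} = l"
proof -
  define p where "p = monom 1 l + [:- a:]"
  have deg: "degree p = l"
    using assms(2) degree_add_eq_left[of "[:- a:]" "monom 1 l"] by (simp add: p_def degree_monom_eq)
  have p0: "p \<noteq> 0" using deg assms(2) by auto
  have roots: "poly p c = 0 \<longleftrightarrow> c ^ l = a" for c
    by (simp add: p_def poly_monom add_eq_0_iff2)
  have "poly (pderiv p) c = of_nat l * c ^ (l - 1)" for c
    by (simp add: p_def pderiv_add pderiv_monom poly_monom pderiv_pCons)
  then have "rsquarefree p"
    unfolding rsquarefree_roots using roots assms by (auto simp: zero_power)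
  then have ord: "order c p \<le> 1" for c
    using rsquarefree_root_order[of p c] order_root[of p c] p0 by (cases "poly p c = 0") auto
  obtain A where A: "size A = degree p" "p = smult (lead_coeff p) (\<Prod>x\<in>#A. [:- x, 1:])"
    using alg_closed_imp_factorization[OF p0] by blast
  have "proots p = A"
  proof -
    have "proots p = proots (\<Prod>x\<in>#A. [:- x, 1:])"
      by (subst A(2), subst proots_smult) (use p0 in auto)
    also have "\<dots> = A"
    proof (induction A)
      case (add x A)
      have "(\<Prod>x\<in>#A. [:- x, 1:]) \<noteq> 0" by auto
      then have "proots ([:- x, 1:] * (\<Prod>x\<in>#A. [:- x, 1:])) = {#x#} + A"
        by (subst proots_mult) (simp_all add: add.IH)
      then show ?case by (simp del: mult_pCons_left)
    qed simp
    finally show ?thesis .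
  qed
  then have cnt: "count A c = order c p" for c using count_proots[OF p0, of c] by simp
  have "size A = (\<Sum>c\<in>set_mset A. count A c)" by (simp add: size_multiset_overloaded_eq)
  also have "\<dots> \<le> (\<Sum>c\<in>set_mset A. 1)" by (rule sum_mono) (use ord cnt in simp)
  finally have "l \<le> card (set_mset A)" using A(1) deg by simp
  moreover have "set_mset A = {c. c ^ l = a}"
    using \<open>proots p = A\<close> set_count_proots[OF p0] roots by simp
  moreover have "card {c. c ^ l = a} \<le> l"
    using card_poly_roots_bound[OF p0] roots deg by simp
  ultimately show ?thesis by simp
qed

section \<open>Trinomials as three blocks of variables\<close>

text \<open>Only the partition of the variables and their exponents are kept. Renumbering within a
  monomial becomes invisible, and a permutation of the monomials becomes a choice of
  \<open>a\<close>, \<open>b\<close>, \<open>c\<close> with \<open>{a, b, c} = {0..2}\<close>. The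
  block \<open>V 0\<close> may be empty; its monomial is then the constant 1.\<close>

locale trinomial_blocks =
  fixes V :: "nat \<Rightarrow> 'v set" and e :: "'v \<Rightarrow> nat"
  assumes finite_V [simp]: "finite (V k)"
    and V_disjoint: "k \<noteq> k' \<Longrightarrow> V k \<inter> V k' = {}"
    and e_pos: "k \<le> 2 \<Longrightarrow> v \<in> V k \<Longrightarrow> 0 < e v"
    and V_nonempty: "V 1 \<noteq> {}" "V 2 \<noteq> {}"
begin

definition I :: "'v set" where "I = (\<Union>k\<in>{0..2}. V k)"

definition monomial :: "'v set \<Rightarrow> ('v \<Rightarrow> 'a::comm_semiring_1) \<Rightarrow> 'a" where
  "monomial S x = (\<Prod>v\<in>S. x v ^ e v)"

definition tri :: "('v \<Rightarrow> 'a::comm_semiring_1) \<Rightarrow> 'a" where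
  "tri x = (\<Sum>k\<in>{0..2}. monomial (V k) x)"

definition X :: "('v \<Rightarrow> 'a::comm_semiring_1) set" where
  "X = {x \<in> affine_space I. tri x = 0}"

definition grad :: "'v \<Rightarrow> ('v \<Rightarrow> 'a::comm_semiring_1) \<Rightarrow> 'a" where
  "grad w x = of_nat (e w) * x w ^ (e w - 1) * (\<Sum>k\<in>{0..2}. if w \<in> V k then monomial (V k - {w}) x else 0)"

lemma finite_I [simp]: "finite I"
  by (simp add: I_def)

lemma V_subset_I: "k \<le> 2 \<Longrightarrow> V k \<subseteq> I"
  by (auto simp: I_def)

lemma in_I: "k \<le> 2 \<Longrightarrow> w \<in> V k \<Longrightarrow> w \<in> I"
  using V_subset_I by blast

lemma I_cases:
  assumes "w \<in> I" obtains k where "k \<le> 2" "w \<in> V k"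
  using assms by (auto simp: I_def)

lemma V_unique: "w \<in> V k \<Longrightarrow> w \<in> V k' \<Longrightarrow> k = k'"
  using V_disjoint by blast

lemma X_subset: "X \<subseteq> affine_space I"
  by (auto simp: X_def)

lemma grad_eq:
  assumes "k \<le> 2" "w \<in> V k"
  shows "grad w x = of_nat (e w) * x w ^ (e w - 1) * monomial (V k - {w}) x"
proof -
  have "(\<Sum>j\<in>{0..2}. if w \<in> V j then monomial (V j - {w}) x else 0) =
      (\<Sum>j\<in>{0..2}. if j = k then monomial (V k - {w}) x else 0)"
    by (rule sum.cong) (use assms(2) in \<open>auto dest: V_unique[OF assms(2)]\<close>)
  then show ?thesis using assms(1) by (simp add: grad_def)
qed

lemma distinct_3:
  assumes "{a, b, c} = {0..2 :: nat}"
  shows "a \<noteq> b" "a \<noteq> c" "b \<noteq> c" "a \<le> 2" "b \<le> 2" "c \<le> 2"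
proof -
  have "card {a, b, c} = 3" using assms by simp
  then show "a \<noteq> b" "a \<noteq> c" "b \<noteq> c" by (auto simp: card_insert_if split: if_splits)
  have "{a, b, c} \<subseteq> {0..2}" using assms by simp
  then show "a \<le> 2" "b \<le> 2" "c \<le> 2" by auto
qed

lemma tri_3:
  assumes "{a, b, c} = {0..2 :: nat}"
  shows "tri x = monomial (V a) x + monomial (V b) x + monomial (V c) x"
  unfolding tri_def assms[symmetric] using distinct_3(1-3)[OF assms] by (simp add: add.assoc)

lemma monomial_remove: "finite S \<Longrightarrow> w \<in> S \<Longrightarrow> monomial S x = x w ^ e w * monomial (S - {w}) x"
  by (simp add: monomial_def prod.remove)

lemma polyfun_monomial: "S \<subseteq> J \<Longrightarrow> polyfun J (monomial S)"
proof -
  assume "S \<subseteq> J"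
  then have "polyfun J (\<lambda>x. \<Prod>v\<in>S. x v ^ e v)" by (intro polyfun_prod polyfun_power polyfun_var) auto
  then show ?thesis by (simp add: monomial_def[abs_def])
qed

lemma polyfun_tri: "polyfun I tri"
proof -
  have "polyfun I (\<lambda>x. \<Sum>k\<in>{0..2}. monomial (V k) x)"
    by (intro polyfun_sum polyfun_monomial V_subset_I) auto
  then show ?thesis by (simp add: tri_def[abs_def])
qed

lemma monomial_cong: "(\<And>v. v \<in> S \<Longrightarrow> x v = y v) \<Longrightarrow> monomial S x = monomial S y"
  by (simp add: monomial_def)

lemma monomial_1 [simp]: "monomial S (\<lambda>_. 1) = 1"
  by (simp add: monomial_def)

lemma monomial_eq_0_iff:
  fixes x :: "'v \<Rightarrow> 'a::idom"
  assumes "finite S" "\<And>v. v \<in> S \<Longrightarrow> 0 < e v"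
  shows "monomial S x = 0 \<longleftrightarrow> (\<exists>v\<in>S. x v = 0)"
  using assms by (auto simp: monomial_def)

text \<open>Along the coordinate line in direction \<open>w\<close> only the monomial containing
  \<open>w\<close> changes, as \<open>(x w + t) ^ e w\<close> times a constant. \<open>F\<close> is
  any formal polynomial with the values of \<open>tri\<close>.\<close>

lemma mpderiv_tri:
  fixes x :: "'v \<Rightarrow> 'a::field_char_0"
  assumes F: "mvars F \<subseteq> I" "meval F = tri" and w: "w \<in> I"
  shows "meval (mpderiv w F) x = grad w x"
proof -
  obtain k where k: "k \<le> 2" "w \<in> V k" using w by (rule I_cases)
  let ?y = "\<lambda>t j. x j + t * unit_vec w j"
  let ?P = "smult (monomial (V k - {w}) x) ([:x w, 1:] ^ e w) + [:\<Sum>j\<in>{0..2} - {k}. monomial (V j) x:]"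
  have "meval F (?y t) = poly ?P t" for t
  proof -
    have "monomial (V k) (?y t) = (x w + t) ^ e w * monomial (V k - {w}) x"
      by (subst monomial_remove[OF _ k(2)])
         (auto simp: unit_vec_def intro!: arg_cong2[where f = "(*)"] monomial_cong)
    moreover have "(\<Sum>j\<in>{0..2} - {k}. monomial (V j) (?y t)) = (\<Sum>j\<in>{0..2} - {k}. monomial (V j) x)"
      by (intro sum.cong monomial_cong) (auto simp: unit_vec_def dest: V_unique[OF k(2)])
    ultimately have "tri (?y t) = (x w + t) ^ e w * monomial (V k - {w}) x + (\<Sum>j\<in>{0..2} - {k}. monomial (V j) x)"
      unfolding tri_def using k(1) by (subst sum.remove[of _ k]) auto
    then show ?thesis by (simp add: F(2) algebra_simps)
  qed
  from mdiff_line[OF finite_I F(1) this]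
  have "mdiff I F x (unit_vec w) = of_nat (e w) * x w ^ (e w - 1) * monomial (V k - {w}) x"
    by (simp add: pderiv_add pderiv_smult pderiv_power pderiv_pCons algebra_simps)
  moreover have "mdiff I F x (unit_vec w) = (\<Sum>i\<in>I. if i = w then meval (mpderiv w F) x else 0)"
    unfolding mdiff_def by (rule sum.cong) (auto simp: unit_vec_def)
  ultimately show ?thesis using w grad_eq[OF k, of x] by simp
qed

lemma mdiff_tri:
  fixes x :: "'v \<Rightarrow> 'a::field_char_0"
  assumes "mvars F \<subseteq> I" "meval F = tri"
  shows "mdiff I F x v = (\<Sum>w\<in>I. grad w x * v w)"
  unfolding mdiff_def by (rule sum.cong) (simp_all add: mpderiv_tri[OF assms])

section \<open>The vanishing ideal of a trinomial hypersurface\<close>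

text \<open>The variable \<open>t\<close> is prime and does not divide the trinomial.\<close>

lemma cancel_variable:
  fixes h q :: "('v \<Rightarrow> 'a::field_char_0) \<Rightarrow> 'a"
  assumes t: "t \<in> V 1" and h: "polyfun I h" and q: "polyfun I q"
    and eq: "\<And>x. x t * h x = q x * tri x"
  shows "\<exists>q'. polyfun I q' \<and> (\<forall>x. h x = q' x * tri x)"
proof -
  have tI: "t \<in> I" using in_I[of 1] t by simp
  obtain r where r: "polyfun I r" "\<And>x. q x = q (x(t := 0)) + x t * r x"
    using polyfun_split_var[OF q tI] by blast
  \<comment> \<open>At the point with coordinate 0 at \<open>t\<close> and 1 elsewhere the monomial
    of \<open>t\<close> vanishes and the other two are 1, so \<open>tri\<close> has the value 2
    there.\<close>
  have m: "monomial (V 1) ((\<lambda>_. 1 :: 'a)(t := 0)) = 0"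
    using t e_pos[of 1] by (subst monomial_remove[OF _ t]) (auto simp: zero_power)
  have "monomial (V k) ((\<lambda>_. 1)(t := 0)) = monomial (V k) (\<lambda>_. 1 :: 'a)" if "k \<noteq> 1" for k
    by (rule monomial_cong) (use that in \<open>auto dest: V_unique[OF t]\<close>)
  then have nz: "tri ((\<lambda>_. 1 :: 'a)(t := 0)) \<noteq> 0"
    by (subst tri_3[of 0 1 2]) (use m in auto)
  have z: "tri (y(t := 0)) * q (y(t := 0)) = 0" for y
    using eq[of "y(t := 0)"] by (simp add: mult.commute)
  have "q (x(t := 0)) = 0" for x
    by (rule polyfun_mult_eq_0[where p = "\<lambda>y. tri (y(t := 0))" and q = "\<lambda>y. q (y(t := 0))"
          and ?x0.0 = "\<lambda>_. 1", OF polyfun_upd_0[OF polyfun_tri] polyfun_upd_0[OF q] z nz])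
  then have "x t * (h x - r x * tri x) = 0" for x
    using eq[of x] r(2)[of x] by (simp add: algebra_simps)
  then have "h x - r x * tri x = 0" for x
    by (rule polyfun_mult_eq_0[where p = "\<lambda>x. x t" and q = "\<lambda>x. h x - r x * tri x" and ?x0.0 = "\<lambda>_. 1",
          OF polyfun_var[OF tI] polyfun_diff[OF h polyfun_mult[OF r(1) polyfun_tri]]]) simp_all
  then show ?thesis using r(1) by (intro exI[of _ r]) simp
qed


lemma tri_split:
  assumes "y \<in> V 1"
  shows "tri x = monomial (V 1 - {y}) x * x y ^ e y + (monomial (V 0) x + monomial (V 2) x)"
proof -
  have "tri x = monomial (V 1) x + monomial (V 0) x + monomial (V 2) x" by (rule tri_3) auto
  then show ?thesis using monomial_remove[OF finite_V assms, of x] by (simp add: algebra_simps)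
qed

text \<open>As a polynomial in \<open>y\<close> the trinomial has leading coefficient
  \<open>monomial (V 1 - {y})\<close>, in general not invertible, so \<open>h\<close> is first
  multiplied by a power of it. Multiplication by \<open>y\<close> shifts the coefficients of a
  remainder; the overflowing term is rewritten by the trinomial at the price of one more
  factor.\<close>

lemma pseudo_division:
  fixes h :: "('v \<Rightarrow> 'a::field_char_0) \<Rightarrow> 'a"
  assumes y: "y \<in> V 1" and h: "polyfun I h"
  shows "\<exists>k q r. polyfun I q \<and> (\<forall>i. polyfun (I - {y}) (r i)) \<and>
    (\<forall>x. monomial (V 1 - {y}) x ^ k * h x = q x * tri x + (\<Sum>i<e y. r i x * x y ^ i))"
  using h
proof (induction rule: polyfun_induct)
  case (const c)
  \<comment> \<open>A constant fits into the remainder because \<open>0 < e y\<close>.\<close>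
  have "(\<Sum>i<e y. (if i = 0 then c else 0) * x y ^ i) = c" for x :: "'v \<Rightarrow> 'a"
    using e_pos[of 1 y] y by (simp add: if_distrib[where f = "\<lambda>z. z * _"] cong: if_cong)
  then show ?case
    by (intro exI[of _ 0] exI[of _ "\<lambda>x. 0"] exI[of _ "\<lambda>i x. if i = 0 then c else 0"])
       auto
next
  case (add F G)
  let ?M = "monomial (V 1 - {y}) :: ('v \<Rightarrow> 'a) \<Rightarrow> 'a"
  obtain k q r where F': "polyfun I q" "\<forall>i. polyfun (I - {y}) (r i)"
    "\<forall>x. ?M x ^ k * F x = q x * tri x + (\<Sum>i<e y. r i x * x y ^ i)"
    using add.IH(1) by (elim exE conjE) (rule that)
  note F = F'(1) F'(2,3)[rule_format]
  obtain k' q' r' where G': "polyfun I q'" "\<forall>i. polyfun (I - {y}) (r' i)"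
    "\<forall>x. ?M x ^ k' * G x = q' x * tri x + (\<Sum>i<e y. r' i x * x y ^ i)"
    using add.IH(2) by (elim exE conjE) (rule that)
  note G = G'(1) G'(2,3)[rule_format]
  have M: "polyfun I ?M" "polyfun (I - {y}) ?M"
    by (rule polyfun_monomial; use in_I[of 1] in auto)+
  show ?case
  proof (intro exI conjI allI)
    show "polyfun I (\<lambda>x. ?M x ^ k' * q x + ?M x ^ k * q' x)"
      by (intro polyfun_add polyfun_mult polyfun_power M F(1) G(1))
    show "polyfun (I - {y}) (\<lambda>x. ?M x ^ k' * r i x + ?M x ^ k * r' i x)" for i
      by (intro polyfun_add polyfun_mult polyfun_power M F(2) G(2))
    fix x
    have "?M x ^ (k + k') * (F x + G x) = ?M x ^ k' * (?M x ^ k * F x) + ?M x ^ k * (?M x ^ k' * G x)"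
      by (simp add: power_add algebra_simps)
    also have "\<dots> = (?M x ^ k' * q x + ?M x ^ k * q' x) * tri x +
        (\<Sum>i<e y. (?M x ^ k' * r i x + ?M x ^ k * r' i x) * x y ^ i)"
      unfolding F(3) G(3) by (simp add: algebra_simps sum.distrib sum_distrib_left)
    finally show "?M x ^ (k + k') * (F x + G x) = \<dots>" .
  qed
next
  case (var F j)
  let ?M = "monomial (V 1 - {y}) :: ('v \<Rightarrow> 'a) \<Rightarrow> 'a"
  obtain k q r where F': "polyfun I q" "\<forall>i. polyfun (I - {y}) (r i)"
    "\<forall>x. ?M x ^ k * F x = q x * tri x + (\<Sum>i<e y. r i x * x y ^ i)"
    using var.IH by (elim exE conjE) (rule that)
  note F = F'(1) F'(2,3)[rule_format]
  have M: "polyfun I ?M" "polyfun (I - {y}) ?M"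
    by (rule polyfun_monomial; use in_I[of 1] in auto)+
  show ?case
  proof (cases "j = y")
    case False
    show ?thesis
    proof (intro exI conjI allI)
      show "polyfun I (\<lambda>x. x j * q x)"
        by (intro polyfun_mult polyfun_var F(1) var.hyps)
      show "polyfun (I - {y}) (\<lambda>x. x j * r i x)" for i
        by (intro polyfun_mult polyfun_var F(2)) (use False var.hyps in auto)
      fix x
      have "?M x ^ k * (x j * F x) = x j * (?M x ^ k * F x)" by (simp add: algebra_simps)
      also have "\<dots> = (x j * q x) * tri x + (\<Sum>i<e y. (x j * r i x) * x y ^ i)"
        unfolding F(3) by (simp add: algebra_simps sum_distrib_left)
      finally show "?M x ^ k * (x j * F x) = \<dots>" .
    qed
  next
    case True
    obtain m where m: "e y = Suc m" using e_pos[of 1 y] y gr0_implies_Suc by auto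
    let ?N = "\<lambda>x. monomial (V 0) x + monomial (V 2) x :: 'a"
    \<comment> \<open>The coefficients of \<open>y\<close> times the old remainder, multiplied by
      \<open>?M\<close>: shifted by one, while the top coefficient \<open>r m\<close> moves to the
      constant term through \<open>?M x * x y ^ e y = tri x - ?N x\<close>.\<close>
    let ?r = "\<lambda>i x. if i = 0 then - (?N x * r m x) else ?M x * r (i - 1) x"
    have N: "polyfun (I - {y}) ?N"
      by (intro polyfun_add polyfun_monomial)
        (use in_I[of 0] in_I[of 2] V_unique[OF y, of 0] V_unique[OF y, of 2] in auto)
    show ?thesis
    proof (intro exI conjI allI)
      show "polyfun I (\<lambda>x. ?M x * x y * q x + r m x)"
        by (intro polyfun_add polyfun_mult polyfun_var M F(1) polyfun_mono[OF F(2)])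
           (use var.hyps True in auto)
      show "polyfun (I - {y}) (?r i)" for i
      proof (cases "i = 0")
        case False
        have "polyfun (I - {y}) (\<lambda>x. ?M x * r (i - 1) x)" by (intro polyfun_mult M F(2))
        then show ?thesis using False by (simp del: One_nat_def)
      qed (simp add: polyfun_uminus polyfun_mult N F(2))
      fix x
      have "?M x ^ Suc k * (x j * F x) = ?M x * x y * (?M x ^ k * F x)"
        by (simp add: True algebra_simps)
      also have "\<dots> = ?M x * x y * q x * tri x + (\<Sum>i<m. ?M x * r i x * x y ^ Suc i) + r m x * (?M x * x y ^ e y)"
        unfolding F(3) m by (simp add: algebra_simps sum_distrib_left)
      also have "?M x * x y ^ e y = tri x - ?N x"
        using tri_split[OF y, of x] by simp
      also have "?M x * x y * q x * tri x + (\<Sum>i<m. ?M x * r i x * x y ^ Suc i) + r m x * (tri x - ?N x) =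
          (?M x * x y * q x + r m x) * tri x + (\<Sum>i<e y. ?r i x * x y ^ i)"
        unfolding m sum.lessThan_Suc_shift by (simp add: algebra_simps)
      finally show "?M x ^ Suc k * (x j * F x) = \<dots>" .
    qed
  qed
qed

lemma cancel_power_variable:
  fixes h q :: "('v \<Rightarrow> 'a::field_char_0) \<Rightarrow> 'a"
  assumes "t \<in> V 1" "polyfun I h" "polyfun I q" "\<And>x. x t ^ n * h x = q x * tri x"
  shows "\<exists>q'. polyfun I q' \<and> (\<forall>x. h x = q' x * tri x)"
  using assms(3,4)
proof (induction n arbitrary: q)
  case 0
  then show ?case by (intro exI[of _ q]) auto
next
  case (Suc n)
  have 1: "polyfun I (\<lambda>x. x t ^ n * h x)"
    by (intro polyfun_mult polyfun_power polyfun_var assms(2)) (use assms(1) in_I[of 1] in auto)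
  have 2: "x t * (x t ^ n * h x) = q x * tri x" for x
    using Suc.prems(2)[of x] by (simp add: mult.assoc)
  obtain q' where q': "polyfun I q'" "\<forall>x. x t ^ n * h x = q' x * tri x"
    using cancel_variable[where h = "\<lambda>x. x t ^ n * h x", OF assms(1) 1 Suc.prems(1) 2] by (elim exE conjE)
  show ?case by (rule Suc.IH[OF q'(1) q'(2)[rule_format]])
qed

text \<open>Removes the power of the leading coefficient left by pseudo-division: it is a product of
  variables from \<open>V 1\<close>, cancelled one after another.\<close>

lemma cancel_monomial:
  fixes h q :: "('v \<Rightarrow> 'a::field_char_0) \<Rightarrow> 'a"
  assumes "finite S" "S \<subseteq> V 1" "polyfun I h" "polyfun I q" "\<And>x. (\<Prod>t\<in>S. x t ^ n t) * h x = q x * tri x"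
  shows "\<exists>q'. polyfun I q' \<and> (\<forall>x. h x = q' x * tri x)"
  using assms
proof (induction S arbitrary: q)
  case empty
  then show ?case by (intro exI[of _ q]) auto
next
  case (insert t S)
  have 1: "polyfun I (\<lambda>x. (\<Prod>t\<in>S. x t ^ n t) * h x)"
    by (intro polyfun_mult polyfun_prod polyfun_power polyfun_var insert.prems(2))
       (use insert.prems(1) in_I[of 1] in auto)
  have 2: "x t ^ n t * ((\<Prod>t\<in>S. x t ^ n t) * h x) = q x * tri x" for x
    using insert.prems(4)[of x] insert.hyps by (simp add: mult.assoc)
  have tS: "t \<in> V 1" "S \<subseteq> V 1" using insert.prems(1) by auto
  obtain q' where q': "polyfun I q'" "\<forall>x. (\<Prod>t\<in>S. x t ^ n t) * h x = q' x * tri x"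
    using cancel_power_variable[where h = "\<lambda>x. (\<Prod>t\<in>S. x t ^ n t) * h x", OF tS(1) 1 insert.prems(3) 2]
    by (elim exE conjE)
  show ?case by (rule insert.IH[OF tS(2) insert.prems(2) q'(1) q'(2)[rule_format]])
qed

text \<open>For generic values of the other variables the trinomial has \<open>e y\<close> distinct roots in \<open>y\<close>,
  so a remainder of degree less than \<open>e y\<close> in \<open>y\<close> that vanishes on \<open>X\<close> is zero.\<close>

lemma vanishing_imp_multiple:
  fixes h :: "('v \<Rightarrow> 'a::{alg_closed_field, field_char_0}) \<Rightarrow> 'a"
  assumes h: "polyfun I h" and van: "\<And>x. x \<in> X \<Longrightarrow> h x = 0"
  shows "\<exists>q. polyfun I q \<and> (\<forall>x. h x = q x * tri x)"
proof -
  obtain y where y: "y \<in> V 1" using V_nonempty by blast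
  have yI: "y \<in> I" using in_I[of 1] y by simp
  let ?M = "monomial (V 1 - {y}) :: ('v \<Rightarrow> 'a) \<Rightarrow> 'a"
  let ?N = "\<lambda>x. monomial (V 0) x + monomial (V 2) x :: 'a"
  obtain k q r where qr': "polyfun I q" "\<forall>i. polyfun (I - {y}) (r i)"
    "\<forall>x. ?M x ^ k * h x = q x * tri x + (\<Sum>i<e y. r i x * x y ^ i)"
    using pseudo_division[OF y h] by (elim exE conjE) (rule that)
  note qr = qr'(1) qr'(2,3)[rule_format]
  have ly: "e y > 0" using e_pos[of 1 y] y by simp
  \<comment> \<open>\<open>X\<close> lies in the affine space, whereas \<open>h\<close> is evaluated
    below at arbitrary zeros of \<open>tri\<close>; setting the coordinates outside \<open>I\<close>
    to zero changes neither value.\<close>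
  have h0: "h x = 0" if "tri x = 0" for x
  proof -
    let ?x = "\<lambda>i. if i \<in> I then x i else 0"
    have "tri ?x = tri x" by (rule polyfun_cong[OF polyfun_tri]) simp
    then have "?x \<in> X" using that by (simp add: X_def affine_space_def)
    moreover have "h ?x = h x" by (rule polyfun_cong[OF h]) simp
    ultimately show ?thesis using van by metis
  qed
  have upd: "F (x(y := c)) = F x" if "polyfun (I - {y}) F" for F :: "('v \<Rightarrow> 'a) \<Rightarrow> 'a" and x c
    by (rule polyfun_cong[OF that]) simp
  have MI: "polyfun (I - {y}) ?M"
    by (rule polyfun_monomial) (use in_I[of 1] in auto)
  have NI: "polyfun (I - {y}) ?N"
    by (intro polyfun_add polyfun_monomial)
      (use in_I[of 0] in_I[of 2] V_unique[OF y, of 0] V_unique[OF y, of 2] in auto)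
  \<comment> \<open>Genericity is expressed by the factors \<open>?M x\<close> and
    \<open>?N x\<close>, which exclude a vanishing leading coefficient and a multiple root. They are
    cancelled afterwards, being nonzero at the point with all coordinates 1.\<close>
  have "?M x * ?N x * r i x = 0" if i: "i < e y" for i x
  proof (cases "?M x = 0 \<or> ?N x = 0")
    case False
    define R where "R = (\<Sum>i<e y. monom (r i x) i)"
    let ?C = "{c. c ^ e y = - ?N x / ?M x}"
    have "poly R c = 0" if "c \<in> ?C" for c
    proof -
      have "tri (x(y := c)) = ?M x * c ^ e y + ?N x"
        using tri_split[OF y, of "x(y := c)"] upd[OF MI, of x c] upd[OF NI, of x c] by simp
      also have "\<dots> = 0" using that False by (simp add: field_simps)
      finally have "tri (x(y := c)) = 0" .
      with qr(3)[of "x(y := c)"] h0 have "(\<Sum>i<e y. r i (x(y := c)) * c ^ i) = 0" by simp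
      then show ?thesis by (simp add: R_def poly_sum poly_monom upd[OF qr(2)])
    qed
    then have sub: "?C \<subseteq> {c. poly R c = 0}" by blast
    have "?M x \<noteq> 0" "?N x \<noteq> 0" using False by simp_all
    then have "- ?N x / ?M x \<noteq> 0" by (simp only: divide_eq_0_iff neg_equal_0_iff_equal) simp
    then have card: "card ?C = e y" using ly by (rule card_roots_of)
    have deg: "degree R < e y"
      unfolding R_def by (rule degree_sum_less) (use ly in \<open>auto intro: le_less_trans[OF degree_monom_le]\<close>)
    have "R = 0"
    proof (rule ccontr)
      assume R: "R \<noteq> 0"
      have "e y \<le> card {c. poly R c = 0}"
        using card_mono[OF poly_roots_finite[OF R] sub] card by simp
      also have "\<dots> \<le> degree R" by (rule card_poly_roots_bound[OF R])
      finally show False using deg by simp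
    qed
    then have "coeff R i = 0" by simp
    then have "r i x = 0" using i by (simp add: R_def coeff_sum)
    then show ?thesis by simp
  qed auto
  then have MN: "(?M x * ?N x) * r i x = 0" if "i < e y" for i x using that by simp
  have "r i x = 0" if "i < e y" for i x
    by (rule polyfun_mult_eq_0[where I = "I - {y}" and p = "\<lambda>x. ?M x * ?N x" and q = "r i"
          and ?x0.0 = "\<lambda>_. 1", OF polyfun_mult[OF MI NI] qr(2) MN[OF that]]) simp
  then have "?M x ^ k * h x = q x * tri x" for x using qr(3)[of x] by simp
  then have "(\<Prod>t\<in>V 1 - {y}. x t ^ (e t * k)) * h x = q x * tri x" for x
    by (simp add: monomial_def prod_power_distrib power_mult)
  note eq = this
  show ?thesis
    by (rule cancel_monomial[where n = "\<lambda>t. e t * k" and S = "V 1 - {y}", OF _ _ h qr(1) eq]) auto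
qed

lemma X_psubset: "(X :: ('v \<Rightarrow> 'a::field_char_0) set) \<subset> affine_space I"
proof -
  let ?x = "\<lambda>i. if i \<in> I then 1 else 0 :: 'a"
  have "tri ?x = tri (\<lambda>_. 1 :: 'a)" by (rule polyfun_cong[OF polyfun_tri]) simp
  also have "\<dots> = 3" by (simp add: tri_def)
  finally have "?x \<notin> X" by (simp add: X_def)
  moreover have "?x \<in> affine_space I" by (simp add: affine_space_def)
  ultimately show ?thesis using X_subset by blast
qed

lemma I_nonempty: "I \<noteq> {}"
  using V_nonempty in_I[of 1] by auto

text \<open>Every polynomial vanishing on \<open>X\<close> is a multiple \<open>q * tri\<close>. If
  the gradient were zero at \<open>x\<close>, the product rule would make its derivative zero in
  every direction, and the tangent space would be the whole affine space.\<close>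

lemma regular_point_grad:
  fixes x :: "'v \<Rightarrow> 'a::{alg_closed_field, field_char_0}"
  assumes "regular_point I X x"
  shows "\<exists>w\<in>I. grad w x \<noteq> 0"
proof (rule ccontr)
  assume neg: "\<not> (\<exists>w\<in>I. grad w x \<noteq> 0)"
  have x: "x \<in> X" and dim: "enat (fdim (tangent_space I X x)) = local_dim I X x"
    using assms by (auto simp: regular_point_def)
  obtain T :: "('v, 'a) mpol" where T: "mvars T \<subseteq> I" "tri = meval T" using polyfun_tri by (rule polyfunE)
  have "mdiff I f x v = 0" if f: "f \<in> vanishing_ideal I X" for f v
  proof -
    have fI: "mvars f \<subseteq> I" and f0: "\<And>x. x \<in> X \<Longrightarrow> meval f x = 0"
      using f by (auto simp: vanishing_ideal_def)
    obtain q where q: "polyfun I q" "\<And>x. meval f x = q x * tri x"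
      using vanishing_imp_multiple[OF polyfun_meval[OF fI] f0] by blast
    obtain p where p: "mvars p \<subseteq> I" "q = meval p" using q(1) by (rule polyfunE)
    let ?c = "\<lambda>t i. x i + t * v i"
    obtain P where P: "\<And>t. meval p (?c t) = poly P t"
      using meval_along_curve_deriv[OF finite_I p(1) velocity_line[of x v]] by blast
    obtain Q where Q: "\<And>t. meval T (?c t) = poly Q t"
      using meval_along_curve_deriv[OF finite_I T(1) velocity_line[of x v]] by blast
    have "poly (pderiv Q) 0 = mdiff I T x v" by (rule mdiff_line[OF finite_I T(1) Q, symmetric])
    also have "\<dots> = 0" using mdiff_tri[OF T(1) T(2)[symmetric], of x v] neg by (simp add: sum.neutral)
    finally have Q': "poly (pderiv Q) 0 = 0" .
    have Q0: "poly Q 0 = 0" using Q[of 0] x by (simp add: X_def T(2))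
    have "meval f (?c t) = poly (P * Q) t" for t by (simp add: q(2) p(2) T(2) P Q)
    from mdiff_line[OF finite_I fI this] show ?thesis by (simp add: pderiv_mult Q0 Q')
  qed
  then have "tangent_space I X x = affine_space I" by (auto simp: tangent_space_mdiff)
  then have "enat (card I) \<le> local_dim I X x"
    using card_le_fdim_affine_space[OF finite_I, where 'a = 'a] dim[symmetric] by simp
  also have "\<dots> < enat (card I)" by (rule local_dim_less[OF finite_I I_nonempty X_psubset])
  finally show False by simp
qed

lemma tangent_space_grad:
  fixes x :: "'v \<Rightarrow> 'a::field_char_0"
  assumes "v \<in> tangent_space I X x"
  shows "(\<Sum>w\<in>I. grad w x * v w) = 0"
proof -
  obtain T :: "('v, 'a) mpol" where T: "mvars T \<subseteq> I" "tri = meval T" using polyfun_tri by (rule polyfunE)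
  have "T \<in> vanishing_ideal I X" using T by (auto simp: vanishing_ideal_def X_def)
  then show ?thesis using assms mdiff_tri[OF T(1) T(2)[symmetric]] by (auto simp: tangent_space_mdiff)
qed

end

section \<open>Additive group actions on trinomial hypersurfaces\<close>

text \<open>The difference quotient of the \<open>l\<close>-th power between \<open>a\<close> and
  \<open>b\<close>, written without division so that \<open>a = b\<close> is allowed; there it is
  the derivative.\<close>

definition geom :: "nat \<Rightarrow> 'a \<Rightarrow> 'a \<Rightarrow> 'a::comm_ring_1" where
  "geom l a b = (\<Sum>i<l. a ^ (l - Suc i) * b ^ i)"

lemma geom_diff: "(b - a) * geom l a b = b ^ l - a ^ l"
  by (simp add: geom_def power_diff_sumr2)

lemma geom_same: "geom l a a = of_nat l * a ^ (l - 1)"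
proof -
  have "geom l a a = (\<Sum>i<l. a ^ (l - 1))"
    unfolding geom_def by (rule sum.cong) (auto simp: power_add[symmetric])
  then show ?thesis by simp
qed

text \<open>Multiplied by \<open>m\<close>, this says that the increment of the \<open>l\<close>-th
  power from \<open>a\<close> to \<open>a + (s + t) * m\<close> is the sum of the increments over
  two partial steps. It makes the flows below additive in time.\<close>

lemma geom_add:
  fixes a m :: "'a::field"
  shows "(s + t) * geom l a (a + (s + t) * m) =
    t * geom l a (a + t * m) + s * geom l (a + t * m) (a + t * m + s * m)"
proof (cases "m = 0")
  case True
  then show ?thesis by (simp add: algebra_simps)
next
  case False
  have e: "a + t * m + s * m = a + (s + t) * m" by (simp add: algebra_simps)
  have "m * ((s + t) * geom l a (a + (s + t) * m)) = (a + (s + t) * m) ^ l - a ^ l"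
    using geom_diff[of "a + (s + t) * m" a l] by (simp add: mult.assoc mult.left_commute)
  moreover have "m * (t * geom l a (a + t * m)) = (a + t * m) ^ l - a ^ l"
    using geom_diff[of "a + t * m" a l] by (simp add: mult.assoc mult.left_commute)
  moreover have "m * (s * geom l (a + t * m) (a + t * m + s * m)) = (a + (s + t) * m) ^ l - (a + t * m) ^ l"
    using geom_diff[of "a + t * m + s * m" "a + t * m" l] by (simp add: mult.assoc mult.left_commute flip: e)
  ultimately have "m * ((s + t) * geom l a (a + (s + t) * m)) =
      m * (t * geom l a (a + t * m) + s * geom l (a + t * m) (a + t * m + s * m))"
    by (simp only: distrib_left) simp
  then show ?thesis using False by simp
qed

text \<open>The flow of the derivation sending \<open>x j\<close> to \<open>m\<close> and each other
  \<open>x k\<close> to \<open>- l * x j ^ (l - 1) * W k\<close>, when \<open>m\<close> and all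
  \<open>W k\<close> are constants of the flow. Then \<open>x j\<close> moves linearly, and
  \<open>x k\<close> changes by \<open>- W k / m\<close> times the increment of
  \<open>x j ^ l\<close>; \<open>geom\<close> avoids the division.\<close>

definition shear :: "'v \<Rightarrow> nat \<Rightarrow> (('v \<Rightarrow> 'a) \<Rightarrow> 'a) \<Rightarrow> ('v \<Rightarrow> ('v \<Rightarrow> 'a) \<Rightarrow> 'a) \<Rightarrow> 'a \<Rightarrow> ('v \<Rightarrow> 'a) \<Rightarrow> 'v \<Rightarrow> 'a::field" where
  "shear j l m W s x = (\<lambda>k. if k = j then x j + s * m x else x k - s * W k x * geom l (x j) (x j + s * m x))"

lemma shear_action:
  fixes X :: "('v \<Rightarrow> 'a::field) set"
  assumes j: "j \<in> I" and m: "polyfun I m" and W: "\<And>k. polyfun I (W k)"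
    and m_inv: "\<And>s x. m (shear j l m W s x) = m x"
    and W_inv: "\<And>k s x. W k (shear j l m W s x) = W k x"
    and closed: "\<And>s x. x \<in> X \<Longrightarrow> shear j l m W s x \<in> X"
  shows "regular_Ga_action I X (shear j l m W)"
  unfolding regular_Ga_action_def
proof (intro conjI allI ballI)
  fix x s t assume "x \<in> X"
  show "shear j l m W s x \<in> X" by (rule closed) fact
  show "shear j l m W 0 x = x" by (auto simp: shear_def)
  let ?y = "shear j l m W t x"
  have yj: "?y j = x j + t * m x" by (simp add: shear_def)
  show "shear j l m W (s + t) x = shear j l m W s ?y"
  proof
    fix k
    show "shear j l m W (s + t) x k = shear j l m W s ?y k"
    proof (cases "k = j")
      case True
      then show ?thesis
        by (simp add: shear_def[of _ _ _ _ s ?y] shear_def[of _ _ _ _ "s + t"] m_inv yj algebra_simps)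
    next
      case False
      have "shear j l m W s ?y k = ?y k - s * W k x * geom l (x j + t * m x) (x j + t * m x + s * m x)"
        using False by (simp add: shear_def[of _ _ _ _ s ?y] m_inv W_inv yj)
      also have "\<dots> = x k - W k x * (t * geom l (x j) (x j + t * m x) + s * geom l (x j + t * m x) (x j + t * m x + s * m x))"
        using False by (simp add: shear_def algebra_simps)
      also have "\<dots> = x k - W k x * ((s + t) * geom l (x j) (x j + (s + t) * m x))"
        by (simp only: geom_add)
      also have "\<dots> = shear j l m W (s + t) x k"
        using False by (simp add: shear_def algebra_simps)
      finally show ?thesis by simp
    qed
  qed
next
  fix i assume i: "i \<in> I"
  let ?J = "insert None (Some ` I)"
  have lift: "polyfun ?J (\<lambda>z. F (\<lambda>v. z (Some v)))" if "polyfun I F" for F :: "('v \<Rightarrow> 'a) \<Rightarrow> 'a"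
    by (rule polyfun_subst[OF that]) auto
  let ?F = "\<lambda>z. shear j l m W (z None) (\<lambda>v. z (Some v)) i"
  have pj: "polyfun ?J (\<lambda>z. z (Some j) + z None * m (\<lambda>v. z (Some v)))"
    using j by (intro polyfun_add polyfun_mult polyfun_var lift m) auto
  have "polyfun ?J ?F"
  proof (cases "i = j")
    case True
    then show ?thesis using pj by (simp add: shear_def)
  next
    case False
    have "polyfun ?J (\<lambda>z. geom l (z (Some j)) (z (Some j) + z None * m (\<lambda>v. z (Some v))))"
      unfolding geom_def using j by (intro polyfun_sum polyfun_mult polyfun_power polyfun_var pj) auto
    then have "polyfun ?J (\<lambda>z. z (Some i) - z None * W i (\<lambda>v. z (Some v)) *
        geom l (z (Some j)) (z (Some j) + z None * m (\<lambda>v. z (Some v))))"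
      using i by (intro polyfun_diff polyfun_mult polyfun_var lift W) auto
    then show ?thesis using False by (simp add: shear_def)
  qed
  then obtain F where F: "mvars F \<subseteq> ?J" "?F = meval F" by (rule polyfunE)
  have "shear j l m W t x i = meval F (case_option t x)" for t x
    using fun_cong[OF F(2), of "case_option t x"] by simp
  then show "\<exists>F. mvars F \<subseteq> ?J \<and> (\<forall>t. \<forall>x\<in>X. shear j l m W t x i = meval F (case_option t x))"
    using F(1) by blast
qed

lemma shear_velocity:
  "velocity_at_0 (\<lambda>t. shear j l m W t x)
    (\<lambda>k. if k = j then m x else - (of_nat l * x j ^ (l - 1) * W k x))"
  unfolding velocity_at_0_def
proof
  fix k
  show "\<exists>p. (\<forall>t. shear j l m W t x k = poly p t) \<and>
      (if k = j then m x else - (of_nat l * x j ^ (l - 1) * W k x)) = poly (pderiv p) 0"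
  proof (cases "k = j")
    case True
    then show ?thesis by (intro exI[of _ "[:x j, m x:]"]) (simp add: shear_def pderiv_pCons)
  next
    case False
    let ?g = "\<Sum>i<l. [:x j:] ^ (l - Suc i) * [:x j, m x:] ^ i"
    let ?p = "[:x k:] - [:0, W k x:] * ?g"
    have g: "poly ?g t = geom l (x j) (x j + t * m x)" for t
      by (simp add: geom_def poly_sum)
    have "shear j l m W t x k = poly ?p t" for t
      using False by (simp add: shear_def g)
    moreover have "poly (pderiv ?p) 0 = - (of_nat l * x j ^ (l - 1) * W k x)"
      using g[of 0] by (simp add: pderiv_diff pderiv_mult pderiv_pCons geom_same)
    ultimately show ?thesis using False by (intro exI[of _ ?p]) simp
  qed
qed

context trinomial_blocks
begin

text \<open>For \<open>i \<noteq> j\<close> the gradient annihilates this vector. For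
  \<open>i = j\<close> the order of the tests gives a vector that need not be zero, which is why
  \<open>rot_linked\<close> treats equality apart.\<close>

definition rot :: "'v \<Rightarrow> 'v \<Rightarrow> ('v \<Rightarrow> 'a) \<Rightarrow> 'v \<Rightarrow> 'a::field" where
  "rot i j x = (\<lambda>k. if k = j then grad i x else if k = i then - grad j x else 0)"

lemma shear_mono:
  assumes "j \<notin> S" "\<And>k. k \<in> S \<Longrightarrow> W k x = 0"
  shows "monomial S (shear j l m W s x) = monomial S x"
  by (rule monomial_cong) (use assms in \<open>auto simp: shear_def\<close>)

lemma shear_affine_space:
  assumes "j \<in> I" "\<And>k. k \<notin> I \<Longrightarrow> W k x = 0" "x \<in> affine_space I"
  shows "shear j l m W s x \<in> affine_space I"
  using assms by (auto simp: affine_space_def shear_def)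

text \<open>The locally nilpotent derivation sends \<open>j\<close> to the cofactor of the linear variable \<open>i\<close>, and
  \<open>i\<close> to minus the partial derivative with respect to \<open>j\<close>.\<close>

lemma rot_linear_tangent:
  fixes x :: "'v \<Rightarrow> 'a::field_char_0"
  assumes abc: "{a, b, c} = {0..2}" and i: "i \<in> V a" "e i = 1" and j: "j \<in> V b"
  shows "rot i j x \<in> Ga_orbit_tangents I X x"
proof -
  note ne = distinct_3[OF abc]
  define M N :: "('v \<Rightarrow> 'a) \<Rightarrow> 'a" where "M = monomial (V a - {i})" and "N = monomial (V b - {j})"
  define W where "W = (\<lambda>k. if k = i then N else (\<lambda>x. 0))"
  have ij: "i \<noteq> j" "j \<notin> V a" "i \<notin> V b" "i \<notin> V c" "j \<notin> V c"
    using V_disjoint[OF ne(1)] V_disjoint[OF ne(2)] V_disjoint[OF ne(3)] i(1) j by blast+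
  have I: "i \<in> I" "j \<in> I" using in_I i j ne by blast+
  have inv: "monomial S (shear j (e j) M W s x) = monomial S x" if "j \<notin> S" "i \<notin> S" for S s and x :: "'v \<Rightarrow> 'a"
    by (rule shear_mono[OF that(1)]) (use that(2) in \<open>auto simp: W_def\<close>)
  have invs: "M (shear j (e j) M W s x) = M x" "N (shear j (e j) M W s x) = N x" for s x
    unfolding M_def N_def by (rule inv[unfolded M_def]; use ij in blast)+
  have "shear j (e j) M W s x \<in> X" if x: "x \<in> X" for s x
  proof -
    let ?y = "shear j (e j) M W s x"
    let ?g = "geom (e j) (x j) (x j + s * M x)"
    have "tri ?y = monomial (V a) ?y + monomial (V b) ?y + monomial (V c) ?y" by (rule tri_3[OF abc])
    also have "monomial (V a) ?y = ?y i * M ?y" using monomial_remove[OF finite_V i(1), of ?y] i(2) by (simp add: M_def)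
    also have "\<dots> = (x i - s * N x * ?g) * M x" unfolding invs using ij by (simp add: shear_def W_def)
    also have "monomial (V b) ?y = ?y j ^ e j * N ?y" using monomial_remove[OF finite_V j, of ?y] by (simp add: N_def)
    also have "\<dots> = (x j + s * M x) ^ e j * N x" unfolding invs by (simp add: shear_def)
    \<comment> \<open>The monomial of \<open>j\<close> grows by \<open>s * M x * ?g * N x\<close>.
      The shift of \<open>i\<close> takes exactly this away from the other monomial, in which
      \<open>i\<close> is linear.\<close>
    also have "(x j + s * M x) ^ e j = x j ^ e j + s * M x * ?g"
      using geom_diff[of "x j + s * M x" "x j" "e j"] by (simp add: algebra_simps)
    also have "monomial (V c) ?y = monomial (V c) x" by (rule inv) (use ij in auto)
    also have "(x i - s * N x * ?g) * M x + (x j ^ e j + s * M x * ?g) * N x + monomial (V c) x =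
        x i * M x + x j ^ e j * N x + monomial (V c) x" by (simp add: algebra_simps)
    also have "\<dots> = tri x"
      using monomial_remove[OF finite_V i(1), of x] monomial_remove[OF finite_V j, of x] i(2)
      by (simp add: tri_3[OF abc] M_def N_def)
    finally have "tri ?y = 0" using x by (simp add: X_def)
    moreover have "?y \<in> affine_space I"
      by (rule shear_affine_space[OF I(2)]) (use x I in \<open>auto simp: X_def W_def\<close>)
    ultimately show ?thesis by (simp add: X_def)
  qed
  moreover have "polyfun I M" "polyfun I N"
    unfolding M_def N_def by (rule polyfun_monomial; use V_subset_I ne in blast)+
  moreover from this have "polyfun I (W k)" for k by (simp add: W_def polyfun_const)
  moreover have "W k (shear j (e j) M W s x) = W k x" for k s x
  proof -
    have "W i = N" "k \<noteq> i \<Longrightarrow> W k = (\<lambda>x. 0)" by (simp_all add: W_def)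
    then show ?thesis using invs by (cases "k = i") auto
  qed
  ultimately have "regular_Ga_action I X (shear j (e j) M W)"
    by (intro shear_action I invs)
  moreover have "(\<lambda>k. if k = j then M x else - (of_nat (e j) * x j ^ (e j - 1) * W k x)) = rot i j x"
    using ij ne i by (auto simp: rot_def W_def fun_eq_iff grad_eq[OF _ i(1)] grad_eq[OF _ j] M_def N_def)
  ultimately show ?thesis
    unfolding Ga_orbit_tangents_def using shear_velocity[of j "e j" M W x] by auto
qed

section \<open>Actions from squared variables\<close>

definition half_mono :: "'v set \<Rightarrow> ('v \<Rightarrow> 'a::comm_semiring_1) \<Rightarrow> 'a" where
  "half_mono S x = (\<Prod>v\<in>S. x v ^ (e v div 2))"

lemma half_mono_square:
  assumes "\<And>v. v \<in> S \<Longrightarrow> even (e v)"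
  shows "half_mono S x ^ 2 = monomial S x"
  unfolding half_mono_def monomial_def prod_power_distrib power_mult[symmetric]
  by (rule prod.cong) (use assms in auto)

lemma polyfun_half_mono: "S \<subseteq> J \<Longrightarrow> polyfun J (half_mono S)"
proof -
  assume "S \<subseteq> J"
  then have "polyfun J (\<lambda>x. \<Prod>v\<in>S. x v ^ (e v div 2))" by (intro polyfun_prod polyfun_power polyfun_var) auto
  then show ?thesis by (simp add: half_mono_def[abs_def])
qed

text \<open>With \<open>P\<close> and \<open>Q\<close> the square roots of the cofactors of \<open>i\<^sup>2\<close> and \<open>j\<^sup>2\<close>, the sum of the first
  two monomials is \<open>u * v\<close> for \<open>u = x i * P + \<iota> * x j * Q\<close> and \<open>v = x i * P - \<iota> * x j * Q\<close>.
  The action fixes \<open>u\<close> and moves \<open>v\<close> and \<open>w\<close>; the factor \<open>P * Q\<close> makes it polynomial in \<open>i\<close> and \<open>j\<close>.\<close>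

lemma square_tangent:
  fixes x :: "'v \<Rightarrow> 'a::field_char_0" and \<iota> :: 'a
  assumes abc: "{a, b, c} = {0..2}" and i: "i \<in> V a" "e i = 2" and j: "j \<in> V b" "e j = 2" and w: "w \<in> V c"
    and ev: "\<And>v. v \<in> V a \<Longrightarrow> even (e v)" "\<And>v. v \<in> V b \<Longrightarrow> even (e v)" and \<iota>: "\<iota> ^ 2 = - 1"
  defines "P \<equiv> half_mono (V a - {i})" and "Q \<equiv> half_mono (V b - {j})"
  shows "(\<lambda>k. if k = w then (x i * P x + \<iota> * x j * Q x) * P x * Q x
      else if k = i then - (grad w x * Q x / 2) else if k = j then - (\<iota> * grad w x * P x / 2) else 0)
    \<in> Ga_orbit_tangents I X x"
proof -
  note ne = distinct_3[OF abc]
  define n :: "('v \<Rightarrow> 'a) \<Rightarrow> 'a" where "n = monomial (V c - {w})"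
  define u where "u = (\<lambda>x. x i * P x + \<iota> * x j * Q x)"
  define m where "m = (\<lambda>x. u x * P x * Q x)"
  \<comment> \<open>The factors 1/2 and \<open>\<iota>\<close> are chosen such that the changes of
    the two terms of \<open>u\<close> cancel, while \<open>x i * P x - \<iota> * x j * Q x\<close>
    decreases by \<open>s * n x * P x * Q x\<close> times the difference quotient in
    \<open>w\<close>. Multiplied by \<open>u\<close> this balances the growth of the monomial of
    \<open>w\<close>.\<close>
  define W where "W = (\<lambda>k. if k = i then (\<lambda>x. n x * Q x * (1 / 2))
    else if k = j then (\<lambda>x. \<iota> * n x * P x * (1 / 2)) else (\<lambda>x. 0))"
  have ij: "i \<noteq> j" "i \<noteq> w" "j \<noteq> w" "w \<notin> V a" "w \<notin> V b" "i \<notin> V b" "i \<notin> V c" "j \<notin> V a" "j \<notin> V c"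
    using V_disjoint[OF ne(1)] V_disjoint[OF ne(2)] V_disjoint[OF ne(3)] i(1) j(1) w by blast+
  have I: "i \<in> I" "j \<in> I" "w \<in> I" using in_I i(1) j(1) w ne by blast+
  have unmoved: "shear w (e w) m W s x v = x v" if "v \<noteq> w" "v \<noteq> i" "v \<noteq> j" for s x v
    using that by (simp add: shear_def W_def)
  have invs: "P (shear w (e w) m W s x) = P x" "Q (shear w (e w) m W s x) = Q x"
    "n (shear w (e w) m W s x) = n x" for s x
  proof -
    have unm: "shear w (e w) m W s x v = x v" if "v \<in> V a - {i} \<or> v \<in> V b - {j} \<or> v \<in> V c - {w}" for v
      by (rule unmoved) (use that ij in auto)
    show "P (shear w (e w) m W s x) = P x" "Q (shear w (e w) m W s x) = Q x"
      "n (shear w (e w) m W s x) = n x"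
      unfolding P_def Q_def n_def half_mono_def monomial_def
      by (rule prod.cong[OF HOL.refl], subst unm, blast, rule HOL.refl)+
  qed
  have yi: "shear w (e w) m W s x i = x i - s * n x * Q x * (1 / 2) * geom (e w) (x w) (x w + s * m x)" for s x
    using ij by (simp add: shear_def W_def)
  have yj: "shear w (e w) m W s x j = x j - s * \<iota> * n x * P x * (1 / 2) * geom (e w) (x w) (x w + s * m x)" for s x
    using ij by (simp add: shear_def W_def)
  have yw: "shear w (e w) m W s x w = x w + s * m x" for s x by (simp add: shear_def)
  have \<iota>2: "\<iota> * (\<iota> * z) = - z" for z
    using \<iota> by (simp add: power2_eq_square mult.assoc[symmetric])
  have uinv: "u (shear w (e w) m W s x) = u x" for s x
    by (simp add: u_def invs yi yj algebra_simps \<iota>2)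
  have uv: "monomial (V a) x + monomial (V b) x = u x * (x i * P x - \<iota> * x j * Q x)" for x
  proof -
    have "monomial (V a) x = (x i * P x) ^ 2"
      using monomial_remove[OF finite_V i(1), of x] half_mono_square[of "V a - {i}" x] ev(1) i(2)
      by (simp add: P_def power_mult_distrib)
    moreover have "monomial (V b) x = (x j * Q x) ^ 2"
      using monomial_remove[OF finite_V j(1), of x] half_mono_square[of "V b - {j}" x] ev(2) j(2)
      by (simp add: Q_def power_mult_distrib)
    ultimately show ?thesis by (simp add: u_def power2_eq_square algebra_simps \<iota>2)
  qed
  have "shear w (e w) m W s x \<in> X" if x: "x \<in> X" for s x
  proof -
    let ?y = "shear w (e w) m W s x"
    let ?g = "geom (e w) (x w) (x w + s * m x)"
    have "tri ?y = monomial (V a) ?y + monomial (V b) ?y + monomial (V c) ?y" by (rule tri_3[OF abc])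
    also have "monomial (V a) ?y + monomial (V b) ?y = u x * (?y i * P x - \<iota> * ?y j * Q x)"
      unfolding uv uinv invs ..
    also have "\<dots> = u x * (x i * P x - \<iota> * x j * Q x) - s * m x * ?g * n x"
      unfolding yi yj by (simp add: algebra_simps \<iota>2 m_def)
    also have "monomial (V c) ?y = ?y w ^ e w * n ?y" using monomial_remove[OF finite_V w, of ?y] by (simp add: n_def)
    also have "\<dots> = (x w + s * m x) ^ e w * n x" unfolding invs yw ..
    also have "(x w + s * m x) ^ e w = x w ^ e w + s * m x * ?g"
      using geom_diff[of "x w + s * m x" "x w" "e w"] by (simp add: algebra_simps)
    also have "u x * (x i * P x - \<iota> * x j * Q x) - s * m x * ?g * n x + (x w ^ e w + s * m x * ?g) * n x = tri x"
      using monomial_remove[OF finite_V w, of x] uv[of x] by (simp add: tri_3[OF abc] n_def algebra_simps)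
    finally have "tri ?y = 0" using x by (simp add: X_def)
    moreover have "?y \<in> affine_space I"
      by (rule shear_affine_space[OF I(3)]) (use x I in \<open>auto simp: X_def W_def\<close>)
    ultimately show ?thesis by (simp add: X_def)
  qed
  note closed = this
  have PQn: "polyfun I P" "polyfun I Q" "polyfun I n"
    unfolding P_def Q_def n_def
    by (rule polyfun_half_mono polyfun_monomial; use V_subset_I ne in blast)+
  have pm: "polyfun I m"
    unfolding m_def u_def by (intro polyfun_mult polyfun_add polyfun_var polyfun_const PQn I)
  have pW: "polyfun I (W k)" for k
  proof -
    have "polyfun I (\<lambda>x. n x * Q x * (1 / 2))" "polyfun I (\<lambda>x. \<iota> * n x * P x * (1 / 2))"
      by (intro polyfun_mult polyfun_const PQn)+
    then show ?thesis by (simp add: W_def polyfun_const)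
  qed
  have "regular_Ga_action I X (shear w (e w) m W)"
  proof (rule shear_action[OF I(3) pm pW _ _ closed])
    show "m (shear w (e w) m W s x) = m x" for s x by (subst (1 2) m_def) (simp add: uinv invs)
    show "W k (shear w (e w) m W s x) = W k x" for k s x
    proof -
      have "W i = (\<lambda>x. n x * Q x * (1 / 2))" "W j = (\<lambda>x. \<iota> * n x * P x * (1 / 2))"
        "k \<noteq> i \<Longrightarrow> k \<noteq> j \<Longrightarrow> W k = (\<lambda>x. 0)" using ij by (simp_all add: W_def)
      then show ?thesis using invs by (cases "k = i"; cases "k = j") auto
    qed
  qed
  moreover have "(\<lambda>k. if k = w then m x else - (of_nat (e w) * x w ^ (e w - 1) * W k x)) =
    (\<lambda>k. if k = w then (x i * P x + \<iota> * x j * Q x) * P x * Q x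
      else if k = i then - (grad w x * Q x / 2) else if k = j then - (\<iota> * grad w x * P x / 2) else 0)"
    using ij ne by (auto simp: m_def u_def W_def fun_eq_iff grad_eq[OF _ w] n_def)
  ultimately show ?thesis
    unfolding Ga_orbit_tangents_def using shear_velocity[of w "e w" m W x] by auto
qed

text \<open>Adding the tangents for \<open>\<iota>\<close> and \<open>- \<iota>\<close> removes the
  entry at \<open>j\<close> and leaves \<open>half_mono (V b - {j}) x\<close> times
  \<open>rot i w x\<close>. That factor has to be inverted, whence the assumption on the coordinates
  of \<open>V b\<close> other than \<open>j\<close>.\<close>

lemma rot_square_span:
  fixes x :: "'v \<Rightarrow> 'a::{alg_closed_field, field_char_0}"
  assumes abc: "{a, b, c} = {0..2}" and i: "i \<in> V a" "e i = 2" and j: "j \<in> V b" "e j = 2" and w: "w \<in> V c"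
    and ev: "\<And>v. v \<in> V a \<Longrightarrow> even (e v)" "\<And>v. v \<in> V b \<Longrightarrow> even (e v)"
    and nz: "\<And>v. v \<in> V b - {j} \<Longrightarrow> x v \<noteq> 0"
  shows "rot i w x \<in> fspan (Ga_orbit_tangents I X x)"
proof -
  note ne = distinct_3[OF abc]
  have ij: "i \<noteq> j" "i \<noteq> w" "j \<noteq> w"
    using V_disjoint[OF ne(1)] V_disjoint[OF ne(2)] V_disjoint[OF ne(3)] i(1) j(1) w by blast+
  obtain \<iota> :: 'a where \<iota>: "\<iota> ^ 2 = - 1" using nth_root_exists[of 2 "- 1"] by auto
  then have \<iota>': "(- \<iota>) ^ 2 = - 1" by simp
  let ?P = "half_mono (V a - {i}) x" and ?Q = "half_mono (V b - {j}) x"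
  let ?D = "\<lambda>\<iota> k. if k = w then (x i * ?P + \<iota> * x j * ?Q) * ?P * ?Q
      else if k = i then - (grad w x * ?Q / 2) else if k = j then - (\<iota> * grad w x * ?P / 2) else 0"
  have Q: "?Q \<noteq> 0" using nz by (simp add: half_mono_def)
  have gi: "grad i x = 2 * x i * ?P ^ 2"
    using i half_mono_square[of "V a - {i}" x] ev(1) ne by (simp add: grad_eq[OF _ i(1)])
  have "?D \<iota> + ?D (- \<iota>) \<in> fspan (Ga_orbit_tangents I X x)"
    by (intro fvec.span_add fvec.span_base square_tangent[OF abc i j w ev \<iota>] square_tangent[OF abc i j w ev \<iota>'])
  then have "fscale (1 / ?Q) (?D \<iota> + ?D (- \<iota>)) \<in> fspan (Ga_orbit_tangents I X x)"
    by (rule fvec.span_scale)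
  also have "fscale (1 / ?Q) (?D \<iota> + ?D (- \<iota>)) = rot i w x"
  proof
    fix k
    show "fscale (1 / ?Q) (?D \<iota> + ?D (- \<iota>)) k = rot i w x k"
      using Q ij by (auto simp: fscale_def rot_def gi power2_eq_square field_simps)
  qed
  finally show ?thesis .
qed


section \<open>Blocks with nonzero coordinates\<close>

lemma block_perms:
  assumes "{a, b, c} = {0..2 :: nat}"
  shows "{a, c, b} = {0..2}" "{b, a, c} = {0..2}" "{b, c, a} = {0..2}" "{c, a, b} = {0..2}" "{c, b, a} = {0..2}"
  using assms by (simp_all add: insert_commute)

lemma I_blocks:
  assumes "{a, b, c} = {0..2}" shows "I = V a \<union> V b \<union> V c"
  unfolding I_def assms[symmetric] by auto

definition full :: "nat \<Rightarrow> ('v \<Rightarrow> 'a::zero) \<Rightarrow> bool" where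
  "full k x \<longleftrightarrow> (\<forall>v\<in>V k. x v \<noteq> 0)"

lemma monomial_neq_0_iff_full:
  fixes x :: "'v \<Rightarrow> 'a::idom"
  assumes "k \<le> 2" shows "monomial (V k) x \<noteq> 0 \<longleftrightarrow> full k x"
  using monomial_eq_0_iff[OF finite_V e_pos[OF assms], of k x] by (simp add: full_def)

lemma grad_neq_0_iff:
  fixes x :: "'v \<Rightarrow> 'a::field_char_0"
  assumes "k \<le> 2" "w \<in> V k"
  shows "grad w x \<noteq> 0 \<longleftrightarrow> (e w = 1 \<or> x w \<noteq> 0) \<and> (\<forall>v\<in>V k - {w}. x v \<noteq> 0)"
proof -
  have "monomial (V k - {w}) x \<noteq> 0 \<longleftrightarrow> (\<forall>v\<in>V k - {w}. x v \<noteq> 0)"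
    using monomial_eq_0_iff[of "V k - {w}" x] e_pos[OF assms(1)] by auto
  moreover have "e w - 1 = 0 \<longleftrightarrow> e w = 1" "e w \<noteq> 0" using e_pos[OF assms] by auto
  ultimately show ?thesis by (auto simp: grad_eq[OF assms])
qed

lemma full_grad:
  fixes x :: "'v \<Rightarrow> 'a::field_char_0"
  assumes "full k x" "k \<le> 2" "w \<in> V k" shows "grad w x \<noteq> 0"
  using assms by (auto simp: grad_neq_0_iff[OF assms(2,3)] full_def)

lemma grad_full_or_linear:
  fixes x :: "'v \<Rightarrow> 'a::field_char_0"
  assumes "grad w x \<noteq> 0" "k \<le> 2" "w \<in> V k"
  shows "full k x \<or> e w = 1"
  using assms(1) unfolding grad_neq_0_iff[OF assms(2,3)] full_def by blast

lemma two_full_blocks: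
  fixes x :: "'v \<Rightarrow> 'a::idom"
  assumes abc: "{a, b, c} = {0..2}" and "x \<in> X" "full a x"
  shows "full b x \<or> full c x"
proof -
  have "monomial (V a) x + monomial (V b) x + monomial (V c) x = 0"
    using assms(2) tri_3[OF abc, of x] by (simp add: X_def)
  moreover have "monomial (V a) x \<noteq> 0"
    using assms(3) monomial_neq_0_iff_full distinct_3[OF abc] by blast
  ultimately have "monomial (V b) x \<noteq> 0 \<or> monomial (V c) x \<noteq> 0" by auto
  then show ?thesis using monomial_neq_0_iff_full distinct_3[OF abc] by blast
qed

section \<open>Moving smooth points to points with nonzero coordinates\<close>

definition generic_reachable :: "('v \<Rightarrow> 'a::field) \<Rightarrow> bool" where
  "generic_reachable x \<longleftrightarrow> (\<exists>y. Ga_reach I X x y \<and> (\<forall>w\<in>I. y w \<noteq> 0))"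

lemma generic_reachable_reach: "Ga_reach I X x y \<Longrightarrow> generic_reachable y \<Longrightarrow> generic_reachable x"
  unfolding generic_reachable_def using Ga_reach_trans by blast

lemma reach_nonzero:
  fixes x :: "'v \<Rightarrow> 'a::field_char_0"
  assumes "x \<in> X" "S \<subseteq> I" "\<And>w. w \<in> S \<Longrightarrow> nonvanishing I X x (\<lambda>y. y w)"
  obtains y where "Ga_reach I X x y" "y \<in> X" "\<forall>w\<in>S. y w \<noteq> 0"
proof -
  have "finite S" using assms(2) finite_I by (rule finite_subset)
  moreover have "polyfun I (\<lambda>y. y w)" if "w \<in> S" for w using that assms(2) by (intro polyfun_var) auto
  ultimately obtain y where y: "Ga_reach I X x y" "\<forall>w\<in>S. y w \<noteq> 0"
    by (rule nonvanishing_all[where F = "\<lambda>w y. y w", OF X_subset assms(1) _ _ assms(3)])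
  show ?thesis by (rule that[OF y(1) Ga_reach_in[OF y(1) assms(1)] y(2)])
qed

lemma generic_reachableI:
  fixes x :: "'v \<Rightarrow> 'a::field_char_0"
  assumes "x \<in> X" "\<And>w. w \<in> I \<Longrightarrow> nonvanishing I X x (\<lambda>y. y w)"
  shows "generic_reachable x"
proof -
  obtain y where "Ga_reach I X x y" "\<forall>w\<in>I. y w \<noteq> 0"
    by (rule reach_nonzero[OF assms(1) subset_refl assms(2)])
  then show ?thesis unfolding generic_reachable_def by blast
qed

text \<open>The entry of \<open>rot i j\<close> at \<open>j\<close> is \<open>grad i\<close> and the
  one at \<open>i\<close> is \<open>- grad j\<close>: a nonzero derivative at one of the two
  variables moves the other.\<close>

lemma nonvanishing_rot:
  fixes x :: "'v \<Rightarrow> 'a::field_char_0"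
  assumes "rot i j x \<in> fspan (Ga_orbit_tangents I X x)" "i \<noteq> j"
  shows "grad i x \<noteq> 0 \<Longrightarrow> nonvanishing I X x (\<lambda>y. y j)"
    and "grad j x \<noteq> 0 \<Longrightarrow> nonvanishing I X x (\<lambda>y. y i)"
  by (rule nonvanishing_tangent[OF assms(1)]; use assms(2) in \<open>simp add: rot_def\<close>)+

lemma rot_linear_span:
  fixes x :: "'v \<Rightarrow> 'a::field_char_0"
  assumes abc: "{a, b, c} = {0..2}" and i: "i \<in> V a" "e i = 1" and j: "j \<in> V b \<union> V c"
  shows "rot i j x \<in> fspan (Ga_orbit_tangents I X x)"
  using j
proof
  assume "j \<in> V b"
  show ?thesis by (rule fvec.span_base[OF rot_linear_tangent[OF abc i \<open>j \<in> V b\<close>]])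
next
  assume "j \<in> V c"
  show ?thesis by (rule fvec.span_base[OF rot_linear_tangent[OF block_perms(1)[OF abc] i \<open>j \<in> V c\<close>]])
qed

lemma nonvanishing_linear:
  fixes x :: "'v \<Rightarrow> 'a::field_char_0"
  assumes abc: "{a, b, c} = {0..2}" and i: "i \<in> V a" "e i = 1" and j: "j \<in> V b \<union> V c"
  shows "grad i x \<noteq> 0 \<Longrightarrow> nonvanishing I X x (\<lambda>y. y j)"
    and "grad j x \<noteq> 0 \<Longrightarrow> nonvanishing I X x (\<lambda>y. y i)"
proof -
  have "i \<noteq> j" using i(1) j V_disjoint distinct_3[OF abc] by blast
  note rot = nonvanishing_rot[OF rot_linear_span[OF abc i j] this]
  show "grad i x \<noteq> 0 \<Longrightarrow> nonvanishing I X x (\<lambda>y. y j)" by (rule rot(1))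
  show "grad j x \<noteq> 0 \<Longrightarrow> nonvanishing I X x (\<lambda>y. y i)" by (rule rot(2))
qed

text \<open>A linear variable with nonzero derivative moves each variable of the other two blocks,
  and finitely many such coordinates can be made nonzero at a single point.\<close>

lemma linear_reach:
  fixes x :: "'v \<Rightarrow> 'a::field_char_0"
  assumes abc: "{a, b, c} = {0..2}" and i: "i \<in> V a" "e i = 1" and x: "x \<in> X" "grad i x \<noteq> 0"
  obtains y where "Ga_reach I X x y" "y \<in> X" "full b y" "full c y"
proof -
  have "V b \<union> V c \<subseteq> I" using V_subset_I distinct_3[OF abc] by blast
  then obtain y where "Ga_reach I X x y" "y \<in> X" "\<forall>w\<in>V b \<union> V c. y w \<noteq> 0"
    by (rule reach_nonzero[OF x(1) _ nonvanishing_linear(1)[OF abc i _ x(2)]])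
  then show ?thesis using that by (auto simp: full_def)
qed

lemma nonvanishing_square:
  fixes x :: "'v \<Rightarrow> 'a::{alg_closed_field, field_char_0}"
  assumes abc: "{a, b, c} = {0..2}" and i: "i \<in> V a" "e i = 2" and j: "j \<in> V b" "e j = 2" and w: "w \<in> V c"
    and ev: "\<And>v. v \<in> V a \<Longrightarrow> even (e v)" "\<And>v. v \<in> V b \<Longrightarrow> even (e v)" and "full b x"
  shows "grad i x \<noteq> 0 \<Longrightarrow> nonvanishing I X x (\<lambda>y. y w)"
    and "grad w x \<noteq> 0 \<Longrightarrow> nonvanishing I X x (\<lambda>y. y i)"
proof -
  have "rot i w x \<in> fspan (Ga_orbit_tangents I X x)"
    by (rule rot_square_span[OF abc i j w ev]) (use \<open>full b x\<close> in \<open>auto simp: full_def\<close>)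
  moreover have "i \<noteq> w" using i(1) w V_disjoint distinct_3[OF abc] by blast
  ultimately have rot: "rot i w x \<in> fspan (Ga_orbit_tangents I X x)" "i \<noteq> w" .
  show "grad i x \<noteq> 0 \<Longrightarrow> nonvanishing I X x (\<lambda>y. y w)" by (rule nonvanishing_rot(1)[OF rot])
  show "grad w x \<noteq> 0 \<Longrightarrow> nonvanishing I X x (\<lambda>y. y i)" by (rule nonvanishing_rot(2)[OF rot])
qed

lemma nonvanishing_full: "full k x \<Longrightarrow> w \<in> V k \<Longrightarrow> nonvanishing I X x (\<lambda>y. y w)"
  by (rule nonvanishing_refl) (simp add: full_def)

lemma generic_reachable_blocks:
  fixes x :: "'v \<Rightarrow> 'a::field_char_0"
  assumes abc: "{a, b, c} = {0..2}" and "x \<in> X" "full a x" "full b x"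
    and "\<And>w. w \<in> V c \<Longrightarrow> nonvanishing I X x (\<lambda>y. y w)"
  shows "generic_reachable x"
proof (rule generic_reachableI[OF assms(2)])
  fix w assume "w \<in> I"
  then consider "w \<in> V a" | "w \<in> V b" | "w \<in> V c" unfolding I_blocks[OF abc] by blast
  then show "nonvanishing I X x (\<lambda>y. y w)"
    by cases (rule nonvanishing_full[OF assms(3)] nonvanishing_full[OF assms(4)] assms(5); assumption)+
qed

lemma generic_reachable_squares:
  fixes x :: "'v \<Rightarrow> 'a::{alg_closed_field, field_char_0}"
  assumes abc: "{a, b, c} = {0..2}" and i: "i \<in> V a" "e i = 2" and j: "j \<in> V b" "e j = 2"
    and ev: "\<And>v. v \<in> V a \<Longrightarrow> even (e v)" "\<And>v. v \<in> V b \<Longrightarrow> even (e v)"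
    and x: "x \<in> X" "full a x" "full b x"
  shows "generic_reachable x"
proof (rule generic_reachable_blocks[OF abc x])
  have "grad i x \<noteq> 0" using full_grad[OF x(2) _ i(1)] distinct_3[OF abc] by blast
  note g = this
  show "nonvanishing I X x (\<lambda>y. y w)" if "w \<in> V c" for w
    by (rule nonvanishing_square(1)[OF abc i j that ev x(3) g])
qed

lemma smooth_cases:
  fixes x :: "'v \<Rightarrow> 'a::field_char_0"
  assumes abc: "{a, b, c} = {0..2}" and "\<exists>w\<in>I. grad w x \<noteq> 0"
  obtains w where "w \<in> V a" "grad w x \<noteq> 0" | w where "w \<in> V b" "grad w x \<noteq> 0"
    | w where "w \<in> V c" "grad w x \<noteq> 0"
  using assms(2) unfolding I_blocks[OF abc] by blast

section \<open>Smooth points of the five types\<close>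

text \<open>\<open>c\<close> is the block with all exponents one. A nonzero derivative outside
  \<open>c\<close> moves all of \<open>c\<close>; once \<open>c\<close> is full, any of its
  variables has nonzero derivative and moves the rest. If a derivative in \<open>c\<close> is
  nonzero instead, \<open>linear_reach\<close> makes the other blocks full, and the nonempty
  \<open>V b\<close> leads back to the first case.\<close>

lemma generic_reachable_H1:
  fixes x :: "'v \<Rightarrow> 'a::field_char_0"
  assumes abc: "{a, b, c} = {0..2}" and lin: "\<And>v. v \<in> V c \<Longrightarrow> e v = 1"
    and ne: "V b \<noteq> {}" "V c \<noteq> {}" and x: "x \<in> X" and smooth: "\<exists>w\<in>I. grad w x \<noteq> 0"
  shows "generic_reachable x"
proof -
  note d = distinct_3[OF abc] and cab = block_perms(4)[OF abc]
  have 1: "generic_reachable x" if x: "x \<in> X" and w: "w \<in> V a \<union> V b" "grad w x \<noteq> 0" for w and x :: "'v \<Rightarrow> 'a"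
  proof -
    have "nonvanishing I X x (\<lambda>y. y t)" if "t \<in> V c" for t
      by (rule nonvanishing_linear(2)[OF cab that lin[OF that] w])
    then obtain y where y: "Ga_reach I X x y" "y \<in> X" "\<forall>t\<in>V c. y t \<noteq> 0"
      by (rule reach_nonzero[OF x V_subset_I[OF d(6)]])
    obtain t where t: "t \<in> V c" using ne by blast
    have g: "grad t y \<noteq> 0" using full_grad[OF _ d(6) t] y(3) by (auto simp: full_def)
    have "generic_reachable y"
    proof (rule generic_reachableI[OF y(2)])
      fix w assume "w \<in> I"
      then consider "w \<in> V a \<union> V b" | "w \<in> V c" unfolding I_blocks[OF abc] by blast
      then show "nonvanishing I X y (\<lambda>y. y w)"
      proof cases
        case 1
        show ?thesis by (rule nonvanishing_linear(1)[OF cab t lin[OF t] 1 g])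
      next
        case 2
        show ?thesis by (rule nonvanishing_refl) (rule bspec[OF y(3) 2])
      qed
    qed
    then show ?thesis by (rule generic_reachable_reach[OF y(1)])
  qed
  from abc smooth show ?thesis
  proof (cases rule: smooth_cases)
    case (3 t)
    obtain y where y: "Ga_reach I X x y" "y \<in> X" "full a y" "full b y"
      by (rule linear_reach[OF cab 3(1) lin[OF 3(1)] x 3(2)])
    obtain w where w: "w \<in> V b" using ne by blast
    have "generic_reachable y" using 1[OF y(2), of w] w full_grad[OF y(4) d(5) w] by blast
    then show ?thesis by (rule generic_reachable_reach[OF y(1)])
  qed (use 1[OF x] in blast)+
qed

text \<open>Two full blocks suffice. If they are the squared ones, their variables move
  \<open>c\<close>. Otherwise each variable of the remaining squared block can play
  \<open>i\<close>, with the full squared block as partner, and is moved by a nonzero derivative in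
  the full block \<open>c\<close>. A smooth point has two full blocks except possibly when the
  nonzero derivative belongs to a linear variable of \<open>c\<close>; then
  \<open>linear_reach\<close> makes the squared blocks full.\<close>

lemma generic_reachable_H2:
  fixes x :: "'v \<Rightarrow> 'a::{alg_closed_field, field_char_0}"
  assumes abc: "{a, b, c} = {0..2}" and sq: "\<And>v. v \<in> V a \<union> V b \<Longrightarrow> e v = 2"
    and ne: "V a \<noteq> {}" "V b \<noteq> {}" "V c \<noteq> {}" and x: "x \<in> X" and smooth: "\<exists>w\<in>I. grad w x \<noteq> 0"
  shows "generic_reachable x"
proof -
  note d = distinct_3[OF abc]
  obtain i j t where ijt: "i \<in> V a" "j \<in> V b" "t \<in> V c" using ne by blast
  have e: "e i = 2" "e j = 2" using sq ijt by blast+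
  have ev: "even (e v)" if "v \<in> V a \<union> V b" for v using sq[OF that] by simp
  have ab: "generic_reachable x" if "x \<in> X" "full a x" "full b x" for x :: "'v \<Rightarrow> 'a"
    by (rule generic_reachable_squares[OF abc ijt(1) e(1) ijt(2) e(2) _ _ that]) (use ev in auto)
  have ac: "generic_reachable x" if "full a x" "full c x"
  proof (rule generic_reachable_blocks[OF block_perms(1)[OF abc] x that])
    fix w assume w: "w \<in> V b"
    show "nonvanishing I X x (\<lambda>y. y w)"
      by (rule nonvanishing_square(2)[OF block_perms(2)[OF abc] w _ ijt(1) e(1) ijt(3)])
         (use sq w ev that(1) full_grad[OF that(2) d(6) ijt(3)] in auto)
  qed
  have bc: "generic_reachable x" if "full b x" "full c x"
  proof (rule generic_reachable_blocks[OF block_perms(3)[OF abc] x that])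
    fix w assume w: "w \<in> V a"
    show "nonvanishing I X x (\<lambda>y. y w)"
      by (rule nonvanishing_square(2)[OF abc w _ ijt(2) e(2) ijt(3)])
         (use sq w ev that(1) full_grad[OF that(2) d(6) ijt(3)] in auto)
  qed
  from abc smooth show ?thesis
  proof (cases rule: smooth_cases)
    case (1 w)
    then have "full a x" using grad_full_or_linear[OF 1(2) d(4) 1(1)] sq[of w] by auto
    then show ?thesis using two_full_blocks[OF abc x] ab[OF x] ac by blast
  next
    case (2 w)
    then have "full b x" using grad_full_or_linear[OF 2(2) d(5) 2(1)] sq[of w] by auto
    then show ?thesis using two_full_blocks[OF block_perms(2)[OF abc] x] ab[OF x] bc by blast
  next
    case (3 w)
    from grad_full_or_linear[OF 3(2) d(6) 3(1)] show ?thesis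
    proof
      assume "full c x"
      then show ?thesis using two_full_blocks[OF block_perms(4)[OF abc] x] ac bc by blast
    next
      assume "e w = 1"
      then obtain y where y: "Ga_reach I X x y" "y \<in> X" "full a y" "full b y"
        by (rule linear_reach[OF block_perms(4)[OF abc] 3(1) _ x 3(2)])
      then show ?thesis using ab generic_reachable_reach by blast
    qed
  qed
qed

text \<open>\<open>i\<close> makes the blocks \<open>a\<close> and \<open>c\<close> full; then the
  derivative at \<open>j\<close> is nonzero, and \<open>j\<close> moves the block of
  \<open>i\<close>.\<close>

lemma generic_reachable_two_linear:
  fixes x :: "'v \<Rightarrow> 'a::field_char_0"
  assumes abc: "{a, b, c} = {0..2}" and i: "i \<in> V b" "e i = 1" and j: "j \<in> V c" "e j = 1"
    and x: "x \<in> X" "grad i x \<noteq> 0"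
  shows "generic_reachable x"
proof -
  note d = distinct_3[OF abc]
  obtain y where y: "Ga_reach I X x y" "y \<in> X" "full a y" "full c y"
    by (rule linear_reach[OF block_perms(2)[OF abc] i x])
  have "grad j y \<noteq> 0" by (rule full_grad[OF y(4) d(6) j(1)])
  then have "generic_reachable y"
    by (intro generic_reachable_blocks[OF block_perms(1)[OF abc] y(2-4)]
        nonvanishing_linear(1)[OF block_perms(5)[OF abc] j]) auto
  then show ?thesis by (rule generic_reachable_reach[OF y(1)])
qed

text \<open>It suffices that \<open>b\<close> or \<open>c\<close> is full, as its linear variable
  then has nonzero derivative. A nonzero derivative in \<open>b\<close> or \<open>c\<close> gives
  this or belongs to a linear variable that can replace the given one; a nonzero derivative in
  \<open>a\<close> leads there through the equation or through \<open>linear_reach\<close>.\<close>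

lemma generic_reachable_H3:
  fixes x :: "'v \<Rightarrow> 'a::field_char_0"
  assumes abc: "{a, b, c} = {0..2}" and i: "i \<in> V b" "e i = 1" and j: "j \<in> V c" "e j = 1"
    and x: "x \<in> X" and smooth: "\<exists>w\<in>I. grad w x \<noteq> 0"
  shows "generic_reachable x"
proof -
  note d = distinct_3[OF abc]
  have b: "generic_reachable x" if "x \<in> X" "full b x" for x :: "'v \<Rightarrow> 'a"
    by (rule generic_reachable_two_linear[OF abc i j that(1) full_grad[OF that(2) d(5) i(1)]])
  have c: "generic_reachable x" if "x \<in> X" "full c x" for x :: "'v \<Rightarrow> 'a"
    by (rule generic_reachable_two_linear[OF block_perms(1)[OF abc] j i that(1) full_grad[OF that(2) d(6) j(1)]])
  from abc smooth show ?thesis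
  proof (cases rule: smooth_cases)
    case (1 w)
    from grad_full_or_linear[OF 1(2) d(4) 1(1)] show ?thesis
    proof
      assume "full a x"
      then show ?thesis using two_full_blocks[OF abc x] b[OF x] c[OF x] by blast
    next
      assume "e w = 1"
      then obtain y where "Ga_reach I X x y" "y \<in> X" "full b y"
        by (rule linear_reach[OF abc 1(1) _ x 1(2)])
      then show ?thesis using b generic_reachable_reach by blast
    qed
  next
    case (2 w)
    then show ?thesis
      using grad_full_or_linear[OF 2(2) d(5) 2(1)] b[OF x]
        generic_reachable_two_linear[OF abc 2(1) _ j x 2(2)] by blast
  next
    case (3 w)
    then show ?thesis
      using grad_full_or_linear[OF 3(2) d(6) 3(1)] c[OF x]
        generic_reachable_two_linear[OF block_perms(1)[OF abc] 3(1) _ i x 3(2)] by blast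
  qed
qed

text \<open>All cases aim at full blocks \<open>b\<close> and \<open>c\<close>, whose squared
  variables move \<open>a\<close>. A full block \<open>a\<close> is as good, since \<open>p\<close>
  then has nonzero derivative and makes \<open>b\<close> and \<open>c\<close> full. A nonzero
  derivative in \<open>b\<close> or \<open>c\<close> belongs to an even exponent, hence to a full
  block, and the equation supplies a second one.\<close>

lemma generic_reachable_H4:
  fixes x :: "'v \<Rightarrow> 'a::{alg_closed_field, field_char_0}"
  assumes abc: "{a, b, c} = {0..2}" and p: "p \<in> V a" "e p = 1"
    and i: "i \<in> V b" "e i = 2" and j: "j \<in> V c" "e j = 2"
    and ev: "\<And>v. v \<in> V b \<Longrightarrow> even (e v)" "\<And>v. v \<in> V c \<Longrightarrow> even (e v)"
    and x: "x \<in> X" and smooth: "\<exists>w\<in>I. grad w x \<noteq> 0"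
  shows "generic_reachable x"
proof -
  note d = distinct_3[OF abc]
  have bc: "generic_reachable x" if "x \<in> X" "full b x" "full c x" for x :: "'v \<Rightarrow> 'a"
    by (rule generic_reachable_squares[OF block_perms(3)[OF abc] i j ev that])
  have lin: "generic_reachable x" if w: "w \<in> V a" "e w = 1" "grad w x \<noteq> 0" for w
  proof -
    obtain y where "Ga_reach I X x y" "y \<in> X" "full b y" "full c y"
      by (rule linear_reach[OF abc w(1,2) x w(3)])
    then show ?thesis using bc generic_reachable_reach by blast
  qed
  have a: "generic_reachable x" if "full a x"
    by (rule lin[OF p full_grad[OF that d(4) p(1)]])
  from abc smooth show ?thesis
  proof (cases rule: smooth_cases)
    case (1 w)
    then show ?thesis using grad_full_or_linear[OF 1(2) d(4) 1(1)] a lin by blast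
  next
    case (2 w)
    then have "full b x" using grad_full_or_linear[OF 2(2) d(5) 2(1)] ev(1)[OF 2(1)] by auto
    then show ?thesis using two_full_blocks[OF block_perms(2)[OF abc] x] a bc[OF x] by blast
  next
    case (3 w)
    then have "full c x" using grad_full_or_linear[OF 3(2) d(6) 3(1)] ev(2)[OF 3(1)] by auto
    then show ?thesis using two_full_blocks[OF block_perms(4)[OF abc] x] a bc[OF x] by blast
  qed
qed

text \<open>With all exponents even, a nonzero derivative gives a full block and the equation a
  second one; every pair of blocks has squared variables that move the third.\<close>

lemma generic_reachable_H5:
  fixes x :: "'v \<Rightarrow> 'a::{alg_closed_field, field_char_0}"
  assumes abc: "{a, b, c} = {0..2}" and p: "p \<in> V a" "e p = 2"
    and i: "i \<in> V b" "e i = 2" and j: "j \<in> V c" "e j = 2"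
    and ev: "\<And>v. v \<in> I \<Longrightarrow> even (e v)"
    and x: "x \<in> X" and smooth: "\<exists>w\<in>I. grad w x \<noteq> 0"
  shows "generic_reachable x"
proof -
  note d = distinct_3[OF abc]
  have ev': "even (e v)" if "v \<in> V k" "k \<le> 2" for k v using ev in_I that by blast
  note eva = ev'[OF _ d(4)] and evb = ev'[OF _ d(5)] and evc = ev'[OF _ d(6)]
  have ab: "generic_reachable x" if "full a x" "full b x"
    by (rule generic_reachable_squares[OF abc p i eva evb x that])
  have ac: "generic_reachable x" if "full a x" "full c x"
    by (rule generic_reachable_squares[OF block_perms(1)[OF abc] p j eva evc x that])
  have bc: "generic_reachable x" if "full b x" "full c x"
    by (rule generic_reachable_squares[OF block_perms(3)[OF abc] i j evb evc x that])
  from abc smooth show ?thesis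
  proof (cases rule: smooth_cases)
    case (1 w)
    then have "full a x" using grad_full_or_linear[OF 1(2) d(4) 1(1)] eva[OF 1(1)] by auto
    then show ?thesis using two_full_blocks[OF abc x] ab ac by blast
  next
    case (2 w)
    then have "full b x" using grad_full_or_linear[OF 2(2) d(5) 2(1)] evb[OF 2(1)] by auto
    then show ?thesis using two_full_blocks[OF block_perms(2)[OF abc] x] ab bc by blast
  next
    case (3 w)
    then have "full c x" using grad_full_or_linear[OF 3(2) d(6) 3(1)] evc[OF 3(1)] by auto
    then show ?thesis using two_full_blocks[OF block_perms(4)[OF abc] x] ac bc by blast
  qed
qed

section \<open>Tangent spaces at points with nonzero coordinates\<close>

definition rot_linked :: "('v \<Rightarrow> 'a::field) \<Rightarrow> 'v \<Rightarrow> 'v \<Rightarrow> bool" where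
  "rot_linked x i j \<longleftrightarrow> i = j \<or> rot i j x \<in> fspan (Ga_orbit_tangents I X x)"

lemma rot_linked_sym:
  assumes "rot_linked x i j" shows "rot_linked x j i"
proof (cases "i = j")
  case False
  then have "rot j i x = fscale (- 1) (rot i j x)" by (auto simp: rot_def fscale_def)
  then show ?thesis
    using assms False fvec.span_scale[of "rot i j x" _ "- 1"] by (simp add: rot_linked_def)
qed (simp add: rot_linked_def)

text \<open>Rests on \<open>grad j * rot i k = grad k * rot i j + grad i * rot j k\<close>; a link
  passes through \<open>j\<close> where \<open>grad j\<close> can be divided out.\<close>

lemma rot_linked_trans:
  assumes "rot_linked x i j" "rot_linked x j k" "grad j x \<noteq> 0"
  shows "rot_linked x i k"
proof (cases "i = j \<or> j = k \<or> i = k")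
  case False
  then have "fscale (grad k x) (rot i j x) + fscale (grad i x) (rot j k x) \<in> fspan (Ga_orbit_tangents I X x)"
    using assms by (intro fvec.span_add fvec.span_scale) (auto simp: rot_linked_def)
  then have "fscale (1 / grad j x) (fscale (grad k x) (rot i j x) + fscale (grad i x) (rot j k x))
      \<in> fspan (Ga_orbit_tangents I X x)" by (rule fvec.span_scale)
  also have "fscale (1 / grad j x) (fscale (grad k x) (rot i j x) + fscale (grad i x) (rot j k x)) = rot i k x"
    using False assms(3) by (auto simp: rot_def fscale_def fun_eq_iff)
  finally show ?thesis by (simp add: rot_linked_def)
qed (use assms in \<open>auto simp: rot_linked_def\<close>)

lemma spanned_at_linked:
  fixes x :: "'v \<Rightarrow> 'a::field_char_0"
  assumes r: "r \<in> I" "grad r x \<noteq> 0" and linked: "\<And>j. j \<in> I \<Longrightarrow> rot_linked x r j"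
  shows "spanned_at I X x"
  unfolding spanned_at_def
proof
  fix v assume v: "v \<in> tangent_space I X x"
  have v0: "v k = 0" if "k \<notin> I" for k using v that by (simp add: tangent_space_def affine_space_def)
  \<comment> \<open>Among the summands only \<open>rot r j\<close> has an entry at \<open>j\<close>,
    namely \<open>grad r\<close>; this fixes the coefficients. The entry at \<open>r\<close> then
    equals \<open>v r\<close> by the tangent equation.\<close>
  let ?w = "\<Sum>j\<in>I - {r}. fscale (v j / grad r x) (rot r j x)"
  have "?w k = v k" for k
  proof (cases "k = r")
    case True
    have "?w k = (\<Sum>j\<in>I - {r}. - (grad j x * v j) / grad r x)"
      unfolding sum_function_apply by (rule sum.cong) (use True in \<open>auto simp: fscale_def rot_def\<close>)
    also have "\<dots> = - (\<Sum>j\<in>I - {r}. grad j x * v j) / grad r x"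
      by (simp add: sum_divide_distrib sum_negf)
    also have "(\<Sum>j\<in>I - {r}. grad j x * v j) = - (grad r x * v r)"
      using tangent_space_grad[OF v] sum.remove[OF finite_I r(1), of "\<lambda>w. grad w x * v w"]
      by (simp add: eq_neg_iff_add_eq_0 add.commute)
    finally show ?thesis using True r(2) by simp
  next
    case False
    have "?w k = (\<Sum>j\<in>I - {r}. if k = j then v j else 0)"
      unfolding sum_function_apply by (rule sum.cong) (use False r(2) in \<open>auto simp: fscale_def rot_def\<close>)
    then show ?thesis using False v0[of k] by simp
  qed
  then have "v = ?w" by auto
  also have "?w \<in> fspan (Ga_orbit_tangents I X x)"
    by (intro fvec.span_sum fvec.span_scale) (use linked in \<open>auto simp: rot_linked_def\<close>)
  finally show "v \<in> fspan (Ga_orbit_tangents I X x)" .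
qed

lemma rot_linked_linear:
  fixes x :: "'v \<Rightarrow> 'a::field_char_0"
  assumes abc: "{a, b, c} = {0..2}" and i: "i \<in> V a" "e i = 1" and j: "j \<in> V b \<union> V c"
  shows "rot_linked x i j"
  unfolding rot_linked_def using rot_linear_span[OF assms] by blast

lemma rot_linked_square:
  fixes x :: "'v \<Rightarrow> 'a::{alg_closed_field, field_char_0}"
  assumes abc: "{a, b, c} = {0..2}" and i: "i \<in> V a" "e i = 2" and j: "j \<in> V b" "e j = 2" and w: "w \<in> V c"
    and ev: "\<And>v. v \<in> V a \<Longrightarrow> even (e v)" "\<And>v. v \<in> V b \<Longrightarrow> even (e v)"
    and x: "\<forall>w\<in>I. x w \<noteq> 0"
  shows "rot_linked x i w"
proof -
  have "V b \<subseteq> I" using V_subset_I distinct_3[OF abc] by blast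
  then show ?thesis
    unfolding rot_linked_def by (intro disjI2 rot_square_span[OF abc i j w ev]) (use x in auto)
qed

lemma generic_grad:
  fixes x :: "'v \<Rightarrow> 'a::field_char_0"
  assumes "\<forall>w\<in>I. x w \<noteq> 0" "w \<in> I" shows "grad w x \<noteq> 0"
proof -
  obtain k where k: "k \<le> 2" "w \<in> V k" using assms(2) by (rule I_cases)
  show ?thesis by (rule full_grad[OF _ k]) (use assms(1) V_subset_I[OF k(1)] in \<open>auto simp: full_def\<close>)
qed

text \<open>Every variable of \<open>c\<close> is linked to everything outside \<open>c\<close>; two
  variables of \<open>c\<close> are linked through one in the nonempty block
  \<open>V b\<close>.\<close>

lemma spanned_at_bipartite:
  fixes x :: "'v \<Rightarrow> 'a::field_char_0"
  assumes abc: "{a, b, c} = {0..2}" and x: "\<forall>w\<in>I. x w \<noteq> 0" and ne: "V b \<noteq> {}" "V c \<noteq> {}"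
    and linked: "\<And>t w. t \<in> V c \<Longrightarrow> w \<in> V a \<union> V b \<Longrightarrow> rot_linked x t w"
  shows "spanned_at I X x"
proof -
  obtain t w where tw: "t \<in> V c" "w \<in> V b" using ne by blast
  have I: "t \<in> I" "w \<in> I" using tw I_blocks[OF abc] by auto
  show ?thesis
  proof (rule spanned_at_linked[OF I(1) generic_grad[OF x I(1)]])
    fix j assume "j \<in> I"
    then consider "j \<in> V a \<union> V b" | "j \<in> V c" unfolding I_blocks[OF abc] by blast
    then show "rot_linked x t j"
    proof cases
      case 2
      show ?thesis
        by (rule rot_linked_trans[OF linked[OF tw(1)] rot_linked_sym[OF linked[OF 2]] generic_grad[OF x I(2)]])
           (use tw in auto)
    qed (rule linked[OF tw(1)])
  qed
qed

text \<open>\<open>i\<close> reaches everything outside its own block, in particular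
  \<open>j\<close>, and \<open>j\<close> reaches the block of \<open>i\<close>.\<close>

lemma spanned_at_two_leads:
  fixes x :: "'v \<Rightarrow> 'a::field_char_0"
  assumes abc: "{a, b, c} = {0..2}" and x: "\<forall>w\<in>I. x w \<noteq> 0" and i: "i \<in> V a" and j: "j \<in> V b"
    and "\<And>w. w \<in> V b \<union> V c \<Longrightarrow> rot_linked x i w" "\<And>w. w \<in> V a \<Longrightarrow> rot_linked x j w"
  shows "spanned_at I X x"
proof -
  have I: "i \<in> I" "j \<in> I" using i j I_blocks[OF abc] by auto
  have ij: "rot_linked x i j" using assms(5) j by blast
  show ?thesis
  proof (rule spanned_at_linked[OF I(1) generic_grad[OF x I(1)]])
    fix w assume "w \<in> I"
    then consider "w \<in> V a" | "w \<in> V b \<union> V c" unfolding I_blocks[OF abc] by blast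
    then show "rot_linked x i w"
      using rot_linked_trans[OF ij _ generic_grad[OF x I(2)]] assms(5,6) by cases blast+
  qed
qed

section \<open>Flexibility\<close>

lemma flexibleI:
  assumes "\<And>x :: 'v \<Rightarrow> 'a::{alg_closed_field, field_char_0}. x \<in> X \<Longrightarrow> \<exists>w\<in>I. grad w x \<noteq> 0 \<Longrightarrow> generic_reachable x"
    and "\<And>x :: 'v \<Rightarrow> 'a. \<forall>w\<in>I. x w \<noteq> 0 \<Longrightarrow> spanned_at I X x"
  shows "flexible I (X :: ('v \<Rightarrow> 'a) set)"
  unfolding flexible_def
proof (intro conjI allI impI finite_I)
  obtain T :: "('v, 'a) mpol" where T: "mvars T \<subseteq> I" "tri = meval T" using polyfun_tri by (rule polyfunE)
  show "zariski_closed I (X :: ('v \<Rightarrow> 'a) set)"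
    unfolding zariski_closed_def
    by (intro exI[of _ "{T}"]) (simp add: T(1) zero_locus_def X_def T(2))
  fix x :: "'v \<Rightarrow> 'a" assume reg: "regular_point I X x"
  then have x: "x \<in> X" by (simp add: regular_point_def)
  obtain y where y: "Ga_reach I X x y" "\<forall>w\<in>I. y w \<noteq> 0"
    using assms(1)[OF x regular_point_grad[OF reg]] unfolding generic_reachable_def by blast
  have "spanned_at I X x"
    by (rule Ga_reach_spanned_at[OF finite_I X_subset x y(1) assms(2)[OF y(2)]])
  then show "fspan (Ga_orbit_tangents I X x) = tangent_space I X x"
    using fspan_Ga_orbit_tangents_subset[OF finite_I X_subset x] unfolding spanned_at_def by blast
qed

lemma flexible_H1:
  assumes abc: "{a, b, c} = {0..2}" and lin: "\<And>v. v \<in> V c \<Longrightarrow> e v = 1" and ne: "V b \<noteq> {}" "V c \<noteq> {}"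
  shows "flexible I (X :: ('v \<Rightarrow> 'a::{alg_closed_field, field_char_0}) set)"
proof (rule flexibleI)
  show "spanned_at I X x" if "\<forall>w\<in>I. x w \<noteq> 0" for x :: "'v \<Rightarrow> 'a"
    by (rule spanned_at_bipartite[OF abc that ne]) (rule rot_linked_linear[OF block_perms(4)[OF abc] _ lin])
qed (rule generic_reachable_H1[OF abc lin ne])

lemma flexible_H2:
  assumes abc: "{a, b, c} = {0..2}" and sq: "\<And>v. v \<in> V a \<union> V b \<Longrightarrow> e v = 2"
    and ne: "V a \<noteq> {}" "V b \<noteq> {}" "V c \<noteq> {}"
  shows "flexible I (X :: ('v \<Rightarrow> 'a::{alg_closed_field, field_char_0}) set)"
proof (rule flexibleI)
  show "spanned_at I X x" if x: "\<forall>w\<in>I. x w \<noteq> 0" for x :: "'v \<Rightarrow> 'a"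
  \<comment> \<open>The squared variables lie in \<open>V a \<union> V b\<close>, so the vectors
    obtained from them lead from there to \<open>V c\<close>; hence the reversal.\<close>
  proof (rule spanned_at_bipartite[OF abc x ne(2,3)], rule rot_linked_sym)
    fix t w assume t: "t \<in> V c" and w: "w \<in> V a \<union> V b"
    obtain i j where ij: "i \<in> V a" "j \<in> V b" using ne by blast
    have e: "e i = 2" "e j = 2" "e w = 2" using sq ij w by blast+
    have ev: "even (e v)" if "v \<in> V a \<union> V b" for v using sq[OF that] by simp
    from w show "rot_linked x w t"
    proof
      assume "w \<in> V a"
      show ?thesis by (rule rot_linked_square[OF abc \<open>w \<in> V a\<close> e(3) ij(2) e(2) t _ _ x]) (use ev in auto)
    next
      assume "w \<in> V b"
      show ?thesis
        by (rule rot_linked_square[OF block_perms(2)[OF abc] \<open>w \<in> V b\<close> e(3) ij(1) e(1) t _ _ x]) (use ev in auto)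
    qed
  qed
qed (rule generic_reachable_H2[OF abc sq ne])

lemma flexible_H3:
  assumes abc: "{a, b, c} = {0..2}" and i: "i \<in> V b" "e i = 1" and j: "j \<in> V c" "e j = 1"
  shows "flexible I (X :: ('v \<Rightarrow> 'a::{alg_closed_field, field_char_0}) set)"
proof (rule flexibleI)
  show "spanned_at I X x" if x: "\<forall>w\<in>I. x w \<noteq> 0" for x :: "'v \<Rightarrow> 'a"
    by (rule spanned_at_two_leads[OF block_perms(3)[OF abc] x i(1) j(1)])
       (auto intro: rot_linked_linear[OF block_perms(3)[OF abc] i] rot_linked_linear[OF block_perms(4)[OF abc] j])
qed (rule generic_reachable_H3[OF abc i j])

lemma flexible_H4:
  assumes abc: "{a, b, c} = {0..2}" and p: "p \<in> V a" "e p = 1"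
    and i: "i \<in> V b" "e i = 2" and j: "j \<in> V c" "e j = 2"
    and ev: "\<And>v. v \<in> V b \<Longrightarrow> even (e v)" "\<And>v. v \<in> V c \<Longrightarrow> even (e v)"
  shows "flexible I (X :: ('v \<Rightarrow> 'a::{alg_closed_field, field_char_0}) set)"
proof (rule flexibleI)
  show "spanned_at I X x" if x: "\<forall>w\<in>I. x w \<noteq> 0" for x :: "'v \<Rightarrow> 'a"
    by (rule spanned_at_two_leads[OF abc x p(1) i(1) rot_linked_linear[OF abc p]
          rot_linked_square[OF block_perms(3)[OF abc] i j _ ev x]])
qed (rule generic_reachable_H4[OF abc p i j ev])

lemma flexible_H5:
  assumes abc: "{a, b, c} = {0..2}" and p: "p \<in> V a" "e p = 2"
    and i: "i \<in> V b" "e i = 2" and j: "j \<in> V c" "e j = 2"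
    and ev: "\<And>v. v \<in> I \<Longrightarrow> even (e v)"
  shows "flexible I (X :: ('v \<Rightarrow> 'a::{alg_closed_field, field_char_0}) set)"
proof (rule flexibleI)
  note d = distinct_3[OF abc]
  have ev': "even (e v)" if "v \<in> V k" "k \<le> 2" for k v using ev in_I that by blast
  note eva = ev'[OF _ d(4)] and evb = ev'[OF _ d(5)] and evc = ev'[OF _ d(6)]
  show "spanned_at I X x" if x: "\<forall>w\<in>I. x w \<noteq> 0" for x :: "'v \<Rightarrow> 'a"
  proof (rule spanned_at_two_leads[OF abc x p(1) i(1)])
    \<comment> \<open>\<open>p\<close> reaches \<open>V c\<close> with partner \<open>i\<close> and
      \<open>V b\<close> with partner \<open>j\<close>.\<close>
    show "rot_linked x p w" if "w \<in> V b \<union> V c" for w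
      using that rot_linked_square[OF abc p i _ eva evb x, of w]
        rot_linked_square[OF block_perms(1)[OF abc] p j _ eva evc x, of w] by blast
    show "rot_linked x i w" if "w \<in> V a" for w
      by (rule rot_linked_square[OF block_perms(3)[OF abc] i j that evb evc x])
  qed
qed (rule generic_reachable_H5[OF abc p i j ev])

end

section \<open>From permuted exponent data to blocks\<close>

theorem theorem4:
  fixes n n' :: "nat \<Rightarrow> nat" and l l' :: "nat \<Rightarrow> nat \<Rightarrow> nat"
  assumes "trinomial_data n l"
    and "permuted_data n l n' l'"
    and "type_H1 n' l' \<or> type_H2 n' l' \<or> type_H3 n' l' \<or> type_H4 n' l' \<or> type_H5 n' l'"
  shows "flexible (trinomial_vars n)
    (trinomial_hypersurface n l :: (nat \<times> nat \<Rightarrow> 'a::{alg_closed_field, field_char_0}) set)"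
proof -
  define V where "V = (\<lambda>i. Pair i ` {1..n i})"
  define e where "e = (\<lambda>(i, j). l i j)"
  interpret trinomial_blocks V e
  proof
    show "V k \<inter> V k' = {}" if "k \<noteq> k'" for k k' using that by (auto simp: V_def)
    show "0 < e v" if "k \<le> 2" "v \<in> V k" for k v
      using assms(1) that by (fastforce simp: trinomial_data_def V_def e_def)
    show "V 1 \<noteq> {}" "V 2 \<noteq> {}" using assms(1) by (auto simp: trinomial_data_def V_def)
  qed (simp add: V_def)
  have I: "I = trinomial_vars n"
    unfolding I_def trinomial_vars_def by (auto simp: V_def)
  have "meval (trinomial n l) x = tri x" for x :: "nat \<times> nat \<Rightarrow> 'a"
  proof -
    have pr: "meval (\<Prod>j\<in>S. mvar (i, j) ^ l i j) x = (\<Prod>j\<in>S. x (i, j) ^ l i j)" if "finite S" for i S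
    proof -
      have one: "meval 1 x = 1" by (simp add: meval_single monom_eval_def flip: single_one)
      have "meval (mvar v ^ k) x = x v ^ k" for v k
        by (induction k) (simp_all add: one meval_mult meval_mvar)
      with that show ?thesis by (induction S rule: finite_induct) (simp_all add: one meval_mult)
    qed
    have "monomial (V i) x = (\<Prod>j\<in>{1..n i}. x (i, j) ^ l i j)" for i
      unfolding monomial_def V_def by (subst prod.reindex) (auto simp: inj_on_def e_def)
    then show ?thesis by (simp add: trinomial_def tri_def meval_sum pr)
  qed
  then have X: "(X :: (nat \<times> nat \<Rightarrow> 'a) set) = trinomial_hypersurface n l"
    by (simp add: X_def trinomial_hypersurface_def zero_locus_def I)
  obtain \<pi> \<sigma> where \<pi>: "\<pi> permutes {0..2 :: nat}"
    and \<pi>\<sigma>: "\<forall>i\<in>{0..2}. bij_betw (\<sigma> i) {1..n i} {1..n' (\<pi> i)} \<and> (\<forall>j\<in>{1..n i}. l' (\<pi> i) (\<sigma> i j) = l i j)"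
    using assms(2) unfolding permuted_data_def by (elim exE conjE)
  have \<sigma>: "bij_betw (\<sigma> i) {1..n i} {1..n' (\<pi> i)}" "\<And>j. j \<in> {1..n i} \<Longrightarrow> l' (\<pi> i) (\<sigma> i j) = l i j"
    if "i \<in> {0..2}" for i
    using bspec[OF \<pi>\<sigma> that] by blast+
  \<comment> \<open>The monomial \<open>\<rho> k\<close> of the given data plays the role of the
    monomial \<open>k\<close> of the normal form.\<close>
  define \<rho> where "\<rho> = inv \<pi>"
  have \<rho>: "\<rho> permutes {0..2}" unfolding \<rho>_def by (rule permutes_inv[OF \<pi>])
  have \<pi>\<rho>: "\<pi> (\<rho> k) = k" for k unfolding \<rho>_def by (rule permutes_inverses(1)[OF \<pi>])
  \<comment> \<open>Comparing sets of exponents is enough: each type only says that a block is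
    nonempty, that all its exponents satisfy a condition, or that a certain exponent occurs.\<close>
  have exps: "e ` V (\<rho> k) = l' k ` {1..n' k}" if "k \<le> 2" for k
  proof -
    have k: "\<rho> k \<in> {0..2}" using permutes_in_image[OF \<rho>, of k] that by simp
    have "e ` V (\<rho> k) = l (\<rho> k) ` {1..n (\<rho> k)}" by (simp add: V_def e_def image_image)
    also have "\<dots> = (\<lambda>j. l' k (\<sigma> (\<rho> k) j)) ` {1..n (\<rho> k)}"
      by (rule image_cong) (use \<sigma>(2)[OF k] \<pi>\<rho> in auto)
    also have "\<dots> = l' k ` (\<sigma> (\<rho> k) ` {1..n (\<rho> k)})" by (simp add: image_image)
    also have "\<sigma> (\<rho> k) ` {1..n (\<rho> k)} = {1..n' k}"
      using \<sigma>(1)[OF k] by (simp add: bij_betw_def \<pi>\<rho>)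
    finally show ?thesis .
  qed
  have abc: "{\<rho> 0, \<rho> 1, \<rho> 2} = {0..2}"
  proof -
    have "{0..2 :: nat} = {0, 1, 2}" by auto
    then show ?thesis using permutes_image[OF \<rho>] by simp
  qed
  have ne: "V (\<rho> k) \<noteq> {}" if "1 \<le> n' k" "k \<le> 2" for k
    using exps[OF that(2)] that(1) by auto
  have lead: "\<exists>v\<in>V (\<rho> k). e v = l' k 1" if "1 \<le> n' k" "k \<le> 2" for k
  proof -
    have "l' k 1 \<in> e ` V (\<rho> k)" unfolding exps[OF that(2)] using that(1) by auto
    then show ?thesis by auto
  qed
  have all: "P (e v)" if "v \<in> V (\<rho> k)" "k \<le> 2" "\<And>j. j \<in> {1..n' k} \<Longrightarrow> P (l' k j)" for P v k
  proof -
    have "e v \<in> l' k ` {1..n' k}" using that(1) exps[OF that(2)] by auto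
    then show ?thesis using that(3) by auto
  qed
  \<comment> \<open>The leading exponent 2 is itself even, so the last two types turn into evenness
    of whole blocks together with the occurrence of a 2.\<close>
  have even: "even (e v)" if "v \<in> V (\<rho> k)" "k \<le> 2" "l' k 1 = 2" "\<forall>j\<in>{2..n' k}. even (l' k j)" for k v
  proof (rule all[OF that(1,2)])
    fix j assume "j \<in> {1..n' k}"
    then show "even (l' k j)" using that(3,4) by (cases "j = 1") auto
  qed
  have "flexible I (X :: (nat \<times> nat \<Rightarrow> 'a) set)"
    using assms(3)
  proof (elim disjE)
    assume H: "type_H1 n' l'"
    then have n': "1 \<le> n' 1" "1 \<le> n' 2" by (auto simp: type_H1_def trinomial_data_def)
    show ?thesis
    proof (rule flexible_H1[OF abc])
      show "e v = 1" if "v \<in> V (\<rho> 2)" for v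
        by (rule all[OF that]) (use H in \<open>auto simp: type_H1_def\<close>)
    qed (use ne n' in auto)
  next
    assume H: "type_H2 n' l'"
    then have n': "1 \<le> n' 0" "1 \<le> n' 1" "1 \<le> n' 2" by (auto simp: type_H2_def trinomial_data_def)
    have "e v = 2" if "v \<in> V (\<rho> 0)" for v
      by (rule all[OF that]) (use H in \<open>auto simp: type_H2_def\<close>)
    moreover have "e v = 2" if "v \<in> V (\<rho> 1)" for v
      by (rule all[OF that]) (use H in \<open>auto simp: type_H2_def\<close>)
    ultimately show ?thesis
      by (intro flexible_H2[OF abc]) (use ne n' in auto)
  next
    assume H: "type_H3 n' l'"
    then have n': "1 \<le> n' 1" "1 \<le> n' 2" and l': "l' 1 1 = 1" "l' 2 1 = 1"
      by (auto simp: type_H3_def trinomial_data_def)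
    obtain i where "i \<in> V (\<rho> 1)" "e i = 1" using lead[OF n'(1)] l' by auto
    moreover obtain j where "j \<in> V (\<rho> 2)" "e j = 1" using lead[OF n'(2)] l' by auto
    ultimately show ?thesis by (rule flexible_H3[OF abc])
  next
    assume H: "type_H4 n' l'"
    then have n': "1 \<le> n' 0" "1 \<le> n' 1" "1 \<le> n' 2" and l': "l' 0 1 = 1" "l' 1 1 = 2" "l' 2 1 = 2"
      and ev: "\<forall>j\<in>{2..n' 1}. even (l' 1 j)" "\<forall>j\<in>{2..n' 2}. even (l' 2 j)"
      by (auto simp: type_H4_def trinomial_data_def)
    obtain p where p: "p \<in> V (\<rho> 0)" "e p = 1" using lead[OF n'(1)] l' by auto
    obtain i where i: "i \<in> V (\<rho> 1)" "e i = 2" using lead[OF n'(2)] l' by auto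
    obtain j where j: "j \<in> V (\<rho> 2)" "e j = 2" using lead[OF n'(3)] l' by auto
    show ?thesis
      by (rule flexible_H4[OF abc p i j]) (use even[of _ 1] even[of _ 2] l' ev in auto)
  next
    assume H: "type_H5 n' l'"
    then have n': "1 \<le> n' 0" "1 \<le> n' 1" "1 \<le> n' 2" by (auto simp: type_H5_def trinomial_data_def)
    have l': "l' k 1 = 2" and ev: "\<forall>j\<in>{2..n' k}. even (l' k j)" if "k \<le> 2" for k
      using H that by (auto simp: type_H5_def)
    obtain p where p: "p \<in> V (\<rho> 0)" "e p = 2" using lead[OF n'(1)] l'[of 0] by auto
    obtain i where i: "i \<in> V (\<rho> 1)" "e i = 2" using lead[OF n'(2)] l'[of 1] by auto
    obtain j where j: "j \<in> V (\<rho> 2)" "e j = 2" using lead[OF n'(3)] l'[of 2] by auto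
    have ev': "even (e v)" if "v \<in> V (\<rho> k)" "k \<le> 2" for v k
      by (rule even[OF that l'[OF that(2)] ev[OF that(2)]])
    have "even (e v)" if "v \<in> I" for v
      using that ev'[of v 0] ev'[of v 1] ev'[of v 2] unfolding I_blocks[OF abc] by auto
    then show ?thesis by (rule flexible_H5[OF abc p i j])
  qed
  then show ?thesis by (simp only: I X)
qed

end
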